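(* Let $\mathcal G$ and $\mathcal H$ be étale, locally compact groupoids and assume $\mathcal G$ to be effective and Hausdorff. If an actor $\mathcal G\to\mathcal H$ induces an isomorphism $C^*(\mathcal G)\to C^*(\mathcal H)$, then it is a groupoid isomorphism; that is, there is an isomorphism of topological groupoids $\varphi\colon\mathcal G\to\mathcal H$ such that the actor is the action $g\cdot h=\varphi(g)h$ with anchor map $h\mapsto\varphi^{-1}(r(h))$.
   Context: Groupoids are étale and locally compact with Hausdorff object space; in general the arrow space may be non-Hausdorff. $\mathcal G^0$ is the object space, $r,s$ are range and source. A groupoid is effective if the interior of its isotropy bundle $\{g:r(g)=s(g)\}$ is the set of units. Actor $\mathcal G\to\mathcal H$: a left (continuous) action of $\mathcal G$ on the arrow space of $\mathcal H$ that commutes with the right translation action of $\mathcal H$. Its anchor map is then of the form $\varrho\circ r$ for a continuous map $\varrho\colon\mathcal H^0\to\mathcal G^0$. $C^*$-algebras: let $\mathfrak S(\mathcal G)$ be the linear span of functions on $\mathcal G$ that are continuous with compact support on some open Hausdorff subset and extended by zero (this is $C_c(\mathcal G)$ in the Hausdorff case), a $*$-algebra under convolution. $C^*(\mathcal G)$ is its completion in the maximal $C^*$-norm. Induced homomorphism: an actor $\mathcal G\to\mathcal H$ induces a nondegenerate $*$-homomorphism $C^*(\mathcal G)\to\mathcal M(C^*(\mathcal H))$ into the multiplier algebra, determined by $(f\cdot\xi)(h)=\sum_{g\in\mathcal G,\ r(g)=\varrho(r(h))}f(g)\,\xi(g^{-1}\cdot h)$ for $f\in\mathfrak S(\mathcal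 G)$, $\xi\in\mathfrak S(\mathcal H)$. It "induces an isomorphism $C^*(\mathcal G)\to C^*(\mathcal H)$" if this homomorphism takes values in $C^*(\mathcal H)$ and is bijective onto $C^*(\mathcal H)$. *)

theory Defs
  imports "HOL-Analysis.Analysis"
begin

section \<open>Topological groupoids\<close>

text \<open>
  Objects are identified with their unit arrows, so range and source take values in the arrow
  space and the object space carries the subspace topology. Composition is only meaningful for
  pairs \<open>g\<close>, \<open>h\<close> with \<open>src g = rng h\<close>. All data live on \<open>topspace (arrtop G)\<close>; the values
  of the operations elsewhere are irrelevant.
\<close>

record 'g groupoid_data =
  arrtop :: "'g topology"
  rng :: "'g \<Rightarrow> 'g"
  src :: "'g \<Rightarrow> 'g"
  gcomp :: "'g \<Rightarrow> 'g \<Rightarrow> 'g"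
  ginv :: "'g \<Rightarrow> 'g"

definition arrows :: "'g groupoid_data \<Rightarrow> 'g set" where
  "arrows G = topspace (arrtop G)"

definition units :: "'g groupoid_data \<Rightarrow> 'g set" where
  "units G = rng G ` arrows G"

definition unit_top :: "'g groupoid_data \<Rightarrow> 'g topology" where
  "unit_top G = subtopology (arrtop G) (units G)"

locale algebraic_groupoid =
  fixes G :: "'g groupoid_data"
  assumes rng_closed: "g \<in> arrows G \<Longrightarrow> rng G g \<in> arrows G"
    and src_closed: "g \<in> arrows G \<Longrightarrow> src G g \<in> arrows G"
    and rng_rng: "g \<in> arrows G \<Longrightarrow> rng G (rng G g) = rng G g"
    and src_rng: "g \<in> arrows G \<Longrightarrow> src G (rng G g) = rng G g"
    and rng_src: "g \<in> arrows G \<Longrightarrow> rng G (src G g) = src G g"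
    and src_src: "g \<in> arrows G \<Longrightarrow> src G (src G g) = src G g"
    and comp_closed:
      "\<lbrakk>g \<in> arrows G; h \<in> arrows G; src G g = rng G h\<rbrakk> \<Longrightarrow> gcomp G g h \<in> arrows G"
    and rng_comp:
      "\<lbrakk>g \<in> arrows G; h \<in> arrows G; src G g = rng G h\<rbrakk> \<Longrightarrow> rng G (gcomp G g h) = rng G g"
    and src_comp:
      "\<lbrakk>g \<in> arrows G; h \<in> arrows G; src G g = rng G h\<rbrakk> \<Longrightarrow> src G (gcomp G g h) = src G h"
    and comp_assoc:
      "\<lbrakk>g \<in> arrows G; h \<in> arrows G; k \<in> arrows G; src G g = rng G h; src G h = rng G k\<rbrakk>
        \<Longrightarrow> gcomp G (gcomp G g h) k = gcomp G g (gcomp G h k)"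
    and comp_rng_left: "g \<in> arrows G \<Longrightarrow> gcomp G (rng G g) g = g"
    and comp_src_right: "g \<in> arrows G \<Longrightarrow> gcomp G g (src G g) = g"
    and inv_closed: "g \<in> arrows G \<Longrightarrow> ginv G g \<in> arrows G"
    and rng_inv: "g \<in> arrows G \<Longrightarrow> rng G (ginv G g) = src G g"
    and src_inv: "g \<in> arrows G \<Longrightarrow> src G (ginv G g) = rng G g"
    and comp_inv_right: "g \<in> arrows G \<Longrightarrow> gcomp G g (ginv G g) = rng G g"
    and comp_inv_left: "g \<in> arrows G \<Longrightarrow> gcomp G (ginv G g) g = src G g"

locale topological_groupoid = algebraic_groupoid G for G :: "'g groupoid_data" +
  assumes continuous_rng: "continuous_map (arrtop G) (unit_top G) (rng G)"
    and continuous_src: "continuous_map (arrtop G) (unit_top G) (src G)"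
    and continuous_inv: "continuous_map (arrtop G) (arrtop G) (ginv G)"
    and continuous_comp:
      "continuous_map
         (subtopology (prod_topology (arrtop G) (arrtop G))
            {(g, h). g \<in> arrows G \<and> h \<in> arrows G \<and> src G g = rng G h})
         (arrtop G) (\<lambda>(g, h). gcomp G g h)"

definition local_homeomorphism :: "'a topology \<Rightarrow> 'b topology \<Rightarrow> ('a \<Rightarrow> 'b) \<Rightarrow> bool" where
  "local_homeomorphism X Y f \<longleftrightarrow>
     (\<forall>x\<in>topspace X. \<exists>U. openin X U \<and> x \<in> U \<and> openin Y (f ` U) \<and>
        homeomorphic_map (subtopology X U) (subtopology Y (f ` U)) f)"

text \<open>
  Only the object space is required to be Hausdorff and locally compact; the arrow space is then
  locally compact and locally Hausdorff, but possibly not Hausdorff.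
\<close>

locale etale_lc_groupoid = topological_groupoid G for G :: "'g groupoid_data" +
  assumes etale_rng: "local_homeomorphism (arrtop G) (unit_top G) (rng G)"
    and etale_src: "local_homeomorphism (arrtop G) (unit_top G) (src G)"
    and Hausdorff_units: "Hausdorff_space (unit_top G)"
    and locally_compact_units: "locally_compact_space (unit_top G)"

definition effective_groupoid :: "'g groupoid_data \<Rightarrow> bool" where
  "effective_groupoid G \<longleftrightarrow>
     (arrtop G) interior_of {g \<in> arrows G. rng G g = src G g} = units G"

definition Hausdorff_groupoid :: "'g groupoid_data \<Rightarrow> bool" where
  "Hausdorff_groupoid G \<longleftrightarrow> Hausdorff_space (arrtop G)"

definition topological_groupoid_iso ::
    "'g groupoid_data \<Rightarrow> 'h groupoid_data \<Rightarrow> ('g \<Rightarrow> 'h) \<Rightarrow> bool" where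
  "topological_groupoid_iso G H \<phi> \<longleftrightarrow>
     homeomorphic_map (arrtop G) (arrtop H) \<phi> \<and>
     (\<forall>g\<in>arrows G. \<phi> (rng G g) = rng H (\<phi> g) \<and> \<phi> (src G g) = src H (\<phi> g)) \<and>
     (\<forall>g\<in>arrows G. \<forall>k\<in>arrows G. src G g = rng G k \<longrightarrow>
        \<phi> (gcomp G g k) = gcomp H (\<phi> g) (\<phi> k))"

section \<open>Actors\<close>

text \<open>
  \<open>anchor\<close> is the anchor map of the left action \<open>act\<close>, with \<open>act g h\<close> meaningful if
  \<open>src G g = anchor h\<close>. The locale \<open>actor\<close> adds that the action commutes with right
  translation.
\<close>

locale groupoid_left_action =
  fixes G :: "'g groupoid_data" and X :: "'x topology"
    and anchor :: "'x \<Rightarrow> 'g" and act :: "'g \<Rightarrow> 'x \<Rightarrow> 'x"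
  assumes continuous_anchor: "continuous_map X (unit_top G) anchor"
    and continuous_act:
      "continuous_map
         (subtopology (prod_topology (arrtop G) X)
            {(g, x). g \<in> arrows G \<and> x \<in> topspace X \<and> src G g = anchor x})
         X (\<lambda>(g, x). act g x)"
    and anchor_act:
      "\<lbrakk>g \<in> arrows G; x \<in> topspace X; src G g = anchor x\<rbrakk> \<Longrightarrow> anchor (act g x) = rng G g"
    and act_comp:
      "\<lbrakk>g \<in> arrows G; k \<in> arrows G; x \<in> topspace X; src G g = rng G k; src G k = anchor x\<rbrakk>
        \<Longrightarrow> act (gcomp G g k) x = act g (act k x)"
    and act_unit: "x \<in> topspace X \<Longrightarrow> act (anchor x) x = x"

locale actor = groupoid_left_action G "arrtop H" anchor act
  for G :: "'g groupoid_data" and H :: "'h groupoid_data"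
    and anchor :: "'h \<Rightarrow> 'g" and act :: "'g \<Rightarrow> 'h \<Rightarrow> 'h" +
  assumes anchor_comp:
      "\<lbrakk>h \<in> arrows H; k \<in> arrows H; src H h = rng H k\<rbrakk> \<Longrightarrow> anchor (gcomp H h k) = anchor h"
    and src_act:
      "\<lbrakk>g \<in> arrows G; h \<in> arrows H; src G g = anchor h\<rbrakk> \<Longrightarrow> src H (act g h) = src H h"
    and act_comp_right:
      "\<lbrakk>g \<in> arrows G; h \<in> arrows H; k \<in> arrows H; src G g = anchor h; src H h = rng H k\<rbrakk>
        \<Longrightarrow> act g (gcomp H h k) = gcomp H (act g h) k"

section \<open>Normed *-algebras, completions and multipliers\<close>

text \<open>
  The records below only collect data. The algebras are not assumed to be unital, and the norm
  may be a seminorm.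
\<close>

record 'a star_algebra =
  acarrier :: "'a set"
  azero :: 'a
  aadd :: "'a \<Rightarrow> 'a \<Rightarrow> 'a"
  ascale :: "complex \<Rightarrow> 'a \<Rightarrow> 'a"
  amult :: "'a \<Rightarrow> 'a \<Rightarrow> 'a"
  astar :: "'a \<Rightarrow> 'a"

record 'a normed_star_algebra = "'a star_algebra" +
  anorm :: "'a \<Rightarrow> real"

definition adist :: "'a normed_star_algebra \<Rightarrow> 'a \<Rightarrow> 'a \<Rightarrow> real" where
  "adist A a b = anorm A (aadd A a (ascale A (-1) b))"

inductive_set lin_span :: "('a, 'z) star_algebra_scheme \<Rightarrow> 'a set \<Rightarrow> 'a set"
  for A :: "('a, 'z) star_algebra_scheme" and S :: "'a set" where
  zero: "azero A \<in> lin_span A S"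
| step: "\<lbrakk>s \<in> S; x \<in> lin_span A S\<rbrakk> \<Longrightarrow> aadd A (ascale A c s) x \<in> lin_span A S"

definition star_hom ::
    "('a, 'y) star_algebra_scheme \<Rightarrow> ('b, 'z) star_algebra_scheme \<Rightarrow> ('a \<Rightarrow> 'b) \<Rightarrow> bool" where
  "star_hom A B \<Phi> \<longleftrightarrow>
     \<Phi> \<in> acarrier A \<rightarrow> acarrier B \<and>
     (\<forall>a\<in>acarrier A. \<forall>b\<in>acarrier A. \<Phi> (aadd A a b) = aadd B (\<Phi> a) (\<Phi> b)) \<and>
     (\<forall>c. \<forall>a\<in>acarrier A. \<Phi> (ascale A c a) = ascale B c (\<Phi> a)) \<and>
     (\<forall>a\<in>acarrier A. \<forall>b\<in>acarrier A. \<Phi> (amult A a b) = amult B (\<Phi> a) (\<Phi> b)) \<and>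
     (\<forall>a\<in>acarrier A. \<Phi> (astar A a) = astar B (\<Phi> a))"

definition cstar_seminorm :: "('a, 'z) star_algebra_scheme \<Rightarrow> ('a \<Rightarrow> real) \<Rightarrow> bool" where
  "cstar_seminorm A p \<longleftrightarrow>
     (\<forall>a\<in>acarrier A. 0 \<le> p a) \<and>
     (\<forall>a\<in>acarrier A. \<forall>b\<in>acarrier A. p (aadd A a b) \<le> p a + p b) \<and>
     (\<forall>c. \<forall>a\<in>acarrier A. p (ascale A c a) = cmod c * p a) \<and>
     (\<forall>a\<in>acarrier A. \<forall>b\<in>acarrier A. p (amult A a b) \<le> p a * p b) \<and>
     (\<forall>a\<in>acarrier A. p (amult A (astar A a) a) = (p a)\<^sup>2)"

text \<open>
  For the convolution algebra of an etale groupoid the supremum is finite, and it is a norm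
  because the reduced norm is one of the competitors.
\<close>

definition max_cstar_norm :: "('a, 'z) star_algebra_scheme \<Rightarrow> 'a \<Rightarrow> real" where
  "max_cstar_norm A a = (SUP p\<in>{p. cstar_seminorm A p}. p a)"

text \<open>The completion consists of Cauchy sequences modulo sequences converging to zero.\<close>

definition cauchy_seqs :: "'a normed_star_algebra \<Rightarrow> (nat \<Rightarrow> 'a) set" where
  "cauchy_seqs A = {u. (\<forall>n. u n \<in> acarrier A) \<and>
     (\<forall>e>0. \<exists>N. \<forall>m\<ge>N. \<forall>n\<ge>N. adist A (u m) (u n) < e)}"

definition cauchy_rel :: "'a normed_star_algebra \<Rightarrow> ((nat \<Rightarrow> 'a) \<times> (nat \<Rightarrow> 'a)) set" where
  "cauchy_rel A = {(u, v). u \<in> cauchy_seqs A \<and> v \<in> cauchy_seqs A \<and>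
     (\<lambda>n. adist A (u n) (v n)) \<longlonglongrightarrow> 0}"

definition cauchy_class :: "'a normed_star_algebra \<Rightarrow> (nat \<Rightarrow> 'a) \<Rightarrow> (nat \<Rightarrow> 'a) set" where
  "cauchy_class A u = cauchy_rel A `` {u}"

definition cauchy_rep :: "(nat \<Rightarrow> 'a) set \<Rightarrow> nat \<Rightarrow> 'a" where
  "cauchy_rep X = (SOME u. u \<in> X)"

definition completion :: "'a normed_star_algebra \<Rightarrow> (nat \<Rightarrow> 'a) set normed_star_algebra" where
  "completion A = \<lparr>
     acarrier = cauchy_seqs A // cauchy_rel A,
     azero = cauchy_class A (\<lambda>_. azero A),
     aadd = (\<lambda>X Y. cauchy_class A (\<lambda>n. aadd A (cauchy_rep X n) (cauchy_rep Y n))),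
     ascale = (\<lambda>c X. cauchy_class A (\<lambda>n. ascale A c (cauchy_rep X n))),
     amult = (\<lambda>X Y. cauchy_class A (\<lambda>n. amult A (cauchy_rep X n) (cauchy_rep Y n))),
     astar = (\<lambda>X. cauchy_class A (\<lambda>n. astar A (cauchy_rep X n))),
     anorm = (\<lambda>X. lim (\<lambda>n. anorm A (cauchy_rep X n)))\<rparr>"

definition to_completion :: "'a normed_star_algebra \<Rightarrow> 'a \<Rightarrow> (nat \<Rightarrow> 'a) set" where
  "to_completion A a = cauchy_class A (\<lambda>_. a)"

text \<open>
  Multipliers are double centralizers \<open>(L, R)\<close>; for a C*-algebra the two maps are automatically
  linear and bounded. They are extensional functions, so that equality of multipliers is equality
  of pairs.
\<close>

definition multiplier_algebra ::
    "'a normed_star_algebra \<Rightarrow> (('a \<Rightarrow> 'a) \<times> ('a \<Rightarrow> 'a)) normed_star_algebra" where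
  "multiplier_algebra A = \<lparr>
     acarrier = {(L, R). L \<in> acarrier A \<rightarrow>\<^sub>E acarrier A \<and> R \<in> acarrier A \<rightarrow>\<^sub>E acarrier A \<and>
       (\<forall>a\<in>acarrier A. \<forall>b\<in>acarrier A. amult A a (L b) = amult A (R a) b)},
     azero = (\<lambda>a\<in>acarrier A. azero A, \<lambda>a\<in>acarrier A. azero A),
     aadd = (\<lambda>(L, R) (L', R').
       (\<lambda>a\<in>acarrier A. aadd A (L a) (L' a), \<lambda>a\<in>acarrier A. aadd A (R a) (R' a))),
     ascale = (\<lambda>c (L, R).
       (\<lambda>a\<in>acarrier A. ascale A c (L a), \<lambda>a\<in>acarrier A. ascale A c (R a))),
     amult = (\<lambda>(L, R) (L', R').
       (\<lambda>a\<in>acarrier A. L (L' a), \<lambda>a\<in>acarrier A. R' (R a))),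
     astar = (\<lambda>(L, R).
       (\<lambda>a\<in>acarrier A. astar A (R (astar A a)), \<lambda>a\<in>acarrier A. astar A (L (astar A a)))),
     anorm = (\<lambda>(L, R). SUP a\<in>{a \<in> acarrier A. anorm A a \<le> 1}. anorm A (L a))\<rparr>"

definition to_multiplier :: "'a normed_star_algebra \<Rightarrow> 'a \<Rightarrow> ('a \<Rightarrow> 'a) \<times> ('a \<Rightarrow> 'a)" where
  "to_multiplier A a = (\<lambda>b\<in>acarrier A. amult A a b, \<lambda>b\<in>acarrier A. amult A b a)"

definition nondegenerate ::
    "'a normed_star_algebra \<Rightarrow> 'b normed_star_algebra \<Rightarrow> ('a \<Rightarrow> ('b \<Rightarrow> 'b) \<times> ('b \<Rightarrow> 'b)) \<Rightarrow> bool"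
  where
  "nondegenerate A B \<Phi> \<longleftrightarrow>
     (\<forall>b\<in>acarrier B. \<forall>e>0.
        \<exists>x\<in>lin_span B {fst (\<Phi> a) y |a y. a \<in> acarrier A \<and> y \<in> acarrier B}. adist B b x < e)"

section \<open>Groupoid C*-algebras and induced homomorphisms\<close>

definition local_cc :: "'g groupoid_data \<Rightarrow> ('g \<Rightarrow> complex) set" where
  "local_cc G = {f. \<exists>U. openin (arrtop G) U \<and> Hausdorff_space (subtopology (arrtop G) U) \<and>
     continuous_map (subtopology (arrtop G) U) euclidean f \<and>
     compactin (subtopology (arrtop G) U)
       ((subtopology (arrtop G) U) closure_of {g \<in> U. f g \<noteq> 0}) \<and>
     (\<forall>g. g \<notin> U \<longrightarrow> f g = 0)}"

definition qcc :: "'g groupoid_data \<Rightarrow> ('g \<Rightarrow> complex) set" where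
  "qcc G = {f. \<exists>(n::nat) c F. (\<forall>i<n. F i \<in> local_cc G) \<and> f = (\<lambda>g. \<Sum>i<n. c i * F i g)}"

text \<open>
  The sums here and in \<open>actor_act\<close> have only finitely many non-zero terms: functions in
  \<open>qcc G\<close> have finite support on every range fibre. Functions vanish outside the arrow space.
\<close>

definition convolution ::
    "'g groupoid_data \<Rightarrow> ('g \<Rightarrow> complex) \<Rightarrow> ('g \<Rightarrow> complex) \<Rightarrow> 'g \<Rightarrow> complex" where
  "convolution G f f' g =
     (if g \<in> arrows G
      then \<Sum>\<^sub>\<infinity>k\<in>{k \<in> arrows G. rng G k = rng G g}. f k * f' (gcomp G (ginv G k) g)
      else 0)"

definition involution :: "'g groupoid_data \<Rightarrow> ('g \<Rightarrow> complex) \<Rightarrow> 'g \<Rightarrow> complex" where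
  "involution G f g = (if g \<in> arrows G then cnj (f (ginv G g)) else 0)"

definition conv_algebra :: "'g groupoid_data \<Rightarrow> ('g \<Rightarrow> complex) star_algebra" where
  "conv_algebra G = \<lparr>
     acarrier = qcc G,
     azero = (\<lambda>_. 0),
     aadd = (\<lambda>f f' g. f g + f' g),
     ascale = (\<lambda>c f g. c * f g),
     amult = convolution G,
     astar = involution G\<rparr>"

definition normed_conv_algebra :: "'g groupoid_data \<Rightarrow> ('g \<Rightarrow> complex) normed_star_algebra" where
  "normed_conv_algebra G =
     star_algebra.extend (conv_algebra G) \<lparr>anorm = max_cstar_norm (conv_algebra G)\<rparr>"

definition groupoid_cstar ::
    "'g groupoid_data \<Rightarrow> (nat \<Rightarrow> 'g \<Rightarrow> complex) set normed_star_algebra" where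
  "groupoid_cstar G = completion (normed_conv_algebra G)"

definition to_cstar ::
    "'g groupoid_data \<Rightarrow> ('g \<Rightarrow> complex) \<Rightarrow> (nat \<Rightarrow> 'g \<Rightarrow> complex) set" where
  "to_cstar G f = to_completion (normed_conv_algebra G) f"

text \<open>The map written \<open>\<rho>\<close> in the anchor map \<open>\<rho> \<circ> r\<close> is the restriction of \<open>anchor\<close> to units.\<close>

definition actor_act ::
    "'g groupoid_data \<Rightarrow> 'h groupoid_data \<Rightarrow> ('h \<Rightarrow> 'g) \<Rightarrow> ('g \<Rightarrow> 'h \<Rightarrow> 'h) \<Rightarrow>
     ('g \<Rightarrow> complex) \<Rightarrow> ('h \<Rightarrow> complex) \<Rightarrow> 'h \<Rightarrow> complex" where
  "actor_act G H anchor act f \<xi> h =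
     (if h \<in> arrows H
      then \<Sum>\<^sub>\<infinity>g\<in>{g \<in> arrows G. rng G g = anchor (rng H h)}. f g * \<xi> (act (ginv G g) h)
      else 0)"

text \<open>
  The conditions determine \<open>\<Phi>\<close> on the carrier of \<open>groupoid_cstar G\<close>, because \<open>qcc G\<close> and
  \<open>qcc H\<close> are dense in the C*-algebras.
\<close>

definition induced_hom ::
    "'g groupoid_data \<Rightarrow> 'h groupoid_data \<Rightarrow> ('h \<Rightarrow> 'g) \<Rightarrow> ('g \<Rightarrow> 'h \<Rightarrow> 'h) \<Rightarrow>
     ((nat \<Rightarrow> 'g \<Rightarrow> complex) set \<Rightarrow>
        ((nat \<Rightarrow> 'h \<Rightarrow> complex) set \<Rightarrow> (nat \<Rightarrow> 'h \<Rightarrow> complex) set) \<times>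
        ((nat \<Rightarrow> 'h \<Rightarrow> complex) set \<Rightarrow> (nat \<Rightarrow> 'h \<Rightarrow> complex) set)) \<Rightarrow> bool" where
  "induced_hom G H anchor act \<Phi> \<longleftrightarrow>
     star_hom (groupoid_cstar G) (multiplier_algebra (groupoid_cstar H)) \<Phi> \<and>
     nondegenerate (groupoid_cstar G) (groupoid_cstar H) \<Phi> \<and>
     (\<forall>f\<in>qcc G. \<forall>\<xi>\<in>qcc H.
        fst (\<Phi> (to_cstar G f)) (to_cstar H \<xi>) = to_cstar H (actor_act G H anchor act f \<xi>))"

definition induces_isomorphism ::
    "'g groupoid_data \<Rightarrow> 'h groupoid_data \<Rightarrow> ('h \<Rightarrow> 'g) \<Rightarrow> ('g \<Rightarrow> 'h \<Rightarrow> 'h) \<Rightarrow> bool" where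
  "induces_isomorphism G H anchor act \<longleftrightarrow>
     (\<exists>\<Phi>. induced_hom G H anchor act \<Phi> \<and>
        bij_betw \<Phi> (acarrier (groupoid_cstar G))
          (to_multiplier (groupoid_cstar H) ` acarrier (groupoid_cstar H)))"

end

theory Submission
  imports Defs
begin

text \<open>
  Let \<open>\<rho>\<close> be the map on object spaces given by the anchor. The induced isomorphism \<open>\<Psi>\<close> sends
  \<open>f\<close> in \<open>C\<^sub>c(G\<^sup>0)\<close> to \<open>f \<circ> \<rho>\<close>, so \<open>\<Psi>\<close> maps the commutant of \<open>C\<^sub>0(G\<^sup>0)\<close> onto an algebra that
  contains \<open>C\<^sub>c(H\<^sup>0)\<close>. Because \<open>G\<close> is Hausdorff and effective, the coefficient functions of
  this commutant live on units. Evaluating them at an object \<open>x\<close> of \<open>G\<close> gives a character of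
  \<open>C\<^sub>c(H\<^sup>0)\<close>, hence a point \<open>\<sigma> x\<close>, and \<open>\<sigma>\<close> is a continuous section of \<open>\<rho>\<close>. Then
  \<open>\<phi> g = g \<cdot> \<sigma> (s g)\<close> is an injective homomorphism onto the restriction of \<open>H\<close> to the closed
  set \<open>F = \<sigma>(G\<^sup>0)\<close>. Coefficient functions only see the reduced C*-algebra and cannot show that
  \<open>F\<close> is everything; but restriction along \<open>\<phi>\<close> is contractive for the maximal norms and is a
  left inverse of \<open>\<Psi>\<close>, so a function on \<open>H\<^sup>0\<close> that vanishes on \<open>F\<close> is zero.
\<close>

section \<open>Star algebras with C*-seminorms\<close>

text \<open>\<open>star_hom\<close> is a purely algebraic notion, so continuity of \<Psi> is not
  given, yet every argument about coefficients passes to limits of functions. Contractivity is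
  therefore proved, without spectral theory: a self-adjoint \<open>h\<close> of norm below 1 solves
  an equation \<open>h h + k k = 2 k\<close>, which makes \<open>h\<close> an average of two
  unitaries of the unitization and bounds it by 1 in every C*-seminorm. The same equation, solved
  pointwise by real functions, bounds all C*-seminorms on the convolution algebra. Lower bounds come
  from the regular representations, kept as seminorms without Hilbert spaces. The arrow space of
  \<open>H\<close> may be non-Hausdorff. Functions in \<open>qcc H\<close> need not be continuous
  and compact sets need not be closed, so supports are recorded by compact subsets of open
  bisections, and continuity is used only on open Hausdorff sets and on objects. For
  \<open>G\<close>, continuity holds globally and makes the non-zero sets of coefficient functions
  open, as an appeal to effectiveness requires. Properness of \<rho>, without which
  \<open>f \<circ> \<rho>\<close> would not have compact support, is derived: \<Psi> takes values in
  the algebra of \<open>H\<close> and not just in its multipliers.\<close>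

locale star_alg =
  fixes A :: "('a, 'z) star_algebra_scheme"
  assumes zero_closed [simp]: "azero A \<in> acarrier A"
    and add_closed [simp]: "\<lbrakk>x \<in> acarrier A; y \<in> acarrier A\<rbrakk> \<Longrightarrow> aadd A x y \<in> acarrier A"
    and scale_closed [simp]: "x \<in> acarrier A \<Longrightarrow> ascale A c x \<in> acarrier A"
    and mult_closed [simp]: "\<lbrakk>x \<in> acarrier A; y \<in> acarrier A\<rbrakk> \<Longrightarrow> amult A x y \<in> acarrier A"
    and star_closed [simp]: "x \<in> acarrier A \<Longrightarrow> astar A x \<in> acarrier A"
    and add_assoc: "\<lbrakk>x \<in> acarrier A; y \<in> acarrier A; z \<in> acarrier A\<rbrakk>
      \<Longrightarrow> aadd A (aadd A x y) z = aadd A x (aadd A y z)"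
    and add_commute: "\<lbrakk>x \<in> acarrier A; y \<in> acarrier A\<rbrakk> \<Longrightarrow> aadd A x y = aadd A y x"
    and add_zero [simp]: "x \<in> acarrier A \<Longrightarrow> aadd A (azero A) x = x"
    and scale_add_right: "\<lbrakk>x \<in> acarrier A; y \<in> acarrier A\<rbrakk>
      \<Longrightarrow> ascale A c (aadd A x y) = aadd A (ascale A c x) (ascale A c y)"
    and scale_add_left: "x \<in> acarrier A
      \<Longrightarrow> ascale A (c + d) x = aadd A (ascale A c x) (ascale A d x)"
    and scale_scale [simp]: "x \<in> acarrier A \<Longrightarrow> ascale A c (ascale A d x) = ascale A (c * d) x"
    and scale_one [simp]: "x \<in> acarrier A \<Longrightarrow> ascale A 1 x = x"
    and scale_zero [simp]: "x \<in> acarrier A \<Longrightarrow> ascale A 0 x = azero A"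
    and mult_assoc: "\<lbrakk>x \<in> acarrier A; y \<in> acarrier A; z \<in> acarrier A\<rbrakk>
      \<Longrightarrow> amult A (amult A x y) z = amult A x (amult A y z)"
    and mult_add_right: "\<lbrakk>x \<in> acarrier A; y \<in> acarrier A; z \<in> acarrier A\<rbrakk>
      \<Longrightarrow> amult A x (aadd A y z) = aadd A (amult A x y) (amult A x z)"
    and mult_add_left: "\<lbrakk>x \<in> acarrier A; y \<in> acarrier A; z \<in> acarrier A\<rbrakk>
      \<Longrightarrow> amult A (aadd A x y) z = aadd A (amult A x z) (amult A y z)"
    and mult_scale_right [simp]: "\<lbrakk>x \<in> acarrier A; y \<in> acarrier A\<rbrakk>
      \<Longrightarrow> amult A x (ascale A c y) = ascale A c (amult A x y)"
    and mult_scale_left [simp]: "\<lbrakk>x \<in> acarrier A; y \<in> acarrier A\<rbrakk>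
      \<Longrightarrow> amult A (ascale A c x) y = ascale A c (amult A x y)"
    and star_add: "\<lbrakk>x \<in> acarrier A; y \<in> acarrier A\<rbrakk>
      \<Longrightarrow> astar A (aadd A x y) = aadd A (astar A x) (astar A y)"
    and star_scale: "x \<in> acarrier A \<Longrightarrow> astar A (ascale A c x) = ascale A (cnj c) (astar A x)"
    and star_mult: "\<lbrakk>x \<in> acarrier A; y \<in> acarrier A\<rbrakk>
      \<Longrightarrow> astar A (amult A x y) = amult A (astar A y) (astar A x)"
    and star_star [simp]: "x \<in> acarrier A \<Longrightarrow> astar A (astar A x) = x"
begin

abbreviation carrier_set ("\<C>") where "\<C> \<equiv> acarrier A"
abbreviation plus_alg (infixl "\<oplus>" 65) where "x \<oplus> y \<equiv> aadd A x y"
abbreviation scale_alg (infixr "\<odot>" 75) where "c \<odot> x \<equiv> ascale A c x"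
abbreviation mult_alg (infixl "\<otimes>" 70) where "x \<otimes> y \<equiv> amult A x y"
abbreviation star_op ("_\<^sup>\<star>" [1000] 1000) where "x\<^sup>\<star> \<equiv> astar A x"
abbreviation minus_alg (infixl "\<ominus>" 65) where "x \<ominus> y \<equiv> aadd A x (ascale A (-1) y)"

lemma add_left_commute:
  "\<lbrakk>x \<in> \<C>; y \<in> \<C>; z \<in> \<C>\<rbrakk> \<Longrightarrow> x \<oplus> (y \<oplus> z) = y \<oplus> (x \<oplus> z)"
  by (metis add_assoc add_commute)

lemmas add_ac = add_assoc add_commute add_left_commute

lemma add_zero_right [simp]: "x \<in> \<C> \<Longrightarrow> x \<oplus> azero A = x"
  by (metis add_commute add_zero zero_closed)

lemma diff_self [simp]: "x \<in> \<C> \<Longrightarrow> x \<ominus> x = azero A"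
  using scale_add_left[of x 1 "-1"] by simp

lemma scale_azero [simp]: "c \<odot> azero A = azero A"
  by (metis mult_zero_right scale_scale scale_zero zero_closed)

lemma diff_self_left [simp]:
  assumes "x \<in> \<C>" "z \<in> \<C>" shows "x \<oplus> ((-1) \<odot> x \<oplus> z) = z"
  using assms by (subst add_assoc[symmetric]) auto

lemma diff_self_left2 [simp]:
  assumes "x \<in> \<C>" "z \<in> \<C>" shows "(-1) \<odot> x \<oplus> (x \<oplus> z) = z"
  using assms by (subst add_left_commute) auto

lemma diff_self2 [simp]: "x \<in> \<C> \<Longrightarrow> (-1) \<odot> x \<oplus> x = azero A"
  by (simp add: add_commute)

lemma diff_triangle:
  assumes "x \<in> \<C>" "y \<in> \<C>" "z \<in> \<C>" shows "x \<ominus> z = (x \<ominus> y) \<oplus> (y \<ominus> z)"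
  using assms by (simp add: add_assoc)

lemma diff_add_cancel: "\<lbrakk>x \<in> \<C>; y \<in> \<C>\<rbrakk> \<Longrightarrow> (x \<ominus> y) \<oplus> y = x"
  by (simp add: add_assoc)

lemma diff_eq_zero: "\<lbrakk>x \<in> \<C>; y \<in> \<C>; x \<ominus> y = azero A\<rbrakk> \<Longrightarrow> x = y"
  by (metis diff_add_cancel add_zero)

lemma diff_add_add:
  assumes "x \<in> \<C>" "y \<in> \<C>" "x' \<in> \<C>" "y' \<in> \<C>"
  shows "(x \<oplus> y) \<ominus> (x' \<oplus> y') = (x \<ominus> x') \<oplus> (y \<ominus> y')"
  using assms by (simp add: scale_add_right add_ac)

lemma diff_scale: "\<lbrakk>x \<in> \<C>; y \<in> \<C>\<rbrakk> \<Longrightarrow> c \<odot> x \<ominus> c \<odot> y = c \<odot> (x \<ominus> y)"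
  by (simp add: scale_add_right)

lemma diff_mult:
  assumes "x \<in> \<C>" "y \<in> \<C>" "x' \<in> \<C>" "y' \<in> \<C>"
  shows "x \<otimes> y \<ominus> x' \<otimes> y' = x \<otimes> (y \<ominus> y') \<oplus> (x \<ominus> x') \<otimes> y'"
  using assms by (simp add: mult_add_left mult_add_right add_assoc)

lemma diff_star: "\<lbrakk>x \<in> \<C>; y \<in> \<C>\<rbrakk> \<Longrightarrow> x\<^sup>\<star> \<ominus> y\<^sup>\<star> = (x \<ominus> y)\<^sup>\<star>"
  by (simp add: star_add star_scale)

lemma mult_azero [simp]: "x \<in> \<C> \<Longrightarrow> x \<otimes> azero A = azero A" "x \<in> \<C> \<Longrightarrow> azero A \<otimes> x = azero A"
  using mult_scale_right[of x "azero A" 0] mult_scale_left[of "azero A" x 0] by auto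

lemma star_azero [simp]: "astar A (azero A) = azero A"
  using star_scale[of "azero A" 0] by simp

text \<open>With \<open>h\<^sup>2 + k\<^sup>2 = 2 k\<close>, the element \<open>h + i (1 - k)\<close> of the unitization is unitary.\<close>

lemma unitary_trick:
  assumes h: "h \<in> \<C>" "h\<^sup>\<star> = h" and k: "k \<in> \<C>" "k\<^sup>\<star> = k" and hk: "h \<otimes> k = k \<otimes> h"
    and eq: "h \<otimes> h \<oplus> k \<otimes> k = 2 \<odot> k" and x: "x \<in> \<C>" and c: "cnj c * c = 1" "c + cnj c = 0"
  defines "u \<equiv> h \<otimes> x \<oplus> c \<odot> (x \<ominus> k \<otimes> x)"
  shows "u\<^sup>\<star> \<otimes> u = x\<^sup>\<star> \<otimes> x"
proof -
  define y where "y = h \<otimes> x"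
  define w where "w = k \<otimes> x"
  have [simp]: "y \<in> \<C>" "w \<in> \<C>" "x \<in> \<C>" using h k x by (auto simp: y_def w_def)
  have ys: "y\<^sup>\<star> = x\<^sup>\<star> \<otimes> h" and ws: "w\<^sup>\<star> = x\<^sup>\<star> \<otimes> k"
    using h k x by (simp_all add: y_def w_def star_mult)
  have yw: "y\<^sup>\<star> \<otimes> w = w\<^sup>\<star> \<otimes> y"
    unfolding ys ws unfolding y_def w_def using h k x
    by (simp add: mult_assoc) (simp add: mult_assoc[symmetric] hk)
  have xy: "x\<^sup>\<star> \<otimes> y = y\<^sup>\<star> \<otimes> x" and xw: "x\<^sup>\<star> \<otimes> w = w\<^sup>\<star> \<otimes> x"
    unfolding ys ws unfolding y_def w_def using h k x by (simp_all add: mult_assoc)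
  have "y\<^sup>\<star> \<otimes> y \<oplus> w\<^sup>\<star> \<otimes> w = x\<^sup>\<star> \<otimes> ((h \<otimes> h \<oplus> k \<otimes> k) \<otimes> x)"
    unfolding ys ws unfolding y_def w_def using h k x
    by (simp add: mult_assoc mult_add_left mult_add_right)
  also have "\<dots> = 2 \<odot> (w\<^sup>\<star> \<otimes> x)" unfolding eq ws using k x by (simp add: mult_assoc)
  finally have yyww: "y\<^sup>\<star> \<otimes> y \<oplus> w\<^sup>\<star> \<otimes> w = 2 \<odot> (w\<^sup>\<star> \<otimes> x)" .
  define z where "z = x \<ominus> w"
  have z[simp]: "z \<in> \<C>" by (simp add: z_def)
  \<comment> \<open>With \<open>u = y + c z\<close> the cross terms of \<open>u* u\<close> are
    \<open>c (y* z)\<close> and \<open>cnj c (z* y)\<close>. This equality merges them into a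
    multiple of \<open>c + cnj c\<close>, which is zero.\<close>
  have yz: "y\<^sup>\<star> \<otimes> z = z\<^sup>\<star> \<otimes> y"
    by (simp add: z_def mult_add_right mult_add_left star_add star_scale xy yw)
  have zz: "z\<^sup>\<star> \<otimes> z = x\<^sup>\<star> \<otimes> x \<oplus> ((-2) \<odot> (w\<^sup>\<star> \<otimes> x) \<oplus> w\<^sup>\<star> \<otimes> w)"
  proof -
    have "z\<^sup>\<star> \<otimes> z = x\<^sup>\<star> \<otimes> x \<oplus> (((-1) \<odot> (w\<^sup>\<star> \<otimes> x) \<oplus> (-1) \<odot> (w\<^sup>\<star> \<otimes> x)) \<oplus> w\<^sup>\<star> \<otimes> w)"
      by (simp add: z_def mult_add_right mult_add_left star_add star_scale xw scale_add_right add_ac)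
    then show ?thesis by (simp add: scale_add_left[symmetric])
  qed
  have "u\<^sup>\<star> \<otimes> u = y\<^sup>\<star> \<otimes> y \<oplus> ((c \<odot> (z\<^sup>\<star> \<otimes> y) \<oplus> cnj c \<odot> (z\<^sup>\<star> \<otimes> y)) \<oplus> z\<^sup>\<star> \<otimes> z)"
    using c(1) by (simp add: u_def y_def[symmetric] w_def[symmetric] z_def[symmetric] star_add star_scale
        mult_add_right mult_add_left yz scale_add_right add_ac mult.commute)
  also have "\<dots> = y\<^sup>\<star> \<otimes> y \<oplus> z\<^sup>\<star> \<otimes> z"
    using c(2) by (simp add: scale_add_left[symmetric])
  also have "\<dots> = x\<^sup>\<star> \<otimes> x \<oplus> ((y\<^sup>\<star> \<otimes> y \<oplus> w\<^sup>\<star> \<otimes> w) \<oplus> (-2) \<odot> (w\<^sup>\<star> \<otimes> x))"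
    unfolding zz by (simp add: add_ac)
  also have "\<dots> = x\<^sup>\<star> \<otimes> x"
    unfolding yyww by (simp add: scale_add_left[symmetric])
  finally show ?thesis .
qed

end

section \<open>C*-seminorms and their supremum\<close>

locale star_seminorm = star_alg A for A :: "('a, 'z) star_algebra_scheme" +
  fixes N :: "'a \<Rightarrow> real"
  assumes N_cstar: "cstar_seminorm A N"
begin

lemma N_nonneg [simp]: "a \<in> \<C> \<Longrightarrow> 0 \<le> N a"
  and N_add: "\<lbrakk>a \<in> \<C>; b \<in> \<C>\<rbrakk> \<Longrightarrow> N (a \<oplus> b) \<le> N a + N b"
  and N_scale [simp]: "a \<in> \<C> \<Longrightarrow> N (c \<odot> a) = cmod c * N a"
  and N_mult: "\<lbrakk>a \<in> \<C>; b \<in> \<C>\<rbrakk> \<Longrightarrow> N (a \<otimes> b) \<le> N a * N b"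
  and N_star_mult: "a \<in> \<C> \<Longrightarrow> N (a\<^sup>\<star> \<otimes> a) = (N a)\<^sup>2"
  using N_cstar by (auto simp: cstar_seminorm_def)

lemma N_zero [simp]: "N (azero A) = 0"
  using N_scale[of "azero A" 0] by simp

text \<open>The C*-identity and submultiplicativity bound the seminorm of an element by that of its
  adjoint; applied to the adjoint this gives the converse.\<close>

lemma N_star [simp]: assumes "a \<in> \<C>" shows "N (a\<^sup>\<star>) = N a"
proof -
  have le: "N b \<le> N (b\<^sup>\<star>)" if "b \<in> \<C>" for b
  proof (cases "N b = 0")
    case False
    have "N b * N b \<le> N (b\<^sup>\<star>) * N b"
      using N_star_mult[OF that] N_mult[of "b\<^sup>\<star>" b] that by (simp add: power2_eq_square)
    then show ?thesis using False N_nonneg[OF that] by (simp add: mult_le_cancel_right)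
  qed (use that in auto)
  show ?thesis using le[of a] le[of "a\<^sup>\<star>"] assms by auto
qed

lemma N_diff_commute: assumes "a \<in> \<C>" "b \<in> \<C>" shows "N (a \<ominus> b) = N (b \<ominus> a)"
proof -
  have "b \<ominus> a = (-1) \<odot> (a \<ominus> b)"
    using assms by (simp add: scale_add_right add_commute)
  then show ?thesis using assms by simp
qed

lemma N_diff_triangle:
  assumes "a \<in> \<C>" "b \<in> \<C>" "c \<in> \<C>" shows "N (a \<ominus> c) \<le> N (a \<ominus> b) + N (b \<ominus> c)"
  using N_add[of "a \<ominus> b" "b \<ominus> c"] diff_triangle[OF assms] assms by simp

lemma N_le_diff: assumes "a \<in> \<C>" "b \<in> \<C>" shows "N a \<le> N (a \<ominus> b) + N b"
  using N_add[of "a \<ominus> b" b] diff_add_cancel[OF assms] assms by simp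

lemma N_abs_diff: assumes "a \<in> \<C>" "b \<in> \<C>" shows "\<bar>N a - N b\<bar> \<le> N (a \<ominus> b)"
  using N_le_diff[of a b] N_le_diff[of b a] N_diff_commute[of a b] assms by auto

text \<open>Left multiplication by \<open>h\<close> is the average of the maps of
  \<open>unitary_trick\<close> for \<open>c = \<i>\<close> and \<open>c = -\<i>\<close>, each of
  which preserves \<open>N\<close>. An algebraic equation thus bounds \<open>h\<close> in every
  C*-seminorm at once.\<close>

lemma N_le_one:
  assumes h: "h \<in> \<C>" "h\<^sup>\<star> = h" and k: "k \<in> \<C>" "k\<^sup>\<star> = k" and hk: "h \<otimes> k = k \<otimes> h"
    and eq: "h \<otimes> h \<oplus> k \<otimes> k = 2 \<odot> k"
  shows "N h \<le> 1"
proof -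
  have le: "N (h \<otimes> x) \<le> N x" if x: "x \<in> \<C>" for x
  proof -
    define u where "u c = h \<otimes> x \<oplus> c \<odot> (x \<ominus> k \<otimes> x)" for c
    have uC: "u c \<in> \<C>" for c using h k x by (simp add: u_def)
    have Nu: "N (u c) = N x" if c: "cnj c * c = 1" "c + cnj c = 0" for c
    proof -
      have "(N (u c))\<^sup>2 = (N x)\<^sup>2"
        using unitary_trick[OF h k hk eq x c] N_star_mult[OF uC, of c] N_star_mult[OF x]
        by (simp add: u_def)
      then show ?thesis using uC x by simp
    qed
    have "u \<i> \<oplus> u (- \<i>) = (h \<otimes> x \<oplus> h \<otimes> x) \<oplus> (\<i> \<odot> (x \<ominus> k \<otimes> x) \<oplus> (- \<i>) \<odot> (x \<ominus> k \<otimes> x))"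
      using h k x by (simp add: u_def add_ac)
    also have "\<dots> = 2 \<odot> (h \<otimes> x)"
      using h k x by (simp add: scale_add_left[of "h \<otimes> x" 1 1, simplified]
          scale_add_left[of "x \<ominus> k \<otimes> x" \<i> "-\<i>", symmetric])
    finally have "2 * N (h \<otimes> x) = N (u \<i> \<oplus> u (- \<i>))" using h x by simp
    also have "\<dots> \<le> N (u \<i>) + N (u (- \<i>))" by (rule N_add[OF uC uC])
    also have "\<dots> = 2 * N x" by (simp add: Nu)
    finally show ?thesis by simp
  qed
  \<comment> \<open>There may be no unit to test on, so the bound is applied to
    \<open>x = h\<close>, where the C*-identity turns it into
    \<open>(N h)^2 \<le> N h\<close>.\<close>
  have "N h * N h \<le> N h" using le[OF h(1)] N_star_mult[OF h(1)] h(2) by (simp add: power2_eq_square)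
  then show ?thesis using N_nonneg[OF h(1)] by (cases "N h = 0") (auto simp: mult_le_cancel_left1)
qed

end

lemma (in star_alg) star_seminormI: "cstar_seminorm A p \<Longrightarrow> star_seminorm A p"
  by (simp add: star_seminorm_axioms.intro star_seminorm_def star_alg_axioms)

text \<open>Pointwise boundedness is assumed because the supremum of an unbounded set of reals is an
  arbitrary value; for convolution algebras \<open>seminorms_bounded\<close> provides it.\<close>

lemma cstar_seminorm_max:
  assumes A: "star_alg A"
    and bdd: "\<And>a. a \<in> acarrier A \<Longrightarrow> \<exists>B. \<forall>p. cstar_seminorm A p \<longrightarrow> p a \<le> B"
  shows "cstar_seminorm A (max_cstar_norm A)"
    and "\<lbrakk>cstar_seminorm A p; a \<in> acarrier A\<rbrakk> \<Longrightarrow> p a \<le> max_cstar_norm A a"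
proof -
  interpret star_alg A by fact
  let ?S = "{p. cstar_seminorm A p}" and ?N = "max_cstar_norm A"
  have ne: "?S \<noteq> {}"
  proof -
    have "cstar_seminorm A (\<lambda>_. 0)" by (simp add: cstar_seminorm_def)
    then show ?thesis by blast
  qed
  have bd: "bdd_above ((\<lambda>p. p a) ` ?S)" if "a \<in> \<C>" for a
    using bdd[OF that] by (auto intro: bdd_aboveI)
  have le: "p a \<le> ?N a" if "cstar_seminorm A p" "a \<in> \<C>" for p a
    unfolding max_cstar_norm_def using that bd by (intro cSUP_upper) auto
  have least: "?N a \<le> B" if "\<And>p. cstar_seminorm A p \<Longrightarrow> p a \<le> B" for a B
    unfolding max_cstar_norm_def by (rule cSUP_least[OF ne]) (use that in auto)
  have nn: "0 \<le> ?N a" if "a \<in> \<C>" for a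
    using le[of "\<lambda>_. 0" a] that by (simp add: cstar_seminorm_def)
  have p_le: "star_seminorm A p" if "cstar_seminorm A p" for p using that by (rule star_seminormI)
  have 1: "?N (a \<oplus> b) \<le> ?N a + ?N b" if "a \<in> \<C>" "b \<in> \<C>" for a b
  proof (rule least)
    fix p assume p: "cstar_seminorm A p"
    show "p (a \<oplus> b) \<le> ?N a + ?N b"
      using star_seminorm.N_add[OF p_le[OF p] that] le[OF p that(1)] le[OF p that(2)] by linarith
  qed
  have 2: "?N (c \<odot> a) = cmod c * ?N a" if a: "a \<in> \<C>" for c a
  proof -
    have le': "?N (c \<odot> a) \<le> cmod c * ?N a" if a: "a \<in> \<C>" for c a
    proof (rule least)
      fix p assume p: "cstar_seminorm A p"
      show "p (c \<odot> a) \<le> cmod c * ?N a"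
        using star_seminorm.N_scale[OF p_le[OF p] a] le[OF p a] by (simp add: mult_left_mono)
    qed
    show ?thesis
    proof (cases "c = 0")
      case True
      have "?N (azero A) \<le> 0" using le'[OF a, of 0] a by simp
      then show ?thesis using True nn[of "azero A"] a by simp
    next
      case False
      have "?N a \<le> cmod (1 / c) * ?N (c \<odot> a)" using le'[of "c \<odot> a" "1 / c"] a False by simp
      then show ?thesis using le'[OF a, of c] False by (simp add: norm_divide field_simps)
    qed
  qed
  have 3: "?N (a \<otimes> b) \<le> ?N a * ?N b" if "a \<in> \<C>" "b \<in> \<C>" for a b
  proof (rule least)
    fix p assume p: "cstar_seminorm A p"
    have "p (a \<otimes> b) \<le> p a * p b" using star_seminorm.N_mult[OF p_le[OF p] that] .
    also have "\<dots> \<le> ?N a * ?N b"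
      using le[OF p that(1)] le[OF p that(2)] nn[OF that(1)] star_seminorm.N_nonneg[OF p_le[OF p] that(2)]
      by (intro mult_mono)
    finally show "p (a \<otimes> b) \<le> ?N a * ?N b" .
  qed
  have 4: "?N (a\<^sup>\<star> \<otimes> a) = (?N a)\<^sup>2" if a: "a \<in> \<C>" for a
  proof (rule antisym)
    show "?N (a\<^sup>\<star> \<otimes> a) \<le> (?N a)\<^sup>2"
    proof (rule least)
      fix p assume p: "cstar_seminorm A p"
      show "p (a\<^sup>\<star> \<otimes> a) \<le> (?N a)\<^sup>2"
        using star_seminorm.N_star_mult[OF p_le[OF p] a] le[OF p a]
          star_seminorm.N_nonneg[OF p_le[OF p] a] by (simp add: power_mono)
    qed
    \<comment> \<open>Each competitor satisfies \<open>p a = sqrt (p (a* a))\<close>, so the square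
      root is a common upper bound.\<close>
    have "?N a \<le> sqrt (?N (a\<^sup>\<star> \<otimes> a))"
    proof (rule least)
      fix p assume p: "cstar_seminorm A p"
      show "p a \<le> sqrt (?N (a\<^sup>\<star> \<otimes> a))"
        using star_seminorm.N_star_mult[OF p_le[OF p] a] le[OF p, of "a\<^sup>\<star> \<otimes> a"] a
        by (intro real_le_rsqrt) simp
    qed
    then have "(?N a)\<^sup>2 \<le> (sqrt (?N (a\<^sup>\<star> \<otimes> a)))\<^sup>2" using nn[OF a] by (rule power_mono)
    then show "(?N a)\<^sup>2 \<le> ?N (a\<^sup>\<star> \<otimes> a)" using nn[of "a\<^sup>\<star> \<otimes> a"] a by simp
  qed
  show "cstar_seminorm A ?N" using nn 1 2 3 4 by (simp add: cstar_seminorm_def)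
  show "p a \<le> ?N a" if "cstar_seminorm A p" "a \<in> \<C>" for p a using le that .
qed

section \<open>The GNS seminorm\<close>

text \<open>A real quadratic that is nowhere negative has nonpositive discriminant. For
  \<open>Q \<noteq> 0\<close> it is evaluated at its minimum \<open>- X / Q\<close>; for
  \<open>Q = 0\<close> it is affine and would reach -1 if \<open>X \<noteq> 0\<close>.\<close>

lemma discriminant_bound:
  fixes P X Q :: real
  assumes "\<And>t. 0 \<le> P + 2 * t * X + t\<^sup>2 * Q" "0 \<le> Q"
  shows "X\<^sup>2 \<le> P * Q"
proof (cases "Q = 0")
  case True
  have "X = 0"
  proof (rule ccontr)
    assume "X \<noteq> 0"
    then have "P + 2 * (- (P + 1) / (2 * X)) * X = - 1" by (simp add: field_simps)
    then show False using assms(1)[of "- (P + 1) / (2 * X)"] True by simp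
  qed
  then show ?thesis using True by simp
next
  case False
  have "0 \<le> P + 2 * (- X / Q) * X + (- X / Q)\<^sup>2 * Q" by (rule assms)
  also have "\<dots> = P - X\<^sup>2 / Q" using False by (simp add: power2_eq_square field_simps)
  finally show ?thesis using False assms(2) by (simp add: field_simps)
qed

text \<open>On an incomplete algebra positivity of \<omega> does not by itself make left
  multiplications bounded for the form \<open>\<omega> (b* c)\<close>, so \<open>w_bounded\<close>
  is an axiom; \<open>gns_evaluation\<close> verifies it for point evaluations.\<close>

locale gns = star_alg A for A :: "('a, 'z) star_algebra_scheme" +
  fixes \<omega> :: "'a \<Rightarrow> complex"
  assumes w_add: "\<lbrakk>a \<in> acarrier A; b \<in> acarrier A\<rbrakk> \<Longrightarrow> \<omega> (aadd A a b) = \<omega> a + \<omega> b"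
    and w_scale: "a \<in> acarrier A \<Longrightarrow> \<omega> (ascale A c a) = c * \<omega> a"
    and w_star: "a \<in> acarrier A \<Longrightarrow> \<omega> (astar A a) = cnj (\<omega> a)"
    and w_pos: "a \<in> acarrier A \<Longrightarrow> 0 \<le> Re (\<omega> (amult A (astar A a) a))"
    and w_bounded: "a \<in> acarrier A \<Longrightarrow> \<exists>M. 0 \<le> M \<and> (\<forall>b\<in>acarrier A.
        Re (\<omega> (amult A (astar A (amult A a b)) (amult A a b))) \<le> M\<^sup>2 * Re (\<omega> (amult A (astar A b) b)))"
begin

definition q :: "'a \<Rightarrow> real" where "q b = sqrt (Re (\<omega> (b\<^sup>\<star> \<otimes> b)))"

text \<open>This is the norm of \<open>a\<close> in the GNS representation of \<omega>, obtained
  without quotient or Hilbert space completion: \<open>q\<close> is the seminorm of the semi-inner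
  product, and null vectors are kept.\<close>

definition gnorm :: "'a \<Rightarrow> real" where "gnorm a = (SUP b\<in>{b \<in> \<C>. q b \<le> 1}. q (a \<otimes> b))"

lemma q_nonneg [simp]: "b \<in> \<C> \<Longrightarrow> 0 \<le> q b"
  by (simp add: q_def w_pos)

lemma q_sq: "b \<in> \<C> \<Longrightarrow> (q b)\<^sup>2 = Re (\<omega> (b\<^sup>\<star> \<otimes> b))"
  by (simp add: q_def w_pos)

lemma Re_swap: "\<lbrakk>b \<in> \<C>; c \<in> \<C>\<rbrakk> \<Longrightarrow> Re (\<omega> (c\<^sup>\<star> \<otimes> b)) = Re (\<omega> (b\<^sup>\<star> \<otimes> c))"
  using w_star[of "b\<^sup>\<star> \<otimes> c"] by (simp add: star_mult)

lemma q_expand: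
  assumes "b \<in> \<C>" "c \<in> \<C>"
  shows "(q (b \<oplus> complex_of_real t \<odot> c))\<^sup>2 = (q b)\<^sup>2 + 2 * t * Re (\<omega> (b\<^sup>\<star> \<otimes> c)) + t\<^sup>2 * (q c)\<^sup>2"
  using assms
  by (simp add: q_sq star_add star_scale mult_add_left mult_add_right w_add w_scale Re_swap[of b c])
    (simp add: power2_eq_square algebra_simps)

text \<open>Only the real part is estimated, so real \<open>t\<close> suffice in
  \<open>q_expand\<close>. This is enough for the triangle inequality of \<open>q\<close> and for
  the C*-identity of \<open>gnorm\<close>.\<close>

lemma cauchy_schwarz: assumes "b \<in> \<C>" "c \<in> \<C>" shows "Re (\<omega> (b\<^sup>\<star> \<otimes> c)) \<le> q b * q c"
proof -
  have "(Re (\<omega> (b\<^sup>\<star> \<otimes> c)))\<^sup>2 \<le> (q b)\<^sup>2 * (q c)\<^sup>2"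
    by (rule discriminant_bound) (use q_expand[OF assms] in \<open>metis zero_le_power2\<close>, simp)
  then have "(Re (\<omega> (b\<^sup>\<star> \<otimes> c)))\<^sup>2 \<le> (q b * q c)\<^sup>2" by (simp add: power_mult_distrib)
  then show ?thesis by (rule power2_le_imp_le) (use assms in simp)
qed

lemma q_add: assumes "b \<in> \<C>" "c \<in> \<C>" shows "q (b \<oplus> c) \<le> q b + q c"
proof (rule power2_le_imp_le)
  show "(q (b \<oplus> c))\<^sup>2 \<le> (q b + q c)\<^sup>2"
    using q_expand[OF assms, of 1] cauchy_schwarz[OF assms] assms by (simp add: power2_sum)
qed (use assms in simp)

lemma q_scale: assumes "b \<in> \<C>" shows "q (c \<odot> b) = cmod c * q b"
proof -
  have "\<omega> ((c \<odot> b)\<^sup>\<star> \<otimes> (c \<odot> b)) = complex_of_real ((cmod c)\<^sup>2) * \<omega> (b\<^sup>\<star> \<otimes> b)"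
    using assms complex_norm_square[of c] by (simp add: star_scale w_scale mult.commute del: of_real_power)
  then show ?thesis by (simp add: q_def real_sqrt_mult del: of_real_power)
qed

lemma q_mult_bound:
  assumes "a \<in> \<C>" obtains M where "0 \<le> M" "\<And>b. b \<in> \<C> \<Longrightarrow> q (a \<otimes> b) \<le> M * q b"
proof -
  obtain M where M: "0 \<le> M" "\<forall>b\<in>\<C>. Re (\<omega> ((a \<otimes> b)\<^sup>\<star> \<otimes> (a \<otimes> b))) \<le> M\<^sup>2 * Re (\<omega> (b\<^sup>\<star> \<otimes> b))"
    using w_bounded[OF assms] by blast
  have "q (a \<otimes> b) \<le> M * q b" if "b \<in> \<C>" for b
  proof (rule power2_le_imp_le)
    show "(q (a \<otimes> b))\<^sup>2 \<le> (M * q b)\<^sup>2"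
      using M(2) that assms by (simp add: q_sq power_mult_distrib)
  qed (use M that in simp)
  then show ?thesis using that M by blast
qed

lemma gnorm_bdd: assumes "a \<in> \<C>" shows "bdd_above ((\<lambda>b. q (a \<otimes> b)) ` {b \<in> \<C>. q b \<le> 1})"
proof -
  obtain M where M: "0 \<le> M" "\<And>b. b \<in> \<C> \<Longrightarrow> q (a \<otimes> b) \<le> M * q b" using q_mult_bound[OF assms] by blast
  have "q (a \<otimes> b) \<le> M" if "b \<in> \<C>" "q b \<le> 1" for b
    using M(2)[OF that(1)] mult_left_le[OF that(2) M(1)] by linarith
  then show ?thesis by (auto intro!: bdd_aboveI)
qed

lemma q_zero [simp]: "q (azero A) = 0"
  using q_scale[of "azero A" 0] by simp

lemma ball_nonempty: "{b \<in> \<C>. q b \<le> 1} \<noteq> {}"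
proof -
  have "azero A \<in> {b \<in> \<C>. q b \<le> 1}" by simp
  then show ?thesis by blast
qed

lemma gnorm_nonneg: assumes "a \<in> \<C>" shows "0 \<le> gnorm a"
  unfolding gnorm_def using assms by (intro cSUP_upper2[OF gnorm_bdd, of a "azero A"]) auto

lemma q_le_gnorm: assumes "a \<in> \<C>" "b \<in> \<C>" shows "q (a \<otimes> b) \<le> gnorm a * q b"
proof (cases "q b = 0")
  case True
  \<comment> \<open>A null vector cannot be normalized; boundedness of left multiplication by
    \<open>a\<close> makes its image null as well.\<close>
  obtain M where M: "0 \<le> M" "\<And>b. b \<in> \<C> \<Longrightarrow> q (a \<otimes> b) \<le> M * q b" using q_mult_bound[OF assms(1)] by blast
  show ?thesis using M(2)[OF assms(2)] True by simp
next
  case False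
  then have pos: "0 < q b" using assms(2) by (simp add: less_le)
  let ?b = "complex_of_real (1 / q b) \<odot> b"
  have "q (a \<otimes> ?b) \<le> gnorm a"
    unfolding gnorm_def using assms pos
    by (intro cSUP_upper gnorm_bdd) (auto simp: q_scale norm_divide)
  then show ?thesis using assms pos by (simp add: q_scale norm_divide field_simps)
qed

lemma gnorm_le: assumes "a \<in> \<C>" "0 \<le> M" "\<And>b. b \<in> \<C> \<Longrightarrow> q (a \<otimes> b) \<le> M * q b" shows "gnorm a \<le> M"
  unfolding gnorm_def
proof (rule cSUP_least[OF ball_nonempty])
  fix b assume "b \<in> {b \<in> \<C>. q b \<le> 1}"
  then show "q (a \<otimes> b) \<le> M" using assms(3)[of b] mult_left_le[of "q b" M] assms(2) by auto
qed

lemma gnorm_cstar_seminorm: "cstar_seminorm A gnorm"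
proof -
  have add: "gnorm (a \<oplus> b) \<le> gnorm a + gnorm b" if "a \<in> \<C>" "b \<in> \<C>" for a b
  proof (rule gnorm_le)
    fix c assume c: "c \<in> \<C>"
    show "q ((a \<oplus> b) \<otimes> c) \<le> (gnorm a + gnorm b) * q c"
      using q_add[of "a \<otimes> c" "b \<otimes> c"] q_le_gnorm[of a c] q_le_gnorm[of b c] that c
      by (simp add: mult_add_left distrib_right)
  qed (use that gnorm_nonneg in auto)
  have mult: "gnorm (a \<otimes> b) \<le> gnorm a * gnorm b" if "a \<in> \<C>" "b \<in> \<C>" for a b
  proof (rule gnorm_le)
    fix c assume c: "c \<in> \<C>"
    have "q ((a \<otimes> b) \<otimes> c) \<le> gnorm a * q (b \<otimes> c)"
      using q_le_gnorm[of a "b \<otimes> c"] that c by (simp add: mult_assoc)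
    also have "\<dots> \<le> gnorm a * (gnorm b * q c)"
      using q_le_gnorm[of b c] gnorm_nonneg that c by (intro mult_left_mono) auto
    finally show "q ((a \<otimes> b) \<otimes> c) \<le> gnorm a * gnorm b * q c" by (simp add: mult.assoc)
  qed (use that gnorm_nonneg in auto)
  have scale_le: "gnorm (c \<odot> a) \<le> cmod c * gnorm a" if "a \<in> \<C>" for c a
  proof (rule gnorm_le)
    fix b assume b: "b \<in> \<C>"
    show "q ((c \<odot> a) \<otimes> b) \<le> cmod c * gnorm a * q b"
      using q_le_gnorm[OF that b] that b by (simp add: q_scale mult.assoc mult_left_mono)
  qed (use that gnorm_nonneg in auto)
  have scale: "gnorm (c \<odot> a) = cmod c * gnorm a" if a: "a \<in> \<C>" for c a
  proof (cases "c = 0")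
    case True
    then show ?thesis using scale_le[OF a, of 0] gnorm_nonneg[of "azero A"] a by simp
  next
    case False
    have "gnorm a \<le> cmod (1 / c) * gnorm (c \<odot> a)"
      using scale_le[of "c \<odot> a" "1 / c"] a False by simp
    then show ?thesis using scale_le[OF a, of c] False by (simp add: norm_divide field_simps)
  qed
  \<comment> \<open>The half of the C*-identity that needs the inner product:
    \<open>(q (a b))^2\<close> pairs \<open>b\<close> with \<open>a* a b\<close>, and Cauchy-Schwarz
    applies. The other half is submultiplicativity once \<open>star_le\<close> compares
    \<open>a\<close> with its adjoint.\<close>
  have sq_le: "(gnorm a)\<^sup>2 \<le> gnorm (a\<^sup>\<star> \<otimes> a)" if a: "a \<in> \<C>" for a
  proof -
    let ?M = "sqrt (gnorm (a\<^sup>\<star> \<otimes> a))"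
    have "gnorm a \<le> ?M"
    proof (rule gnorm_le)
      fix b assume b: "b \<in> \<C>"
      have "(q (a \<otimes> b))\<^sup>2 = Re (\<omega> (b\<^sup>\<star> \<otimes> ((a\<^sup>\<star> \<otimes> a) \<otimes> b)))"
        using a b by (simp add: q_sq star_mult mult_assoc)
      also have "\<dots> \<le> q b * q ((a\<^sup>\<star> \<otimes> a) \<otimes> b)" using a b by (intro cauchy_schwarz) auto
      also have "\<dots> \<le> q b * (gnorm (a\<^sup>\<star> \<otimes> a) * q b)"
        using a b by (intro mult_left_mono q_le_gnorm) auto
      also have "\<dots> = (?M * q b)\<^sup>2"
        using gnorm_nonneg[of "a\<^sup>\<star> \<otimes> a"] a by (simp add: power_mult_distrib power2_eq_square)
      finally show "q (a \<otimes> b) \<le> ?M * q b"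
        by (rule power2_le_imp_le) (use a b gnorm_nonneg in simp)
    qed (use a gnorm_nonneg in auto)
    then show ?thesis using gnorm_nonneg[OF a] gnorm_nonneg[of "a\<^sup>\<star> \<otimes> a"] a
      by (metis mult_closed power_mono real_sqrt_pow2 star_closed)
  qed
  have star_le: "gnorm a \<le> gnorm (a\<^sup>\<star>)" if a: "a \<in> \<C>" for a
  proof (cases "gnorm a = 0")
    case False
    have "gnorm a * gnorm a \<le> gnorm (a\<^sup>\<star>) * gnorm a"
      using sq_le[OF a] mult[of "a\<^sup>\<star>" a] a by (simp add: power2_eq_square)
    then show ?thesis using False gnorm_nonneg[OF a] by (simp add: mult_le_cancel_right)
  qed (use a gnorm_nonneg in auto)
  have "gnorm (a\<^sup>\<star> \<otimes> a) = (gnorm a)\<^sup>2" if a: "a \<in> \<C>" for a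
  proof (rule antisym)
    have "gnorm (a\<^sup>\<star> \<otimes> a) \<le> gnorm (a\<^sup>\<star>) * gnorm a" using mult a by simp
    also have "\<dots> \<le> gnorm a * gnorm a"
      using star_le[of "a\<^sup>\<star>"] a gnorm_nonneg by (intro mult_right_mono) auto
    finally show "gnorm (a\<^sup>\<star> \<otimes> a) \<le> (gnorm a)\<^sup>2" by (simp add: power2_eq_square)
  qed (rule sq_le[OF a])
  then show ?thesis using add mult scale gnorm_nonneg by (auto simp: cstar_seminorm_def)
qed

end

section \<open>Completions\<close>

lemma null_squeeze:
  fixes f g :: "nat \<Rightarrow> real"
  assumes "g \<longlonglongrightarrow> 0" "\<And>n. 0 \<le> f n" "\<And>n. f n \<le> g n"
  shows "f \<longlonglongrightarrow> 0"
  by (rule tendsto_sandwich[OF _ _ tendsto_const assms(1)]) (use assms in auto)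

locale pre_cstar = star_seminorm A "anorm A" for A :: "'a normed_star_algebra"
begin

lemma adist_eq: "adist A a b = anorm A (a \<ominus> b)"
  by (simp add: adist_def)

lemma adist_commute: "\<lbrakk>a \<in> \<C>; b \<in> \<C>\<rbrakk> \<Longrightarrow> adist A a b = adist A b a"
  by (simp add: adist_eq N_diff_commute)

lemma adist_triangle: "\<lbrakk>a \<in> \<C>; b \<in> \<C>; c \<in> \<C>\<rbrakk> \<Longrightarrow> adist A a c \<le> adist A a b + adist A b c"
  by (simp add: adist_eq N_diff_triangle)

lemma adist_nonneg [simp]: "\<lbrakk>a \<in> \<C>; b \<in> \<C>\<rbrakk> \<Longrightarrow> 0 \<le> adist A a b"
  by (simp add: adist_eq)

lemma adist_self [simp]: "a \<in> \<C> \<Longrightarrow> adist A a a = 0"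
  by (simp add: adist_eq)

lemma adist_add:
  "\<lbrakk>a \<in> \<C>; b \<in> \<C>; a' \<in> \<C>; b' \<in> \<C>\<rbrakk> \<Longrightarrow> adist A (a \<oplus> b) (a' \<oplus> b') \<le> adist A a a' + adist A b b'"
  by (simp add: adist_eq diff_add_add N_add)

lemma adist_scale: "\<lbrakk>a \<in> \<C>; b \<in> \<C>\<rbrakk> \<Longrightarrow> adist A (c \<odot> a) (c \<odot> b) = cmod c * adist A a b"
  unfolding adist_eq by (subst diff_scale) auto

lemma adist_star: "\<lbrakk>a \<in> \<C>; b \<in> \<C>\<rbrakk> \<Longrightarrow> adist A (a\<^sup>\<star>) (b\<^sup>\<star>) = adist A a b"
  unfolding adist_eq by (subst diff_star) auto

lemma adist_mult:
  assumes "a \<in> \<C>" "b \<in> \<C>" "a' \<in> \<C>" "b' \<in> \<C>"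
  shows "adist A (a \<otimes> b) (a' \<otimes> b') \<le> anorm A a * adist A b b' + adist A a a' * anorm A b'"
  unfolding adist_eq diff_mult[OF assms]
  using assms by (intro order_trans[OF N_add] add_mono N_mult) auto

lemma cauchy_seqs_closed: "u \<in> cauchy_seqs A \<Longrightarrow> u n \<in> \<C>"
  by (simp add: cauchy_seqs_def)

lemma cauchy_seqsD:
  "\<lbrakk>u \<in> cauchy_seqs A; 0 < e\<rbrakk> \<Longrightarrow> \<exists>N. \<forall>m\<ge>N. \<forall>n\<ge>N. adist A (u m) (u n) < e"
  by (simp add: cauchy_seqs_def)

lemma cauchy_seqsI:
  assumes "\<And>n. u n \<in> \<C>" "\<And>e. 0 < e \<Longrightarrow> \<exists>N. \<forall>m\<ge>N. \<forall>n\<ge>N. adist A (u m) (u n) < e"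
  shows "u \<in> cauchy_seqs A"
  using assms by (simp add: cauchy_seqs_def)

lemma cauchy_const [simp]: "a \<in> \<C> \<Longrightarrow> (\<lambda>_. a) \<in> cauchy_seqs A"
  by (rule cauchy_seqsI) auto

lemma cauchy_bounded:
  assumes "u \<in> cauchy_seqs A" obtains B where "0 < B" "\<And>n. anorm A (u n) \<le> B"
proof -
  obtain N where N: "\<forall>m\<ge>N. \<forall>n\<ge>N. adist A (u m) (u n) < 1"
    using cauchy_seqsD[OF assms, of 1] by auto
  define B where "B = Max ((\<lambda>n. anorm A (u n)) ` {..N}) + 1"
  have le: "anorm A (u n) \<le> B - 1" if "n \<le> N" for n
    unfolding B_def using that by (auto intro!: Max_ge)
  have "anorm A (u n) \<le> B" for n
  proof (cases "n \<le> N")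
    case False
    then have "adist A (u n) (u N) < 1" using N by auto
    then show ?thesis
      using N_le_diff[of "u n" "u N"] le[of N] cauchy_seqs_closed[OF assms] by (simp add: adist_eq)
  qed (use le in fastforce)
  moreover have "0 < B" using le[of 0] N_nonneg[OF cauchy_seqs_closed[OF assms], of 0] by auto
  ultimately show ?thesis using that by blast
qed

lemma cauchy_add:
  assumes u: "u \<in> cauchy_seqs A" and v: "v \<in> cauchy_seqs A"
  shows "(\<lambda>n. u n \<oplus> v n) \<in> cauchy_seqs A"
proof (rule cauchy_seqsI)
  fix e :: real assume e: "0 < e"
  obtain M N where M: "\<forall>m\<ge>M. \<forall>n\<ge>M. adist A (u m) (u n) < e/2"
    and N: "\<forall>m\<ge>N. \<forall>n\<ge>N. adist A (v m) (v n) < e/2"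
    using cauchy_seqsD[OF u, of "e/2"] cauchy_seqsD[OF v, of "e/2"] e by auto
  have "adist A (u m \<oplus> v m) (u n \<oplus> v n) < e" if "m \<ge> max M N" "n \<ge> max M N" for m n
    using adist_add[of "u m" "v m" "u n" "v n"] M[rule_format, of m n] N[rule_format, of m n] that
      cauchy_seqs_closed[OF u] cauchy_seqs_closed[OF v] by simp
  then show "\<exists>N. \<forall>m\<ge>N. \<forall>n\<ge>N. adist A (u m \<oplus> v m) (u n \<oplus> v n) < e" by blast
qed (use u v cauchy_seqs_closed in auto)

lemma cauchy_scale:
  assumes u: "u \<in> cauchy_seqs A" shows "(\<lambda>n. c \<odot> u n) \<in> cauchy_seqs A"
proof (rule cauchy_seqsI)
  fix e :: real assume e: "0 < e"
  have pos: "0 < cmod c + 1" by (simp add: add_nonneg_pos)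
  obtain N where N: "\<forall>m\<ge>N. \<forall>n\<ge>N. adist A (u m) (u n) < e / (cmod c + 1)"
    using cauchy_seqsD[OF u, of "e / (cmod c + 1)"] e pos by auto
  have "adist A (c \<odot> u m) (c \<odot> u n) < e" if "m \<ge> N" "n \<ge> N" for m n
  proof -
    have "cmod c * adist A (u m) (u n) \<le> (cmod c + 1) * adist A (u m) (u n)"
      using cauchy_seqs_closed[OF u] by (intro mult_right_mono) auto
    also have "\<dots> < e" using N[rule_format, OF that] pos by (simp add: field_simps)
    finally show ?thesis using cauchy_seqs_closed[OF u] by (simp add: adist_scale)
  qed
  then show "\<exists>N. \<forall>m\<ge>N. \<forall>n\<ge>N. adist A (c \<odot> u m) (c \<odot> u n) < e" by blast
qed (use u cauchy_seqs_closed in auto)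

lemma cauchy_star: "u \<in> cauchy_seqs A \<Longrightarrow> (\<lambda>n. (u n)\<^sup>\<star>) \<in> cauchy_seqs A"
  using cauchy_seqs_closed by (intro cauchy_seqsI) (auto simp: adist_star cauchy_seqsD)

lemma cauchy_mult:
  assumes u: "u \<in> cauchy_seqs A" and v: "v \<in> cauchy_seqs A"
  shows "(\<lambda>n. u n \<otimes> v n) \<in> cauchy_seqs A"
proof (rule cauchy_seqsI)
  fix e :: real assume e: "0 < e"
  obtain B where B: "0 < B" "\<And>n. anorm A (u n) \<le> B" using cauchy_bounded[OF u] by blast
  obtain D where D: "0 < D" "\<And>n. anorm A (v n) \<le> D" using cauchy_bounded[OF v] by blast
  obtain M where M: "\<forall>m\<ge>M. \<forall>n\<ge>M. adist A (u m) (u n) < e/2/D"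
    using cauchy_seqsD[OF u, of "e/2/D"] e D(1) by auto
  obtain N where N: "\<forall>m\<ge>N. \<forall>n\<ge>N. adist A (v m) (v n) < e/2/B"
    using cauchy_seqsD[OF v, of "e/2/B"] e B(1) by auto
  have "adist A (u m \<otimes> v m) (u n \<otimes> v n) < e" if mn: "m \<ge> max M N" "n \<ge> max M N" for m n
  proof -
    have "anorm A (u m) * adist A (v m) (v n) \<le> B * adist A (v m) (v n)"
      using B cauchy_seqs_closed[OF v] by (intro mult_right_mono) auto
    also have "\<dots> < e/2" using N[rule_format, of m n] mn B(1) by (simp add: field_simps)
    finally have 1: "anorm A (u m) * adist A (v m) (v n) < e/2" .
    have "adist A (u m) (u n) * anorm A (v n) \<le> adist A (u m) (u n) * D"
      using D cauchy_seqs_closed[OF u] by (intro mult_left_mono) auto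
    also have "\<dots> < e/2" using M[rule_format, of m n] mn D(1) by (simp add: field_simps)
    finally show ?thesis
      using 1 adist_mult[of "u m" "v m" "u n" "v n"] cauchy_seqs_closed[OF u] cauchy_seqs_closed[OF v]
      by simp
  qed
  then show "\<exists>N. \<forall>m\<ge>N. \<forall>n\<ge>N. adist A (u m \<otimes> v m) (u n \<otimes> v n) < e" by blast
qed (use u v cauchy_seqs_closed in auto)

section \<open>Cauchy sequences modulo null sequences\<close>

lemma equiv_cauchy_rel: "equiv (cauchy_seqs A) (cauchy_rel A)"
proof (rule equivI)
  show "cauchy_rel A \<subseteq> cauchy_seqs A \<times> cauchy_seqs A" by (auto simp: cauchy_rel_def)
  show "refl_on (cauchy_seqs A) (cauchy_rel A)"
    by (rule refl_onI) (auto simp: cauchy_rel_def cauchy_seqs_closed)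
  show "sym (cauchy_rel A)"
    by (rule symI) (auto simp: cauchy_rel_def adist_commute[OF cauchy_seqs_closed cauchy_seqs_closed])
  show "trans (cauchy_rel A)"
  proof (rule transI)
    fix u v w assume uv: "(u, v) \<in> cauchy_rel A" and vw: "(v, w) \<in> cauchy_rel A"
    then have c: "u \<in> cauchy_seqs A" "v \<in> cauchy_seqs A" "w \<in> cauchy_seqs A"
      by (auto simp: cauchy_rel_def)
    have "(\<lambda>n. adist A (u n) (v n) + adist A (v n) (w n)) \<longlonglongrightarrow> 0"
      using uv vw tendsto_add[of _ 0 _ _ 0] by (force simp: cauchy_rel_def)
    then have "(\<lambda>n. adist A (u n) (w n)) \<longlonglongrightarrow> 0"
      by (rule tendsto_sandwich[rotated 3, where f = "\<lambda>_. 0"])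
        (use c cauchy_seqs_closed adist_triangle in auto)
    then show "(u, w) \<in> cauchy_rel A" using c by (simp add: cauchy_rel_def)
  qed
qed

lemma class_eq_iff:
  "\<lbrakk>u \<in> cauchy_seqs A; v \<in> cauchy_seqs A\<rbrakk> \<Longrightarrow>
     cauchy_class A u = cauchy_class A v \<longleftrightarrow> (\<lambda>n. adist A (u n) (v n)) \<longlonglongrightarrow> 0"
  unfolding cauchy_class_def by (subst eq_equiv_class_iff[OF equiv_cauchy_rel]) (auto simp: cauchy_rel_def)

lemma class_closed: "u \<in> cauchy_seqs A \<Longrightarrow> cauchy_class A u \<in> acarrier (completion A)"
  by (simp add: completion_def cauchy_class_def quotientI)

lemma rep:
  assumes "X \<in> acarrier (completion A)"
  shows "cauchy_rep X \<in> cauchy_seqs A" "cauchy_class A (cauchy_rep X) = X"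
proof -
  have X: "X \<in> cauchy_seqs A // cauchy_rel A" using assms by (simp add: completion_def)
  then have "X \<noteq> {}" using equiv_cauchy_rel in_quotient_imp_non_empty by blast
  then have r: "cauchy_rep X \<in> X" unfolding cauchy_rep_def by (simp add: some_in_eq)
  show "cauchy_rep X \<in> cauchy_seqs A" using r X equiv_cauchy_rel in_quotient_imp_subset by blast
  show "cauchy_class A (cauchy_rep X) = X"
    using X
  proof (rule quotientE)
    fix u assume "X = cauchy_rel A `` {u}"
    then show ?thesis
      using r equiv_class_eq[OF equiv_cauchy_rel, of u "cauchy_rep X"] by (simp add: cauchy_class_def)
  qed
qed

lemma classE:
  assumes "X \<in> acarrier (completion A)"
  obtains u where "u \<in> cauchy_seqs A" "X = cauchy_class A u" "\<And>n. u n \<in> \<C>"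
  using rep[OF assms] cauchy_seqs_closed by metis

text \<open>The operations of \<open>completion\<close> act on the chosen \<open>cauchy_rep\<close>.
  It differs from any other representative by a null sequence, which lets the next lemmas compute
  with arbitrary representatives.\<close>

lemma rep_class:
  assumes "u \<in> cauchy_seqs A"
  shows "cauchy_rep (cauchy_class A u) \<in> cauchy_seqs A"
    "(\<lambda>n. adist A (cauchy_rep (cauchy_class A u) n) (u n)) \<longlonglongrightarrow> 0"
  using rep[OF class_closed[OF assms]] class_eq_iff[of "cauchy_rep (cauchy_class A u)" u] assms by auto

lemma completion_add:
  assumes u: "u \<in> cauchy_seqs A" and v: "v \<in> cauchy_seqs A"
  shows "aadd (completion A) (cauchy_class A u) (cauchy_class A v) = cauchy_class A (\<lambda>n. u n \<oplus> v n)"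
proof -
  let ?u = "cauchy_rep (cauchy_class A u)" and ?v = "cauchy_rep (cauchy_class A v)"
  note r = rep_class[OF u] rep_class[OF v]
  have "(\<lambda>n. adist A (?u n) (u n) + adist A (?v n) (v n)) \<longlonglongrightarrow> 0 + 0"
    using r by (intro tendsto_add)
  then have "(\<lambda>n. adist A (?u n \<oplus> ?v n) (u n \<oplus> v n)) \<longlonglongrightarrow> 0"
    by (elim null_squeeze[OF tendsto_eq_rhs]) (use u v r cauchy_seqs_closed adist_add in auto)
  then show ?thesis
    using u v r by (simp add: completion_def class_eq_iff cauchy_add)
qed

lemma completion_scale:
  assumes u: "u \<in> cauchy_seqs A"
  shows "ascale (completion A) c (cauchy_class A u) = cauchy_class A (\<lambda>n. c \<odot> u n)"
proof -
  note r = rep_class[OF u]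
  have "(\<lambda>n. cmod c * adist A (cauchy_rep (cauchy_class A u) n) (u n)) \<longlonglongrightarrow> 0"
    using r(2) by (rule tendsto_mult_right_zero)
  then show ?thesis
    using u r by (simp add: completion_def class_eq_iff cauchy_scale adist_scale cauchy_seqs_closed)
qed

lemma completion_star:
  assumes u: "u \<in> cauchy_seqs A"
  shows "astar (completion A) (cauchy_class A u) = cauchy_class A (\<lambda>n. (u n)\<^sup>\<star>)"
  using u rep_class[OF u]
  by (simp add: completion_def class_eq_iff cauchy_star adist_star cauchy_seqs_closed)

lemma completion_mult:
  assumes u: "u \<in> cauchy_seqs A" and v: "v \<in> cauchy_seqs A"
  shows "amult (completion A) (cauchy_class A u) (cauchy_class A v) = cauchy_class A (\<lambda>n. u n \<otimes> v n)"
proof -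
  let ?u = "cauchy_rep (cauchy_class A u)" and ?v = "cauchy_rep (cauchy_class A v)"
  note r = rep_class[OF u] rep_class[OF v]
  obtain B where B: "0 < B" "\<And>n. anorm A (?u n) \<le> B" using cauchy_bounded[OF r(1)] by blast
  obtain D where D: "0 < D" "\<And>n. anorm A (v n) \<le> D" using cauchy_bounded[OF v] by blast
  have "(\<lambda>n. B * adist A (?v n) (v n) + adist A (?u n) (u n) * D) \<longlonglongrightarrow> B * 0 + 0 * D"
    using r by (intro tendsto_intros)
  moreover have "adist A (?u n \<otimes> ?v n) (u n \<otimes> v n) \<le> B * adist A (?v n) (v n) + adist A (?u n) (u n) * D" for n
  proof -
    have "anorm A (?u n) * adist A (?v n) (v n) \<le> B * adist A (?v n) (v n)"
      using B(2) r v by (intro mult_right_mono) (auto simp: cauchy_seqs_closed)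
    moreover have "adist A (?u n) (u n) * anorm A (v n) \<le> adist A (?u n) (u n) * D"
      using D(2) r u by (intro mult_left_mono) (auto simp: cauchy_seqs_closed)
    ultimately show ?thesis
      using adist_mult[of "?u n" "?v n" "u n" "v n"] r u v by (simp add: cauchy_seqs_closed)
  qed
  ultimately have "(\<lambda>n. adist A (?u n \<otimes> ?v n) (u n \<otimes> v n)) \<longlonglongrightarrow> 0"
    by (elim null_squeeze[OF tendsto_eq_rhs]) (use u v r cauchy_seqs_closed in auto)
  then show ?thesis
    using u v r by (simp add: completion_def class_eq_iff cauchy_mult)
qed

lemma completion_zero: "azero (completion A) = cauchy_class A (\<lambda>_. azero A)"
  by (simp add: completion_def)

lemma norm_convergent:
  assumes u: "u \<in> cauchy_seqs A" shows "convergent (\<lambda>n. anorm A (u n))"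
  unfolding Cauchy_convergent_iff[symmetric]
proof (rule CauchyI)
  fix e :: real assume "0 < e"
  then obtain N where N: "\<forall>m\<ge>N. \<forall>n\<ge>N. adist A (u m) (u n) < e" using cauchy_seqsD[OF u] by blast
  have "norm (anorm A (u m) - anorm A (u n)) < e" if "m \<ge> N" "n \<ge> N" for m n
    using N_abs_diff[of "u m" "u n"] N[rule_format, OF that] u by (auto simp: adist_eq cauchy_seqs_closed)
  then show "\<exists>N. \<forall>m\<ge>N. \<forall>n\<ge>N. norm (anorm A (u m) - anorm A (u n)) < e" by blast
qed

lemma completion_norm:
  assumes u: "u \<in> cauchy_seqs A"
  shows "(\<lambda>n. anorm A (u n)) \<longlonglongrightarrow> anorm (completion A) (cauchy_class A u)"
proof -
  let ?u = "cauchy_rep (cauchy_class A u)"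
  note r = rep_class[OF u]
  have l: "(\<lambda>n. anorm A (?u n)) \<longlonglongrightarrow> anorm (completion A) (cauchy_class A u)"
    using norm_convergent[OF r(1)] by (simp add: completion_def convergent_LIMSEQ_iff)
  have "(\<lambda>n. anorm A (?u n) - anorm A (u n)) \<longlonglongrightarrow> 0"
    by (rule Lim_null_comparison[OF _ r(2)])
      (use u r cauchy_seqs_closed N_abs_diff in \<open>auto simp: adist_eq\<close>)
  from tendsto_diff[OF l this] show ?thesis by simp
qed

lemma completion_star_alg: "star_alg (completion A)"
proof -
  let ?B = "completion A"
  \<comment> \<open>The laws are identities: rewritten with \<open>ops\<close> they become equations
    between classes of sequences and hold term by term in \<open>A\<close>.\<close>
  note ops = completion_add completion_scale completion_star completion_mult completion_zero
    class_closed cauchy_add cauchy_scale cauchy_star cauchy_mult cauchy_const[OF zero_closed]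
  have three: "aadd ?B (aadd ?B x y) z = aadd ?B x (aadd ?B y z)"
      "amult ?B (amult ?B x y) z = amult ?B x (amult ?B y z)"
      "amult ?B x (aadd ?B y z) = aadd ?B (amult ?B x y) (amult ?B x z)"
      "amult ?B (aadd ?B x y) z = aadd ?B (amult ?B x z) (amult ?B y z)"
    if "x \<in> acarrier ?B" "y \<in> acarrier ?B" "z \<in> acarrier ?B" for x y z
  proof -
    obtain u where u: "u \<in> cauchy_seqs A" "x = cauchy_class A u" "\<And>n. u n \<in> \<C>"
      using classE[OF \<open>x \<in> _\<close>] by blast
    obtain v where v: "v \<in> cauchy_seqs A" "y = cauchy_class A v" "\<And>n. v n \<in> \<C>"
      using classE[OF \<open>y \<in> _\<close>] by blast
    obtain w where w: "w \<in> cauchy_seqs A" "z = cauchy_class A w" "\<And>n. w n \<in> \<C>"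
      using classE[OF \<open>z \<in> _\<close>] by blast
    note * = u(1) v(1) w(1) u(2) v(2) w(2) u(3) v(3) w(3)
    show "aadd ?B (aadd ?B x y) z = aadd ?B x (aadd ?B y z)"
      "amult ?B (amult ?B x y) z = amult ?B x (amult ?B y z)"
      "amult ?B x (aadd ?B y z) = aadd ?B (amult ?B x y) (amult ?B x z)"
      "amult ?B (aadd ?B x y) z = aadd ?B (amult ?B x z) (amult ?B y z)"
      by (simp_all only: *(1-6) ops)
        (simp_all add: *(7-9) add_assoc mult_assoc mult_add_left mult_add_right)
  qed
  have two: "aadd ?B x y \<in> acarrier ?B" "amult ?B x y \<in> acarrier ?B"
      "aadd ?B x y = aadd ?B y x"
      "ascale ?B c (aadd ?B x y) = aadd ?B (ascale ?B c x) (ascale ?B c y)"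
      "amult ?B x (ascale ?B c y) = ascale ?B c (amult ?B x y)"
      "amult ?B (ascale ?B c x) y = ascale ?B c (amult ?B x y)"
      "astar ?B (aadd ?B x y) = aadd ?B (astar ?B x) (astar ?B y)"
      "astar ?B (amult ?B x y) = amult ?B (astar ?B y) (astar ?B x)"
    if "x \<in> acarrier ?B" "y \<in> acarrier ?B" for x y c
  proof -
    obtain u where u: "u \<in> cauchy_seqs A" "x = cauchy_class A u" "\<And>n. u n \<in> \<C>"
      using classE[OF \<open>x \<in> _\<close>] by blast
    obtain v where v: "v \<in> cauchy_seqs A" "y = cauchy_class A v" "\<And>n. v n \<in> \<C>"
      using classE[OF \<open>y \<in> _\<close>] by blast
    note * = u(1) v(1) u(2) v(2) u(3) v(3)
    have "u n \<oplus> v n = v n \<oplus> u n" for n using * add_commute by blast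
    then show "aadd ?B x y = aadd ?B y x" by (simp only: *(1-4) ops)
    show "aadd ?B x y \<in> acarrier ?B" "amult ?B x y \<in> acarrier ?B"
      by (simp_all only: *(1-4) ops)
    show "ascale ?B c (aadd ?B x y) = aadd ?B (ascale ?B c x) (ascale ?B c y)"
      "amult ?B x (ascale ?B c y) = ascale ?B c (amult ?B x y)"
      "amult ?B (ascale ?B c x) y = ascale ?B c (amult ?B x y)"
      "astar ?B (aadd ?B x y) = aadd ?B (astar ?B x) (astar ?B y)"
      "astar ?B (amult ?B x y) = amult ?B (astar ?B y) (astar ?B x)"
      by (simp_all only: *(1-4) ops)
        (simp_all add: *(5,6) scale_add_right star_add star_mult)
  qed
  have one: "ascale ?B c x \<in> acarrier ?B" "astar ?B x \<in> acarrier ?B" "aadd ?B (azero ?B) x = x"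
      "ascale ?B (c + d) x = aadd ?B (ascale ?B c x) (ascale ?B d x)"
      "ascale ?B c (ascale ?B d x) = ascale ?B (c * d) x"
      "ascale ?B 1 x = x" "ascale ?B 0 x = azero ?B"
      "astar ?B (ascale ?B c x) = ascale ?B (cnj c) (astar ?B x)" "astar ?B (astar ?B x) = x"
    if x: "x \<in> acarrier ?B" for x c d
  proof -
    obtain u where *: "u \<in> cauchy_seqs A" "x = cauchy_class A u" "\<And>n. u n \<in> \<C>"
      using classE[OF x] by blast
    show "ascale ?B c x \<in> acarrier ?B" "astar ?B x \<in> acarrier ?B" 
      by (simp_all only: *(1,2) ops)
    show "aadd ?B (azero ?B) x = x"
      "ascale ?B (c + d) x = aadd ?B (ascale ?B c x) (ascale ?B d x)"
      "ascale ?B c (ascale ?B d x) = ascale ?B (c * d) x"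
      "ascale ?B 1 x = x" "ascale ?B 0 x = azero ?B"
      "astar ?B (ascale ?B c x) = ascale ?B (cnj c) (astar ?B x)" "astar ?B (astar ?B x) = x"
      by (simp_all only: *(1,2) ops)
        (simp_all add: *(3) scale_add_left star_scale)
  qed
  have zero: "azero ?B \<in> acarrier ?B"
    by (simp only: ops)
  show ?thesis by (rule star_alg.intro; (rule zero one two three)?; assumption?)
qed

lemma completion_cstar_seminorm: "cstar_seminorm (completion A) (anorm (completion A))"
proof -
  note [simp] = completion_add completion_scale completion_star completion_mult
    class_closed cauchy_add cauchy_scale cauchy_star cauchy_mult
  have 1: "0 \<le> anorm (completion A) X" if "X \<in> acarrier (completion A)" for X
    using that by (elim classE) (auto intro!: LIMSEQ_le_const[OF completion_norm])
  have 2: "anorm (completion A) (aadd (completion A) X Y) \<le> anorm (completion A) X + anorm (completion A) Y"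
    if XY: "X \<in> acarrier (completion A)" "Y \<in> acarrier (completion A)" for X Y
  proof -
    obtain u where u: "u \<in> cauchy_seqs A" "X = cauchy_class A u" "\<And>n. u n \<in> \<C>"
      using classE[OF XY(1)] by blast
    obtain v where v: "v \<in> cauchy_seqs A" "Y = cauchy_class A v" "\<And>n. v n \<in> \<C>"
      using classE[OF XY(2)] by blast
    note uv = u(1,2) v(1,2) u(3) v(3)
    show ?thesis unfolding uv(2,4) completion_add[OF uv(1,3)]
      by (rule LIMSEQ_le[OF completion_norm tendsto_add[OF completion_norm completion_norm]])
        (use uv N_add in auto)
  qed
  have 3: "anorm (completion A) (amult (completion A) X Y) \<le> anorm (completion A) X * anorm (completion A) Y"
    if XY: "X \<in> acarrier (completion A)" "Y \<in> acarrier (completion A)" for X Y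
  proof -
    obtain u where u: "u \<in> cauchy_seqs A" "X = cauchy_class A u" "\<And>n. u n \<in> \<C>"
      using classE[OF XY(1)] by blast
    obtain v where v: "v \<in> cauchy_seqs A" "Y = cauchy_class A v" "\<And>n. v n \<in> \<C>"
      using classE[OF XY(2)] by blast
    note uv = u(1,2) v(1,2) u(3) v(3)
    show ?thesis unfolding uv(2,4) completion_mult[OF uv(1,3)]
      by (rule LIMSEQ_le[OF completion_norm tendsto_mult[OF completion_norm completion_norm]])
        (use uv N_mult in auto)
  qed
  have 4: "anorm (completion A) (ascale (completion A) c X) = cmod c * anorm (completion A) X"
    if X: "X \<in> acarrier (completion A)" for c X
  proof -
    obtain u where u: "u \<in> cauchy_seqs A" "X = cauchy_class A u" "\<And>n. u n \<in> \<C>"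
      using classE[OF X] by blast
    show ?thesis unfolding u(2) completion_scale[OF u(1)]
      by (rule LIMSEQ_unique[OF completion_norm])
        (use u tendsto_mult_left[OF completion_norm[OF u(1)]] in auto)
  qed
  have 5: "anorm (completion A) (amult (completion A) (astar (completion A) X) X) = (anorm (completion A) X)\<^sup>2"
    if X: "X \<in> acarrier (completion A)" for X
  proof -
    obtain u where u: "u \<in> cauchy_seqs A" "X = cauchy_class A u" "\<And>n. u n \<in> \<C>"
      using classE[OF X] by blast
    show ?thesis unfolding u(2) completion_star[OF u(1)] completion_mult[OF cauchy_star[OF u(1)] u(1)]
      by (rule LIMSEQ_unique[OF completion_norm])
        (use u tendsto_power[OF completion_norm[OF u(1)], of 2] in \<open>auto simp: N_star_mult\<close>)
  qed
  show ?thesis using 1 2 3 4 5 by (simp add: cstar_seminorm_def)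
qed

lemma completion_pre_cstar: "pre_cstar (completion A)"
  by (simp add: completion_cstar_seminorm completion_star_alg pre_cstar_def star_seminorm_axioms_def
      star_seminorm_def)

interpretation completion: pre_cstar "completion A"
  by (rule completion_pre_cstar)

lemma completion_definite:
  assumes "X \<in> acarrier (completion A)" "anorm (completion A) X = 0"
  shows "X = azero (completion A)"
proof -
  obtain u where u: "u \<in> cauchy_seqs A" "X = cauchy_class A u" "\<And>n. u n \<in> \<C>"
    using classE[OF assms(1)] by blast
  show ?thesis using completion_norm[OF u(1)] assms(2) u
    by (simp add: completion_zero class_eq_iff adist_eq cauchy_seqs_closed)
qed

lemma to_completion_closed [simp]: "a \<in> \<C> \<Longrightarrow> to_completion A a \<in> acarrier (completion A)"
  by (simp add: to_completion_def class_closed)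

lemma to_completion_add: "\<lbrakk>a \<in> \<C>; b \<in> \<C>\<rbrakk> \<Longrightarrow>
    to_completion A (a \<oplus> b) = aadd (completion A) (to_completion A a) (to_completion A b)"
  and to_completion_scale: "a \<in> \<C> \<Longrightarrow>
    to_completion A (c \<odot> a) = ascale (completion A) c (to_completion A a)"
  and to_completion_mult: "\<lbrakk>a \<in> \<C>; b \<in> \<C>\<rbrakk> \<Longrightarrow>
    to_completion A (a \<otimes> b) = amult (completion A) (to_completion A a) (to_completion A b)"
  by (simp_all add: to_completion_def completion_add completion_scale completion_mult)

lemma to_completion_norm [simp]: "a \<in> \<C> \<Longrightarrow> anorm (completion A) (to_completion A a) = anorm A a"
  unfolding to_completion_def
  using LIMSEQ_unique[OF completion_norm[of "\<lambda>_. a"] tendsto_const] by simp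

lemma adist_to_completion:
  "\<lbrakk>a \<in> \<C>; b \<in> \<C>\<rbrakk> \<Longrightarrow> adist (completion A) (to_completion A a) (to_completion A b) = adist A a b"
  by (simp add: completion.adist_eq adist_eq to_completion_add[symmetric] to_completion_scale[symmetric])

text \<open>The Cauchy estimate with \<open>n\<close> fixed passes to the limit in the norm of the
  completion, at the price of a non-strict inequality; hence the \<open>e/2\<close>.\<close>

lemma class_limit:
  assumes u: "u \<in> cauchy_seqs A"
  shows "(\<lambda>n. adist (completion A) (cauchy_class A u) (to_completion A (u n))) \<longlonglongrightarrow> 0"
proof (rule LIMSEQ_I)
  fix e :: real assume e: "0 < e"
  obtain N where N: "\<forall>m\<ge>N. \<forall>n\<ge>N. adist A (u m) (u n) < e/2"
    using cauchy_seqsD[OF u, of "e/2"] e by auto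
  have "adist (completion A) (cauchy_class A u) (to_completion A (u n)) \<le> e/2" if n: "n \<ge> N" for n
  proof -
    have un: "u n \<in> \<C>" using u by (rule cauchy_seqs_closed)
    have c: "(\<lambda>m. u m \<ominus> u n) \<in> cauchy_seqs A"
      using cauchy_add[OF u cauchy_const[of "(-1) \<odot> u n"]] un by simp
    have "adist (completion A) (cauchy_class A u) (to_completion A (u n))
        = anorm (completion A) (cauchy_class A (\<lambda>m. u m \<ominus> u n))"
      using u un by (simp add: completion.adist_eq to_completion_def completion_scale completion_add)
    also have "\<dots> \<le> e/2"
      using N n by (intro LIMSEQ_le_const2[OF completion_norm[OF c]] exI[of _ N])
        (auto simp: adist_eq less_imp_le)
    finally show ?thesis .
  qed
  then have "norm (adist (completion A) (cauchy_class A u) (to_completion A (u n)) - 0) < e" if "n \<ge> N" for n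
    using that e completion.adist_nonneg[OF class_closed[OF u] to_completion_closed[OF cauchy_seqs_closed[OF u]], of n]
    by fastforce
  then show "\<exists>N. \<forall>n\<ge>N. norm (adist (completion A) (cauchy_class A u) (to_completion A (u n)) - 0) < e"
    by blast
qed

lemma completion_dense:
  assumes "X \<in> acarrier (completion A)" "0 < e"
  obtains a where "a \<in> \<C>" "adist (completion A) X (to_completion A a) < e"
proof -
  obtain u where u: "u \<in> cauchy_seqs A" "X = cauchy_class A u" "\<And>n. u n \<in> \<C>"
    using classE[OF assms(1)] by blast
  have "eventually (\<lambda>n. adist (completion A) X (to_completion A (u n)) < e) sequentially"
    using order_tendstoD(2)[OF class_limit[OF u(1)]] assms(2) u(2) by simp
  then show ?thesis using that cauchy_seqs_closed[OF u(1)]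
    by (metis (no_types, lifting) eventually_sequentially le_refl)
qed

text \<open>Replacing \<open>X n\<close> by an element of \<open>A\<close> at distance below
  \<open>1 / Suc n\<close> gives a Cauchy sequence in \<open>A\<close>, and its class is the
  limit.\<close>

lemma completion_complete:
  assumes X: "X \<in> cauchy_seqs (completion A)"
  shows "\<exists>Y\<in>acarrier (completion A). (\<lambda>n. adist (completion A) (X n) Y) \<longlonglongrightarrow> 0"
proof -
  have XC: "X n \<in> acarrier (completion A)" for n using X by (rule completion.cauchy_seqs_closed)
  have "\<exists>a\<in>\<C>. adist (completion A) (X n) (to_completion A a) < 1 / Suc n" for n
    using completion_dense[OF XC, of "1 / Suc n" n] by (metis of_nat_0_less_iff zero_less_Suc zero_less_divide_1_iff)
  then obtain a where a: "\<And>n. a n \<in> \<C>" "\<And>n. adist (completion A) (X n) (to_completion A (a n)) < 1 / Suc n"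
    by metis
  have lim: "(\<lambda>n. adist (completion A) (X n) (to_completion A (a n))) \<longlonglongrightarrow> 0"
    by (rule tendsto_sandwich[OF _ _ tendsto_const LIMSEQ_Suc[OF lim_inverse_n']])
      (use a XC in \<open>auto simp: less_imp_le\<close>)
  have ac: "a \<in> cauchy_seqs A"
  proof (rule cauchy_seqsI[OF a(1)])
    fix e :: real assume e: "0 < e"
    obtain M where M: "\<forall>m\<ge>M. \<forall>n\<ge>M. adist (completion A) (X m) (X n) < e/3"
      using completion.cauchy_seqsD[OF X, of "e/3"] e by auto
    obtain N where N: "\<forall>n\<ge>N. adist (completion A) (X n) (to_completion A (a n)) < e/3"
      using order_tendstoD(2)[OF lim, of "e/3"] e by (auto simp: eventually_sequentially)
    have "adist A (a m) (a n) < e" if mn: "m \<ge> max M N" "n \<ge> max M N" for m n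
    proof -
      have "adist A (a m) (a n) = adist (completion A) (to_completion A (a m)) (to_completion A (a n))"
        using a by (simp add: adist_to_completion)
      also have "\<dots> \<le> adist (completion A) (to_completion A (a m)) (X m)
          + (adist (completion A) (X m) (X n) + adist (completion A) (X n) (to_completion A (a n)))"
        using a XC by (intro order_trans[OF completion.adist_triangle[of _ "X m"]] add_left_mono
            completion.adist_triangle) auto
      also have "\<dots> < e"
        using M[rule_format, of m n] N[rule_format, of m] N[rule_format, of n] mn
          completion.adist_commute[of "X m" "to_completion A (a m)"] a XC by simp
      finally show ?thesis .
    qed
    then show "\<exists>N. \<forall>m\<ge>N. \<forall>n\<ge>N. adist A (a m) (a n) < e" by blast
  qed
  let ?Y = "cauchy_class A a"
  have "(\<lambda>n. adist (completion A) (X n) (to_completion A (a n)) + adist (completion A) ?Y (to_completion A (a n))) \<longlonglongrightarrow> 0 + 0"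
    by (intro tendsto_add lim class_limit ac)
  moreover have "adist (completion A) (X n) ?Y
      \<le> adist (completion A) (X n) (to_completion A (a n)) + adist (completion A) ?Y (to_completion A (a n))" for n
    using completion.adist_triangle[of "X n" "to_completion A (a n)" ?Y] XC a class_closed[OF ac]
      completion.adist_commute[of ?Y "to_completion A (a n)"] by simp
  ultimately have "(\<lambda>n. adist (completion A) (X n) ?Y) \<longlonglongrightarrow> 0"
    by (elim null_squeeze[OF tendsto_eq_rhs]) (use XC class_closed[OF ac] in auto)
  then show ?thesis using class_closed[OF ac] by blast
qed

end

locale cstar_alg = pre_cstar +
  assumes definite: "\<lbrakk>a \<in> acarrier A; anorm A a = 0\<rbrakk> \<Longrightarrow> a = azero A"
    and complete: "u \<in> cauchy_seqs A \<Longrightarrow> \<exists>a\<in>acarrier A. (\<lambda>n. adist A (u n) a) \<longlonglongrightarrow> 0"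

lemma (in pre_cstar) completion_cstar_alg: "cstar_alg (completion A)"
  by (intro cstar_alg.intro completion_pre_cstar cstar_alg_axioms.intro completion_definite
      completion_complete)

section \<open>Automatic continuity\<close>

context cstar_alg
begin

lemma adist_eq_0: "\<lbrakk>a \<in> \<C>; b \<in> \<C>; adist A a b = 0\<rbrakk> \<Longrightarrow> a = b"
  using definite[of "a \<ominus> b"] diff_eq_zero[of a b] by (simp add: adist_eq)

lemma limit_unique:
  assumes "\<And>n. u n \<in> \<C>" "a \<in> \<C>" "b \<in> \<C>" "(\<lambda>n. adist A (u n) a) \<longlonglongrightarrow> 0" "(\<lambda>n. adist A (u n) b) \<longlonglongrightarrow> 0"
  shows "a = b"
proof (rule adist_eq_0)
  have "adist A a b \<le> adist A (u n) a + adist A (u n) b" for n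
    using adist_triangle[of a "u n" b] adist_commute[of a "u n"] assms by simp
  then have "adist A a b \<le> 0"
    using LIMSEQ_le_const[OF tendsto_add[OF assms(4,5)], of "adist A a b"] by simp
  then show "adist A a b = 0" using adist_nonneg[of a b] assms by linarith
qed (use assms in auto)

text \<open>The solution \<open>k = 1 - sqrt (1 - h\<^sup>2)\<close> of \<open>h\<^sup>2 + k\<^sup>2 = 2 k\<close> is the fixed point of the
  contraction \<open>k \<mapsto> (h\<^sup>2 + k\<^sup>2) / 2\<close>.\<close>

lemma sqrt_defect:
  assumes h: "h \<in> \<C>" "h\<^sup>\<star> = h" and r: "anorm A h < 1"
  obtains k where "k \<in> \<C>" "k\<^sup>\<star> = k" "h \<otimes> k = k \<otimes> h" "h \<otimes> h \<oplus> k \<otimes> k = 2 \<odot> k"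
proof -
  define r where "r = anorm A h"
  have r01: "0 \<le> r" "r < 1" using h r by (auto simp: r_def)
  define F where "F k = (1/2) \<odot> (h \<otimes> h \<oplus> k \<otimes> k)" for k
  define k where "k n = (F ^^ n) (azero A)" for n
  have kS: "k (Suc n) = F (k n)" for n by (simp add: k_def)
  have k0: "k 0 = azero A" by (simp add: k_def)
  have kC [simp]: "k n \<in> \<C>" for n by (induction n) (use h in \<open>auto simp: k0 kS F_def\<close>)
  have ks: "(k n)\<^sup>\<star> = k n" for n
    by (induction n) (use h in \<open>auto simp: k0 kS F_def star_add star_scale star_mult\<close>)
  have kh: "h \<otimes> k n = k n \<otimes> h" for n
  proof (induction n)
    case (Suc n)
    have "h \<otimes> (k n \<otimes> k n) = (k n \<otimes> k n) \<otimes> h"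
      using Suc h by (metis kC mult_assoc)
    then show ?case using h by (simp add: kS F_def mult_add_left mult_add_right mult_assoc)
  qed (use h in \<open>simp add: k0\<close>)
  have nk: "anorm A (k n) \<le> r" for n
  proof (induction n)
    case (Suc n)
    have "anorm A (h \<otimes> h \<oplus> k n \<otimes> k n) \<le> r * r + r * r"
      using h Suc r01 by (intro order_trans[OF N_add] add_mono order_trans[OF N_mult] mult_mono)
        (auto simp: r_def)
    also have "\<dots> \<le> 2 * r" using r01 mult_left_le[of r r] by simp
    finally show ?case using h by (simp add: kS F_def)
  qed (use r01 in \<open>simp add: k0\<close>)
  \<comment> \<open>On the ball of radius \<open>r\<close>, which by \<open>nk\<close> contains the
    iterates, the factorization \<open>x x - y y = x (x - y) + (x - y) y\<close> makes
    \<open>F\<close> contract by \<open>r\<close>.\<close>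
  have contr: "adist A (F x) (F y) \<le> r * adist A x y"
    if "x \<in> \<C>" "y \<in> \<C>" "anorm A x \<le> r" "anorm A y \<le> r" for x y
  proof -
    have "adist A (F x) (F y) = (1/2) * adist A (h \<otimes> h \<oplus> x \<otimes> x) (h \<otimes> h \<oplus> y \<otimes> y)"
      unfolding F_def using h that by (subst adist_scale) auto
    also have "\<dots> \<le> (1/2) * adist A (x \<otimes> x) (y \<otimes> y)"
      using adist_add[of "h \<otimes> h" "x \<otimes> x" "h \<otimes> h" "y \<otimes> y"] h that by simp
    also have "\<dots> \<le> (1/2) * (anorm A x * adist A x y + adist A x y * anorm A y)"
      using adist_mult[of x x y y] that by simp
    also have "\<dots> \<le> (1/2) * (r * adist A x y + adist A x y * r)"
      using that by (intro mult_left_mono add_mono mult_right_mono) auto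
    finally show ?thesis by simp
  qed
  have step: "adist A (k (Suc n)) (k n) \<le> r ^ n * r" for n
  proof (induction n)
    case 0
    show ?case using nk[of 1] by (simp add: k0 adist_eq)
  next
    case (Suc n)
    have "adist A (k (Suc (Suc n))) (k (Suc n)) \<le> r * adist A (k (Suc n)) (k n)"
      using contr[OF kC kC nk nk, of "Suc n" n] by (simp add: kS)
    also have "\<dots> \<le> r * (r ^ n * r)" using Suc r01 by (intro mult_left_mono)
    finally show ?case by simp
  qed
  have far: "adist A (k (n + d)) (k n) \<le> r ^ n * (r / (1 - r))" for n d
  proof -
    have "adist A (k (n + d)) (k n) \<le> (\<Sum>i<d. r ^ (n + i) * r)"
    proof (induction d)
      case (Suc d)
      show ?case using adist_triangle[of "k (n + Suc d)" "k (n + d)" "k n"] Suc step[of "n + d"] by simp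
    qed simp
    also have "\<dots> = r ^ n * r * (\<Sum>i<d. r ^ i)"
      by (simp add: power_add sum_distrib_left algebra_simps)
    also have "\<dots> \<le> r ^ n * r * (1 / (1 - r))"
    proof (rule mult_left_mono)
      show "(\<Sum>i<d. r ^ i) \<le> 1 / (1 - r)"
        using sum_gp_strict[of r d] r01 by (simp add: divide_right_mono)
    qed (use r01 in auto)
    finally show ?thesis by simp
  qed
  have lim0: "(\<lambda>n. r ^ n * (r / (1 - r))) \<longlonglongrightarrow> 0"
    using r01 by (intro tendsto_mult_left_zero LIMSEQ_realpow_zero) auto
  have "k \<in> cauchy_seqs A"
  proof (rule cauchy_seqsI[OF kC])
    fix e :: real assume e: "0 < e"
    obtain M where M: "\<forall>n\<ge>M. r ^ n * (r / (1 - r)) < e"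
      using order_tendstoD(2)[OF lim0 e] by (auto simp: eventually_sequentially)
    have *: "adist A (k m) (k n) < e" if "m \<ge> M" "n \<ge> m" for m n
      using far[of m "n - m"] M[rule_format, of m] that adist_commute[of "k m" "k n"] by simp
    have "adist A (k m) (k n) < e" if "m \<ge> M" "n \<ge> M" for m n
      using *[of m n] *[of n m] adist_commute[of "k m" "k n"] that by (cases "n \<ge> m") auto
    then show "\<exists>M. \<forall>m\<ge>M. \<forall>n\<ge>M. adist A (k m) (k n) < e" by blast
  qed
  then obtain l where l: "l \<in> \<C>" "(\<lambda>n. adist A (k n) l) \<longlonglongrightarrow> 0" using complete by blast
  \<comment> \<open>\<open>contr\<close> needs both arguments in the ball of radius
    \<open>r\<close>, so the limit has to be placed there before \<open>F l = l\<close> can be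
    derived.\<close>
  have nl: "anorm A l \<le> r"
  proof -
    have "anorm A l \<le> adist A (k n) l + r" for n
      using N_le_diff[of l "k n"] nk[of n] l adist_commute[of "k n" l] by (simp add: adist_eq)
    then show ?thesis using LIMSEQ_le_const[OF tendsto_add[OF l(2) tendsto_const], of "anorm A l"] by auto
  qed
  have "l\<^sup>\<star> = l"
  proof (rule limit_unique[of k])
    show "(\<lambda>n. adist A (k n) (l\<^sup>\<star>)) \<longlonglongrightarrow> 0"
      using l adist_star[of "k _" l] ks by simp
  qed (use l in auto)
  moreover have "F l = l"
  proof (rule limit_unique[of "\<lambda>n. k (Suc n)"])
    show "(\<lambda>n. adist A (k (Suc n)) (F l)) \<longlonglongrightarrow> 0"
      by (rule tendsto_sandwich[OF _ _ tendsto_const tendsto_mult_right_zero[OF l(2), of r]])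
        (use contr[OF kC _ nk] l nl h in \<open>auto simp: kS F_def\<close>)
    show "(\<lambda>n. adist A (k (Suc n)) l) \<longlonglongrightarrow> 0" using l(2) by (rule LIMSEQ_Suc)
    show "F l \<in> \<C>" using l h by (simp add: F_def)
  qed (use l in auto)
  moreover have "h \<otimes> l = l \<otimes> h"
  proof (rule limit_unique[of "\<lambda>n. h \<otimes> k n"])
    show "(\<lambda>n. adist A (h \<otimes> k n) (h \<otimes> l)) \<longlonglongrightarrow> 0"
      by (rule tendsto_sandwich[OF _ _ tendsto_const tendsto_mult_right_zero[OF l(2), of r]])
        (use adist_mult[of h "k _" h l] l h in \<open>auto simp: r_def\<close>)
    show "(\<lambda>n. adist A (h \<otimes> k n) (l \<otimes> h)) \<longlonglongrightarrow> 0"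
      by (rule tendsto_sandwich[OF _ _ tendsto_const tendsto_mult_left_zero[OF l(2), of r]])
        (use adist_mult[of "k _" h l h] l h in \<open>auto simp: r_def kh\<close>)
  qed (use l h in auto)
  moreover have "h \<otimes> h \<oplus> l \<otimes> l = 2 \<odot> F l" using l h by (simp add: F_def)
  ultimately show ?thesis using that l(1) by simp
qed

text \<open>After scaling, a self-adjoint element has norm below 1, so \<open>sqrt_defect\<close>
  supplies the \<open>k\<close> that \<open>N_le_one\<close> needs for \<open>p\<close>.
  Completeness is required of the norm, not of \<open>p\<close>. General \<open>a\<close> reduce to
  \<open>a* a\<close> by the two C*-identities.\<close>

lemma cstar_seminorm_le_norm:
  assumes p: "cstar_seminorm A p" and a: "a \<in> \<C>"
  shows "p a \<le> anorm A a"
proof -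
  interpret p: star_seminorm A p using p by (rule star_seminormI)
  have sa: "p h \<le> anorm A h" if h: "h \<in> \<C>" "h\<^sup>\<star> = h" for h
  proof (rule dense_ge)
    fix t assume t: "anorm A h < t"
    then have t0: "0 < t" using N_nonneg[OF h(1)] by linarith
    let ?h = "complex_of_real (1 / t) \<odot> h"
    have h': "?h \<in> \<C>" "?h\<^sup>\<star> = ?h" using h by (auto simp: star_scale)
    have "anorm A ?h < 1" using t t0 h by (simp add: norm_divide)
    then obtain k where "k \<in> \<C>" "k\<^sup>\<star> = k" "?h \<otimes> k = k \<otimes> ?h" "?h \<otimes> ?h \<oplus> k \<otimes> k = 2 \<odot> k"
      using sqrt_defect[OF h'] by blast
    then have "p ?h \<le> 1" using p.N_le_one h' by blast
    then show "p h \<le> t" using t0 h by (simp add: norm_divide field_simps)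
  qed
  have "(p a)\<^sup>2 \<le> (anorm A a)\<^sup>2"
    using sa[of "a\<^sup>\<star> \<otimes> a"] p.N_star_mult[OF a] N_star_mult[OF a] a by (simp add: star_mult)
  then show ?thesis by (rule power2_le_imp_le) (use a in simp)
qed

end

text \<open>The norm of \<open>B\<close> pulled back along \<Psi> is a C*-seminorm on the complete
  algebra \<open>A\<close>. No continuity of \<Psi> is presupposed.\<close>

lemma star_hom_contractive:
  assumes A: "cstar_alg A" and B: "pre_cstar B" and hom: "star_hom A B \<Psi>" and a: "a \<in> acarrier A"
  shows "anorm B (\<Psi> a) \<le> anorm A a"
proof -
  interpret A: cstar_alg A by fact
  interpret B: pre_cstar B by fact
  have [simp]: "\<Psi> x \<in> acarrier B" if "x \<in> acarrier A" for x using hom that by (auto simp: star_hom_def)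
  have "cstar_seminorm A (\<lambda>a. anorm B (\<Psi> a))"
    using hom B.N_add B.N_mult B.N_star_mult by (auto simp: cstar_seminorm_def star_hom_def)
  then show ?thesis using a by (rule A.cstar_seminorm_le_norm)
qed

section \<open>Homomorphisms to the multiplier algebra with values in the algebra\<close>

context cstar_alg
begin

text \<open>Testing with the adjoint of \<open>a\<close> suffices, by the C*-identity.\<close>

lemma mult_left_cancel:
  assumes a: "a \<in> \<C>" and z: "\<And>b. b \<in> \<C> \<Longrightarrow> a \<otimes> b = azero A"
  shows "a = azero A"
proof (rule definite[OF a])
  have "(anorm A (a\<^sup>\<star>))\<^sup>2 = 0" using N_star_mult[of "a\<^sup>\<star>"] z[of "a\<^sup>\<star>"] a by simp
  then show "anorm A a = 0" using a by simp
qed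

lemma to_multiplier_inj: "inj_on (to_multiplier A) \<C>"
proof (rule inj_onI)
  fix a b assume ab: "a \<in> \<C>" "b \<in> \<C>" "to_multiplier A a = to_multiplier A b"
  have "a \<otimes> c = b \<otimes> c" if "c \<in> \<C>" for c
    using ab(3) that unfolding to_multiplier_def by (metis Pair_inject restrict_apply')
  then have "a \<ominus> b = azero A"
    using ab by (subst mult_left_cancel[of "a \<ominus> b"]) (auto simp: mult_add_left)
  then show "a = b" using diff_eq_zero ab by blast
qed

lemma to_multiplier_hom:
  assumes "a \<in> \<C>"
  shows "b \<in> \<C> \<Longrightarrow> aadd (multiplier_algebra A) (to_multiplier A a) (to_multiplier A b) = to_multiplier A (a \<oplus> b)"
    "ascale (multiplier_algebra A) c (to_multiplier A a) = to_multiplier A (c \<odot> a)"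
    "b \<in> \<C> \<Longrightarrow> amult (multiplier_algebra A) (to_multiplier A a) (to_multiplier A b) = to_multiplier A (a \<otimes> b)"
    "astar (multiplier_algebra A) (to_multiplier A a) = to_multiplier A (a\<^sup>\<star>)"
  using assms
  by (auto simp: multiplier_algebra_def to_multiplier_def fun_eq_iff restrict_def
      mult_add_left mult_add_right mult_assoc star_mult)

text \<open>The image of \<Phi> is exactly the canonical copy of the algebra in its multipliers, so
  \<Phi> is composed with the inverse of \<open>to_multiplier\<close>; \<open>key\<close> pulls each
  algebraic law back through the injective embedding.\<close>

lemma multiplier_valued_hom:
  assumes B: "star_alg B" and hom: "star_hom B (multiplier_algebra A) \<Phi>"
    and bij: "bij_betw \<Phi> (acarrier B) (to_multiplier A ` \<C>)"
  obtains \<Psi> where "star_hom B A \<Psi>" "bij_betw \<Psi> (acarrier B) \<C>"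
    "\<And>b. b \<in> acarrier B \<Longrightarrow> \<Phi> b = to_multiplier A (\<Psi> b)"
proof
  interpret B: star_alg B by fact
  define \<Psi> where "\<Psi> = the_inv_into \<C> (to_multiplier A) \<circ> \<Phi>"
  have inv: "bij_betw (the_inv_into \<C> (to_multiplier A)) (to_multiplier A ` \<C>) \<C>"
    by (rule bij_betw_the_inv_into) (simp add: bij_betw_def to_multiplier_inj)
  show bij': "bij_betw \<Psi> (acarrier B) \<C>"
    unfolding \<Psi>_def by (rule bij_betw_trans[OF bij inv])
  have C: "\<Psi> b \<in> \<C>" if "b \<in> acarrier B" for b using bij' that by (auto simp: bij_betw_def)
  show eq: "\<Phi> b = to_multiplier A (\<Psi> b)" if "b \<in> acarrier B" for b
    unfolding \<Psi>_def comp_def using bij that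
    by (subst f_the_inv_into_f[OF to_multiplier_inj]) (auto simp: bij_betw_def)
  have key: "\<Psi> b = a" if "b \<in> acarrier B" "a \<in> \<C>" "\<Phi> b = to_multiplier A a" for a b
    using inj_onD[OF to_multiplier_inj, of "\<Psi> b" a] eq[of b] C[of b] that by simp
  have add: "\<Psi> (aadd B a b) = \<Psi> a \<oplus> \<Psi> b" if ab: "a \<in> acarrier B" "b \<in> acarrier B" for a b
    by (rule key) (use hom ab C in \<open>simp_all add: star_hom_def eq to_multiplier_hom(1)\<close>)
  have mult: "\<Psi> (amult B a b) = \<Psi> a \<otimes> \<Psi> b" if ab: "a \<in> acarrier B" "b \<in> acarrier B" for a b
    by (rule key) (use hom ab C in \<open>simp_all add: star_hom_def eq to_multiplier_hom(3)\<close>)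
  have scale: "\<Psi> (ascale B c a) = c \<odot> \<Psi> a" if a: "a \<in> acarrier B" for a c
    by (rule key) (use hom a C in \<open>simp_all add: star_hom_def eq to_multiplier_hom(2)\<close>)
  have star: "\<Psi> (astar B a) = (\<Psi> a)\<^sup>\<star>" if a: "a \<in> acarrier B" for a
    by (rule key) (use hom a C in \<open>simp_all add: star_hom_def eq to_multiplier_hom(4)\<close>)
  show "star_hom B A \<Psi>" using C add mult scale star by (auto simp: star_hom_def)
qed

end

section \<open>Convolution of functions with finite support on fibres\<close>

context algebraic_groupoid
begin

abbreviation rg ("\<r>") where "\<r> \<equiv> rng G"
abbreviation sc ("\<s>") where "\<s> \<equiv> src G"
abbreviation gc (infixl "\<cdot>" 70) where "g \<cdot> h \<equiv> gcomp G g h"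
abbreviation gi ("\<iota>") where "\<iota> \<equiv> ginv G"
abbreviation arr ("\<A>") where "\<A> \<equiv> arrows G"

lemmas gpd [simp] = rng_closed src_closed rng_rng src_rng rng_src src_src comp_closed rng_comp src_comp
  comp_rng_left comp_src_right inv_closed rng_inv src_inv comp_inv_right comp_inv_left

lemma units_subset: "units G \<subseteq> \<A>"
  by (auto simp: units_def)

lemma units_iff_rng: "x \<in> units G \<longleftrightarrow> x \<in> \<A> \<and> \<r> x = x"
  by (auto simp: units_def) (metis imageI)

lemma units_iff_src: "x \<in> units G \<longleftrightarrow> x \<in> \<A> \<and> \<s> x = x"
  unfolding units_iff_rng by (metis rng_src src_rng)

lemma rng_unit [simp]: "x \<in> units G \<Longrightarrow> \<r> x = x"
  by (simp add: units_iff_rng)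

lemma src_unit [simp]: "x \<in> units G \<Longrightarrow> \<s> x = x"
  by (simp add: units_iff_src)

lemma unit_arrow [simp]: "x \<in> units G \<Longrightarrow> x \<in> \<A>"
  by (simp add: units_iff_rng)

lemma rng_in_units [simp]: "g \<in> \<A> \<Longrightarrow> \<r> g \<in> units G"
  by (simp add: units_iff_rng del: unit_arrow)

lemma src_in_units [simp]: "g \<in> \<A> \<Longrightarrow> \<s> g \<in> units G"
  by (simp add: units_iff_rng del: unit_arrow)

lemma inv_comp_cancel [simp]: "\<lbrakk>k \<in> \<A>; m \<in> \<A>; \<s> k = \<r> m\<rbrakk> \<Longrightarrow> \<iota> k \<cdot> (k \<cdot> m) = m"
  by (subst comp_assoc[symmetric]) auto

lemma comp_inv_cancel [simp]: "\<lbrakk>k \<in> \<A>; g \<in> \<A>; \<r> k = \<r> g\<rbrakk> \<Longrightarrow> k \<cdot> (\<iota> k \<cdot> g) = g"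
  by (subst comp_assoc[symmetric]) auto

lemma inv_unique: "\<lbrakk>g \<in> \<A>; h \<in> \<A>; \<s> g = \<r> h; g \<cdot> h = \<r> g\<rbrakk> \<Longrightarrow> h = \<iota> g"
  by (metis comp_src_right inv_closed inv_comp_cancel src_inv)

lemma inv_inv [simp]: "g \<in> \<A> \<Longrightarrow> \<iota> (\<iota> g) = g"
  using inv_unique[of "\<iota> g" g] by simp

lemma inv_unit [simp]: "x \<in> units G \<Longrightarrow> \<iota> x = x"
  using inv_unique[of x x] comp_rng_left[of x] by simp

lemma inv_comp [simp]:
  assumes "g \<in> \<A>" "h \<in> \<A>" "\<s> g = \<r> h" shows "\<iota> (g \<cdot> h) = \<iota> h \<cdot> \<iota> g"
proof (rule inv_unique[symmetric])
  have "(g \<cdot> h) \<cdot> (\<iota> h \<cdot> \<iota> g) = g \<cdot> (h \<cdot> (\<iota> h \<cdot> \<iota> g))"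
    using assms by (intro comp_assoc) auto
  also have "\<dots> = g \<cdot> \<iota> g"
    using assms by (intro arg_cong[of _ _ "\<lambda>x. g \<cdot> x"] comp_inv_cancel) auto
  finally show "(g \<cdot> h) \<cdot> (\<iota> h \<cdot> \<iota> g) = \<r> (g \<cdot> h)" using assms by simp
qed (use assms in auto)

lemma inv_comp_unit_iff:
  assumes "k \<in> \<A>" "g \<in> \<A>" "\<r> k = \<r> g" shows "\<iota> k \<cdot> g \<in> units G \<longleftrightarrow> k = g"
proof
  assume u: "\<iota> k \<cdot> g \<in> units G"
  then have "\<iota> k \<cdot> g = \<s> k"
    by (metis assms inv_closed rng_comp rng_inv rng_unit src_inv u)
  then show "k = g" using comp_inv_cancel[OF assms] assms by simp
qed (use assms in auto)

text \<open>Convolution sums over range fibres and \<open>convolution_inner\<close> over source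
  fibres, so both kinds must be finite; the algebra of this section then needs no topology.\<close>

definition fibre_finite :: "('g \<Rightarrow> complex) \<Rightarrow> bool" where
  "fibre_finite f \<longleftrightarrow> (\<forall>g. g \<notin> \<A> \<longrightarrow> f g = 0) \<and>
     (\<forall>x. finite {k \<in> \<A>. \<r> k = x \<and> f k \<noteq> 0}) \<and> (\<forall>x. finite {k \<in> \<A>. \<s> k = x \<and> f k \<noteq> 0})"

lemma fibre_finite_zero_off: "\<lbrakk>fibre_finite f; g \<notin> \<A>\<rbrakk> \<Longrightarrow> f g = 0"
  by (simp add: fibre_finite_def)

lemma fibre_finite_add: "\<lbrakk>fibre_finite f; fibre_finite f'\<rbrakk> \<Longrightarrow> fibre_finite (\<lambda>g. f g + f' g)"
  unfolding fibre_finite_def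
proof (intro conjI allI impI; elim conjE)
  fix x assume *: "\<forall>x. finite {k \<in> \<A>. \<r> k = x \<and> f k \<noteq> 0}" "\<forall>x. finite {k \<in> \<A>. \<r> k = x \<and> f' k \<noteq> 0}"
  show "finite {k \<in> \<A>. \<r> k = x \<and> f k + f' k \<noteq> 0}"
    by (rule finite_subset[OF _ finite_UnI[OF *(1)[rule_format, of x] *(2)[rule_format, of x]]]) auto
next
  fix x assume *: "\<forall>x. finite {k \<in> \<A>. \<s> k = x \<and> f k \<noteq> 0}" "\<forall>x. finite {k \<in> \<A>. \<s> k = x \<and> f' k \<noteq> 0}"
  show "finite {k \<in> \<A>. \<s> k = x \<and> f k + f' k \<noteq> 0}"
    by (rule finite_subset[OF _ finite_UnI[OF *(1)[rule_format, of x] *(2)[rule_format, of x]]]) auto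
qed auto

lemma infsum_eq_finite_sum:
  fixes t :: "'a \<Rightarrow> complex"
  assumes "finite S" "S \<subseteq> I" "\<And>k. \<lbrakk>k \<in> I; k \<notin> S\<rbrakk> \<Longrightarrow> t k = 0"
  shows "infsum t I = sum t S"
proof -
  have "infsum t I = infsum t S" by (rule infsum_cong_neutral) (use assms in auto)
  then show ?thesis using assms by simp
qed

lemma convolution_sum:
  assumes "g \<in> \<A>" "finite S" "S \<subseteq> {k \<in> \<A>. \<r> k = \<r> g}"
    "\<And>k. \<lbrakk>k \<in> \<A>; \<r> k = \<r> g; k \<notin> S\<rbrakk> \<Longrightarrow> f k = 0 \<or> f' (\<iota> k \<cdot> g) = 0"
  shows "convolution G f f' g = (\<Sum>k\<in>S. f k * f' (\<iota> k \<cdot> g))"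
  unfolding convolution_def using assms by (simp, intro infsum_eq_finite_sum) auto

lemma convolution_sum_supp:
  assumes "fibre_finite f" "g \<in> \<A>"
  shows "convolution G f f' g = (\<Sum>k\<in>{k \<in> \<A>. \<r> k = \<r> g \<and> f k \<noteq> 0}. f k * f' (\<iota> k \<cdot> g))"
  by (rule convolution_sum) (use assms in \<open>auto simp: fibre_finite_def\<close>)

lemma convolution_zero_off [simp]: "g \<notin> \<A> \<Longrightarrow> convolution G f f' g = 0"
  by (simp add: convolution_def)

lemma convolution_nonzero:
  assumes "convolution G f f' g \<noteq> 0"
  obtains k m where "k \<in> \<A>" "m \<in> \<A>" "\<s> k = \<r> m" "g = k \<cdot> m" "f k \<noteq> 0" "f' m \<noteq> 0"
proof -
  have g: "g \<in> \<A>" using assms convolution_zero_off by blast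
  have "\<exists>k\<in>{k \<in> \<A>. \<r> k = \<r> g}. f k * f' (\<iota> k \<cdot> g) \<noteq> 0"
  proof (rule ccontr)
    assume "\<not> ?thesis"
    then have "convolution G f f' g = 0" unfolding convolution_def using g by (auto intro!: infsum_0)
    then show False using assms by contradiction
  qed
  then obtain k where "k \<in> \<A>" "\<r> k = \<r> g" "f k \<noteq> 0" "f' (\<iota> k \<cdot> g) \<noteq> 0" by auto
  then show ?thesis using that[of k "\<iota> k \<cdot> g"] g by simp
qed

lemma convolution_add_right:
  assumes "fibre_finite f"
  shows "convolution G f (\<lambda>g. a g + b g) = (\<lambda>g. convolution G f a g + convolution G f b g)"
proof
  fix g show "convolution G f (\<lambda>g. a g + b g) g = convolution G f a g + convolution G f b g"
    by (cases "g \<in> \<A>") (simp_all add: convolution_sum_supp[OF assms] sum.distrib distrib_left)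
qed

lemma convolution_add_left:
  assumes "fibre_finite a" "fibre_finite b"
  shows "convolution G (\<lambda>g. a g + b g) f = (\<lambda>g. convolution G a f g + convolution G b f g)"
proof
  fix g show "convolution G (\<lambda>g. a g + b g) f g = convolution G a f g + convolution G b f g"
  proof (cases "g \<in> \<A>")
    case True
    let ?S = "{k \<in> \<A>. \<r> k = \<r> g \<and> a k \<noteq> 0} \<union> {k \<in> \<A>. \<r> k = \<r> g \<and> b k \<noteq> 0}"
    have fin: "finite ?S" using assms by (simp add: fibre_finite_def)
    have "convolution G c f g = (\<Sum>k\<in>?S. c k * f (\<iota> k \<cdot> g))"
      if "\<And>k. a k = 0 \<Longrightarrow> b k = 0 \<Longrightarrow> c k = 0" for c
      by (rule convolution_sum[OF True fin]) (use that in auto)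
    then show ?thesis by (simp add: sum.distrib distrib_right)
  qed simp
qed

lemma convolution_scale_right: "convolution G f (\<lambda>g. c * a g) = (\<lambda>g. c * convolution G f a g)"
proof
  fix g show "convolution G f (\<lambda>g. c * a g) g = c * convolution G f a g"
    by (cases "c = 0") (simp_all add: convolution_def infsum_cmult_right' mult.left_commute)
qed

lemma convolution_scale_left: "convolution G (\<lambda>g. c * a g) f = (\<lambda>g. c * convolution G a f g)"
proof
  fix g show "convolution G (\<lambda>g. c * a g) f g = c * convolution G a f g"
    by (cases "c = 0") (simp_all add: convolution_def infsum_cmult_right' mult.assoc)
qed

lemma involution_convolution:
  assumes "fibre_finite f'"
  shows "involution G (convolution G f f') = convolution G (involution G f') (involution G f)"
proof
  fix g show "involution G (convolution G f f') g = convolution G (involution G f') (involution G f) g"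
  proof (cases "g \<in> \<A>")
    case True
    let ?I = "{k \<in> \<A>. \<r> k = \<s> g}" and ?J = "{l \<in> \<A>. \<r> l = \<r> g}"
    \<comment> \<open>The two sums run over different range fibres, at the range and at the source
      of \<open>g\<close>; left translation by the inverse of \<open>g\<close> matches them.\<close>
    have bij: "bij_betw (\<lambda>l. \<iota> g \<cdot> l) ?J ?I"
      by (rule bij_betw_byWitness[where f' = "\<lambda>k. g \<cdot> k"])
        (use True in \<open>auto simp: inv_comp_cancel[of g, simplified]\<close>)
    have "convolution G (involution G f') (involution G f) g
        = (\<Sum>\<^sub>\<infinity>l\<in>?J. cnj (f' (\<iota> l)) * cnj (f (\<iota> g \<cdot> l)))"
      unfolding convolution_def using True
      by (simp only: if_True, intro infsum_cong) (auto simp: involution_def)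
    also have "\<dots> = (\<Sum>\<^sub>\<infinity>l\<in>?J. cnj (f (\<iota> g \<cdot> l) * f' (\<iota> (\<iota> g \<cdot> l) \<cdot> \<iota> g)))"
    proof (rule infsum_cong)
      fix l assume l: "l \<in> ?J"
      have "\<iota> (\<iota> g \<cdot> l) \<cdot> \<iota> g = (\<iota> l \<cdot> g) \<cdot> \<iota> g" using l True by simp
      also have "\<dots> = \<iota> l \<cdot> (g \<cdot> \<iota> g)" using l True by (intro comp_assoc) auto
      also have "\<dots> = \<iota> l" using l True comp_src_right[of "\<iota> l"] by simp
      finally show "cnj (f' (\<iota> l)) * cnj (f (\<iota> g \<cdot> l))
          = cnj (f (\<iota> g \<cdot> l) * f' (\<iota> (\<iota> g \<cdot> l) \<cdot> \<iota> g))" by simp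
    qed
    also have "\<dots> = (\<Sum>\<^sub>\<infinity>k\<in>?I. cnj (f k * f' (\<iota> k \<cdot> \<iota> g)))"
      by (rule infsum_reindex_bij_betw[OF bij, of "\<lambda>k. cnj (f k * f' (\<iota> k \<cdot> \<iota> g))"])
    also have "\<dots> = cnj (\<Sum>\<^sub>\<infinity>k\<in>?I. f k * f' (\<iota> k \<cdot> \<iota> g))" by (rule infsum_cnj)
    also have "\<dots> = involution G (convolution G f f') g"
      using True by (simp add: convolution_def involution_def)
    finally show ?thesis by simp
  qed (simp add: involution_def)
qed

lemma convolution_assoc:
  assumes a: "fibre_finite a" and b: "fibre_finite b"
  shows "convolution G (convolution G a b) c = convolution G a (convolution G b c)"
proof
  fix g show "convolution G (convolution G a b) c g = convolution G a (convolution G b c) g"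
  proof (cases "g \<in> \<A>")
    case g: True
    define L where "L = {l \<in> \<A>. \<r> l = \<r> g \<and> a l \<noteq> 0}"
    define M where "M l = {m \<in> \<A>. \<r> m = \<s> l \<and> b m \<noteq> 0}" for l
    \<comment> \<open>The products \<open>l m\<close> of support arrows of \<open>a\<close> and
      \<open>b\<close> with the range of \<open>g\<close>: a finite set that carries the convolution
      of \<open>a\<close> and \<open>b\<close> on this fibre. It serves all \<open>l\<close> at
      once, so the two sums can be exchanged.\<close>
    define P where "P = (\<Union>l\<in>L. (\<lambda>m. l \<cdot> m) ` M l)"
    have fin: "finite L" "\<And>l. finite (M l)" "finite P"
      using a b by (auto simp: L_def M_def P_def fibre_finite_def)
    have PA: "k \<in> \<A> \<and> \<r> k = \<r> g" if "k \<in> P" for k using that by (auto simp: P_def L_def M_def)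
    have inner: "(\<Sum>k\<in>P. b (\<iota> l \<cdot> k) * c (\<iota> k \<cdot> g)) = convolution G b c (\<iota> l \<cdot> g)" if l: "l \<in> L" for l
    proof -
      have lA: "l \<in> \<A>" "\<r> l = \<r> g" using l by (auto simp: L_def)
      have inj: "inj_on (\<lambda>m. l \<cdot> m) (M l)"
        by (rule inj_on_inverseI[of _ "\<lambda>k. \<iota> l \<cdot> k"]) (use lA in \<open>auto simp: M_def\<close>)
      have "(\<Sum>k\<in>P. b (\<iota> l \<cdot> k) * c (\<iota> k \<cdot> g))
          = (\<Sum>k\<in>(\<lambda>m. l \<cdot> m) ` M l. b (\<iota> l \<cdot> k) * c (\<iota> k \<cdot> g))"
      proof (rule sum.mono_neutral_right[OF fin(3)])
        show "(\<lambda>m. l \<cdot> m) ` M l \<subseteq> P" using l by (auto simp: P_def)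
        show "\<forall>k\<in>P - (\<lambda>m. l \<cdot> m) ` M l. b (\<iota> l \<cdot> k) * c (\<iota> k \<cdot> g) = 0"
        proof
          fix k assume k: "k \<in> P - (\<lambda>m. l \<cdot> m) ` M l"
          have kA: "k \<in> \<A>" "\<r> k = \<r> g" using k PA by auto
          have "b (\<iota> l \<cdot> k) = 0"
          proof (rule ccontr)
            assume "b (\<iota> l \<cdot> k) \<noteq> 0"
            then have "\<iota> l \<cdot> k \<in> M l" using lA kA by (simp add: M_def)
            moreover have "k = l \<cdot> (\<iota> l \<cdot> k)" using lA kA by simp
            ultimately show False using k by blast
          qed
          then show "b (\<iota> l \<cdot> k) * c (\<iota> k \<cdot> g) = 0" by simp
        qed
      qed
      also have "\<dots> = (\<Sum>m\<in>M l. b m * c (\<iota> m \<cdot> (\<iota> l \<cdot> g)))"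
        unfolding sum.reindex[OF inj]
      proof (rule sum.cong)
        fix m assume "m \<in> M l"
        then have m: "m \<in> \<A>" "\<r> m = \<s> l" by (auto simp: M_def)
        have "(\<iota> m \<cdot> \<iota> l) \<cdot> g = \<iota> m \<cdot> (\<iota> l \<cdot> g)" using lA m g by (intro comp_assoc) auto
        then show "((\<lambda>k. b (\<iota> l \<cdot> k) * c (\<iota> k \<cdot> g)) \<circ> (\<lambda>m. l \<cdot> m)) m = b m * c (\<iota> m \<cdot> (\<iota> l \<cdot> g))"
          using lA m g by simp
      qed simp
      also have "\<dots> = convolution G b c (\<iota> l \<cdot> g)"
        using lA g by (simp add: convolution_sum_supp[OF b] M_def)
      finally show ?thesis .
    qed
    have ab: "convolution G a b k = (\<Sum>l\<in>L. a l * b (\<iota> l \<cdot> k))" if "k \<in> P" for k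
      using PA[OF that] by (simp add: convolution_sum_supp[OF a] L_def)
    have "convolution G (convolution G a b) c g = (\<Sum>k\<in>P. convolution G a b k * c (\<iota> k \<cdot> g))"
    proof (rule convolution_sum[OF g fin(3)])
      show "P \<subseteq> {k \<in> \<A>. \<r> k = \<r> g}" using PA by auto
      fix k assume k: "k \<in> \<A>" "\<r> k = \<r> g" "k \<notin> P"
      have "convolution G a b k = 0"
      proof (rule ccontr)
        assume "convolution G a b k \<noteq> 0"
        then obtain l m where "l \<in> \<A>" "m \<in> \<A>" "\<s> l = \<r> m" "k = l \<cdot> m" "a l \<noteq> 0" "b m \<noteq> 0"
          by (rule convolution_nonzero)
        then have "k \<in> P" using k by (auto simp: P_def L_def M_def)
        then show False using k by simp
      qed
      then show "convolution G a b k = 0 \<or> c (\<iota> k \<cdot> g) = 0" by simp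
    qed
    also have "\<dots> = (\<Sum>k\<in>P. \<Sum>l\<in>L. a l * (b (\<iota> l \<cdot> k) * c (\<iota> k \<cdot> g)))"
      by (intro sum.cong) (simp_all add: ab sum_distrib_right mult.assoc)
    also have "\<dots> = (\<Sum>l\<in>L. a l * (\<Sum>k\<in>P. b (\<iota> l \<cdot> k) * c (\<iota> k \<cdot> g)))"
      by (subst sum.swap) (simp add: sum_distrib_left)
    also have "\<dots> = (\<Sum>l\<in>L. a l * convolution G b c (\<iota> l \<cdot> g))"
      by (intro sum.cong) (simp_all add: inner)
    also have "\<dots> = convolution G a (convolution G b c) g"
      using g by (simp add: convolution_sum_supp[OF a] L_def)
    finally show ?thesis .
  qed simp
qed

text \<open>The only unit in the range fibre of \<open>g\<close> is its range, so one term
  survives.\<close>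

lemma convolution_unit_left:
  assumes "\<And>g. g \<notin> units G \<Longrightarrow> u g = 0" "g \<in> \<A>"
  shows "convolution G u f g = u (\<r> g) * f g"
proof -
  have "convolution G u f g = (\<Sum>k\<in>{\<r> g}. u k * f (\<iota> k \<cdot> g))"
  proof (rule convolution_sum)
    fix k assume k: "k \<in> \<A>" "\<r> k = \<r> g" "k \<notin> {\<r> g}"
    then have "k \<notin> units G" by auto
    then show "u k = 0 \<or> f (\<iota> k \<cdot> g) = 0" using assms by simp
  qed (use assms in auto)
  then show ?thesis using assms by simp
qed

text \<open>Here \<open>k^-1 g\<close> is a unit only for \<open>k = g\<close>.\<close>

lemma convolution_unit_right:
  assumes "\<And>g. g \<notin> units G \<Longrightarrow> u g = 0" "g \<in> \<A>"
  shows "convolution G f u g = f g * u (\<s> g)"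
proof -
  have "convolution G f u g = (\<Sum>k\<in>{g}. f k * u (\<iota> k \<cdot> g))"
  proof (rule convolution_sum)
    fix k assume k: "k \<in> \<A>" "\<r> k = \<r> g" "k \<notin> {g}"
    then have "\<iota> k \<cdot> g \<notin> units G" using inv_comp_unit_iff assms by auto
    then show "f k = 0 \<or> u (\<iota> k \<cdot> g) = 0" using assms by simp
  qed (use assms in auto)
  then show ?thesis using assms by simp
qed

lemma involution_involution:
  "(\<And>g. g \<notin> \<A> \<Longrightarrow> f g = 0) \<Longrightarrow> involution G (involution G f) = f"
  by (auto simp: involution_def fun_eq_iff)

text \<open>Substituting \<open>m = k^-1\<close> turns the value at a unit into the inner product of
  \<open>l^2\<close> of the source fibre; this is the state behind the regular representation at
  \<open>x\<close>.\<close>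

lemma convolution_inner:
  assumes b: "fibre_finite b" and x: "x \<in> units G"
  shows "convolution G (involution G b) c x = (\<Sum>m\<in>{m \<in> \<A>. \<s> m = x \<and> b m \<noteq> 0}. cnj (b m) * c m)"
proof -
  let ?F = "{m \<in> \<A>. \<s> m = x \<and> b m \<noteq> 0}"
  have inj: "inj_on \<iota> ?F" by (rule inj_on_inverseI[of _ "\<iota>"]) auto
  have "convolution G (involution G b) c x = (\<Sum>k\<in>\<iota> ` ?F. involution G b k * c (\<iota> k \<cdot> x))"
  proof (rule convolution_sum)
    show "finite (\<iota> ` ?F)" using b by (simp add: fibre_finite_def)
    fix k assume k: "k \<in> \<A>" "\<r> k = \<r> x" "k \<notin> \<iota> ` ?F"
    have "b (\<iota> k) = 0"
    proof (rule ccontr)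
      assume "b (\<iota> k) \<noteq> 0"
      then have "\<iota> k \<in> ?F" using k x by simp
      then have "k \<in> \<iota> ` ?F" using k by (intro image_eqI[of _ _ "\<iota> k"]) auto
      then show False using k by simp
    qed
    then show "involution G b k = 0 \<or> c (\<iota> k \<cdot> x) = 0" using k by (simp add: involution_def)
  qed (use x in auto)
  also have "\<dots> = (\<Sum>m\<in>?F. cnj (b m) * c m)"
    unfolding sum.reindex[OF inj] using x comp_src_right by (intro sum.cong) (auto simp: involution_def)
  finally show ?thesis .
qed

lemma inner_self:
  assumes b: "fibre_finite b" and x: "x \<in> units G"
  shows "convolution G (involution G b) b x
    = complex_of_real (\<Sum>m\<in>{m \<in> \<A>. \<s> m = x \<and> b m \<noteq> 0}. (cmod (b m))\<^sup>2)"
  unfolding convolution_inner[OF assms] of_real_sum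
  by (intro sum.cong) (simp_all only: complex_norm_square mult.commute)

text \<open>In a contributing product \<open>k m\<close>, the arrows \<open>k^-1\<close> and
  \<open>m\<close> both lie in \<open>U\<close> and have the same range, so they agree and
  \<open>k m\<close> is a unit.\<close>

lemma bisection_star_mult_units:
  assumes f: "\<And>g. f g \<noteq> 0 \<Longrightarrow> g \<in> U" and U: "inj_on \<r> U" and g: "g \<notin> units G"
  shows "convolution G (involution G f) f g = 0"
proof (rule ccontr)
  assume "convolution G (involution G f) f g \<noteq> 0"
  then obtain k m where km: "k \<in> \<A>" "m \<in> \<A>" "\<s> k = \<r> m" "g = k \<cdot> m" "involution G f k \<noteq> 0" "f m \<noteq> 0"
    by (rule convolution_nonzero)
  have fk: "f (\<iota> k) \<noteq> 0" using km by (simp add: involution_def)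
  have "\<iota> k = m" by (rule inj_onD[OF U]) (use km(1-3) f[OF fk] f[OF km(6)] in auto)
  then have "g = \<s> m" using km by (metis comp_inv_left inv_inv)
  then show False using g km by simp
qed

end

section \<open>Topological preliminaries\<close>

lemma local_homeomorphism_open_image:
  assumes f: "local_homeomorphism X Y f" and U: "openin X U"
  shows "openin Y (f ` U)"
proof (subst openin_subopen, clarify)
  fix x assume x: "x \<in> U"
  then have "x \<in> topspace X" using openin_subset[OF U] by blast
  then obtain V where V: "openin X V" "x \<in> V" "openin Y (f ` V)"
      "homeomorphic_map (subtopology X V) (subtopology Y (f ` V)) f"
    using f unfolding local_homeomorphism_def by blast
  have "openin (subtopology X V) (U \<inter> V)" using U by (simp add: openin_subtopology_Int)
  then have "openin (subtopology Y (f ` V)) (f ` (U \<inter> V))"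
    using homeomorphic_imp_open_map[OF V(4)] by (simp add: open_map_def)
  then have "openin Y (f ` (U \<inter> V))" using V(3) openin_open_subtopology by blast
  then show "\<exists>W. openin Y W \<and> f x \<in> W \<and> W \<subseteq> f ` U" using x V(2) by blast
qed

lemma local_homeomorphism_inj_nbhd:
  assumes f: "local_homeomorphism X Y f" and W: "openin X W" "x \<in> W"
  obtains U where "openin X U" "x \<in> U" "U \<subseteq> W" "inj_on f U"
proof -
  have "x \<in> topspace X" using W openin_subset by blast
  then obtain V where V: "openin X V" "x \<in> V" 
      "homeomorphic_map (subtopology X V) (subtopology Y (f ` V)) f"
    using f unfolding local_homeomorphism_def by blast
  have "inj_on f V"
    using homeomorphic_imp_injective_map[OF V(3)] openin_subset[OF V(1)] by (simp add: Int_absorb1)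
  then show ?thesis using that[of "V \<inter> W"] V W inj_on_subset[of f V "V \<inter> W"] by blast
qed

lemma open_injective_inverse_continuous:
  assumes f: "\<And>V. openin X V \<Longrightarrow> openin Y (f ` V)" and U: "openin X U" "inj_on f U"
  shows "continuous_map (subtopology Y (f ` U)) (subtopology X U) (inv_into U f)"
proof (rule continuous_map_into_subtopology)
  have sub: "f ` U \<subseteq> topspace Y" using f[OF U(1)] openin_subset by blast
  show "continuous_map (subtopology Y (f ` U)) X (inv_into U f)"
    unfolding continuous_map_def
  proof (intro conjI allI impI)
    show "inv_into U f \<in> topspace (subtopology Y (f ` U)) \<rightarrow> topspace X"
      using openin_subset[OF U(1)] by (auto intro!: inv_into_into)
    fix V assume V: "openin X V"
    have "{y \<in> topspace (subtopology Y (f ` U)). inv_into U f y \<in> V} = f ` (U \<inter> V)"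
      using U(2) sub by (auto simp: f_inv_into_f inv_into_into)
    moreover have "openin Y (f ` (U \<inter> V))" using f U(1) V by blast
    ultimately show "openin (subtopology Y (f ` U)) {y \<in> topspace (subtopology Y (f ` U)). inv_into U f y \<in> V}"
      by (simp add: openin_subset_topspace_eq subset_openin_subtopology image_mono)
  qed
qed (auto intro!: inv_into_into)

text \<open>Preimages are glued from the open sets \<open>W\<close> and the complement of
  \<open>K\<close>. In most uses \<open>K\<close> is compact, and a Hausdorff assumption makes it
  closed.\<close>

lemma continuous_map_extend_zero:
  fixes v :: "'a \<Rightarrow> 'b::real_normed_vector"
  assumes W: "openin X W" and K: "closedin X K" "K \<subseteq> W"
    and v: "continuous_map (subtopology X W) euclidean v"
    and zero: "\<And>x. \<lbrakk>x \<in> topspace X; x \<notin> K\<rbrakk> \<Longrightarrow> v x = 0"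
  shows "continuous_map X euclidean v"
  unfolding continuous_map_def
proof (intro conjI allI impI)
  fix B :: "'b set" assume B: "openin euclidean B"
  have "openin (subtopology X W) {x \<in> topspace (subtopology X W). v x \<in> B}"
    by (rule openin_continuous_map_preimage[OF v B])
  then have 1: "openin X {x \<in> W. v x \<in> B}"
    using W openin_subset[OF W] by (simp add: openin_open_subtopology Int_absorb1)
  have 2: "openin X (topspace X - K)" using K(1) by blast
  show "openin X {x \<in> topspace X. v x \<in> B}"
  proof (cases "0 \<in> B")
    case True
    have "{x \<in> topspace X. v x \<in> B} = {x \<in> W. v x \<in> B} \<union> (topspace X - K)"
      using True zero K openin_subset[OF W] by auto
    then show ?thesis using openin_Un[OF 1 2] by simp
  next
    case False
    have "x \<in> W" if "x \<in> topspace X" "v x \<in> B" for x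
      using zero[of x] that K(2) False by (metis subsetD)
    then have "{x \<in> topspace X. v x \<in> B} = {x \<in> W. v x \<in> B}"
      using openin_subset[OF W] by blast
    then show ?thesis using 1 by simp
  qed
qed simp

lemma continuous_map_complex_mult:
  fixes f g :: "'a \<Rightarrow> complex"
  shows "\<lbrakk>continuous_map X euclidean f; continuous_map X euclidean g\<rbrakk>
    \<Longrightarrow> continuous_map X euclidean (\<lambda>x. f x * g x)"
  by (simp add: continuous_map_atin tendsto_mult)

lemma continuous_map_of_real:
  "continuous_map X euclideanreal f \<Longrightarrow> continuous_map X euclidean (\<lambda>x. complex_of_real (f x))"
  by (simp add: continuous_map_atin tendsto_of_real)

lemma continuous_map_cnj:
  "continuous_map X euclidean f \<Longrightarrow> continuous_map X euclidean (\<lambda>x. cnj (f x))"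
  by (simp add: continuous_map_atin tendsto_cnj)

lemma continuous_map_Re:
  "continuous_map X euclidean f \<Longrightarrow> continuous_map X euclideanreal (\<lambda>x. Re (f x))"
  by (simp add: continuous_map_atin tendsto_Re)

lemma closedin_equalizer:
  assumes "Hausdorff_space Y" "continuous_map X Y f" "continuous_map X Y g"
  shows "closedin X {x \<in> topspace X. f x = g x}"
proof -
  have "closedin (prod_topology Y Y) ((\<lambda>x. (x, x)) ` topspace Y)"
    using assms(1) by (simp add: Hausdorff_space_closedin_diagonal)
  from closedin_continuous_map_preimage[OF continuous_map_pairedI[OF assms(2,3)] this]
  have "closedin X {x \<in> topspace X. (f x, g x) \<in> (\<lambda>x. (x, x)) ` topspace Y}" .
  moreover have "{x \<in> topspace X. (f x, g x) \<in> (\<lambda>x. (x, x)) ` topspace Y} = {x \<in> topspace X. f x = g x}"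
    using continuous_map_image_subset_topspace[OF assms(2)] by auto
  ultimately show ?thesis by simp
qed

lemma urysohn_locally_compact:
  assumes X: "locally_compact_space X" "Hausdorff_space X"
    and K: "compactin X K" "openin X W" "K \<subseteq> W"
  obtains u L where "continuous_map X euclideanreal u" "\<And>x. x \<in> topspace X \<Longrightarrow> 0 \<le> u x \<and> u x \<le> 1"
    "\<And>x. x \<in> K \<Longrightarrow> u x = 1" "compactin X L" "L \<subseteq> W" "\<And>x. \<lbrakk>x \<in> topspace X; x \<notin> L\<rbrakk> \<Longrightarrow> u x = 0"
proof -
  have reg: "regular_space X" using X locally_compact_Hausdorff_imp_regular_space by blast
  have cr: "completely_regular_space X"
    using X reg locally_compact_regular_imp_completely_regular_space by blast
  obtain V L where VL: "openin X V" "compactin X L" "closedin X L" "K \<subseteq> V" "V \<subseteq> L"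
    using X K(1) locally_compact_space_compact_closed_compact[of X] by blast
  have clW: "closedin X (topspace X - W)" using K(2) by blast
  have "disjnt K (topspace X - W)" using K(3) by (auto simp: disjnt_def)
  then obtain A B where AB: "openin X A" "openin X B" "K \<subseteq> A" "topspace X - W \<subseteq> B" "disjnt A B"
    using regular_space_compact_closed_separation[OF reg K(1) clW] by blast
  \<comment> \<open>A compact neighbourhood of \<open>K\<close> is cut down by the open set
    \<open>B\<close> around the complement of \<open>W\<close>: it stays compact and now lies in
    \<open>W\<close>.\<close>
  let ?L = "L \<inter> (topspace X - B)"
  have L: "compactin X ?L"
    using VL(2) AB(2) by (intro compact_Int_closedin) auto
  have LW: "?L \<subseteq> W" using AB(4) openin_subset by auto
  let ?O = "V \<inter> A"
  have O: "openin X ?O" "K \<subseteq> ?O" using VL AB by auto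
  have OL: "?O \<subseteq> ?L" using VL(5) AB(5) openin_subset[OF AB(1)] by (auto simp: disjnt_def)
  have "closedin X (topspace X - ?O)" "disjnt K (topspace X - ?O)"
    using O by (auto simp: disjnt_def)
  then obtain u where u: "continuous_map X (subtopology euclidean {0..1::real}) u"
      "u ` (topspace X - ?O) \<subseteq> {0}" "u ` K \<subseteq> {1}"
    using Urysohn_completely_regular_compact_closed[OF zero_le_one cr K(1)] by blast
  show ?thesis
  proof (rule that[of u ?L])
    show "continuous_map X euclideanreal u" using u(1) continuous_map_into_fulltopology by blast
    show "0 \<le> u x \<and> u x \<le> 1" if "x \<in> topspace X" for x
      using continuous_map_image_subset_topspace[OF u(1)] that by auto
    show "u x = 0" if "x \<in> topspace X" "x \<notin> ?L" for x
    proof -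
      have "x \<in> topspace X - ?O" using that OL by blast
      then show ?thesis using u(2) by blast
    qed
  qed (use u L LW in auto)
qed

section \<open>Open bisections\<close>

definition bisection :: "'g groupoid_data \<Rightarrow> 'g set \<Rightarrow> bool" where
  "bisection G U \<longleftrightarrow> openin (arrtop G) U \<and> inj_on (rng G) U \<and> inj_on (src G) U"

text \<open>A compact \<open>K\<close> containing the support replaces the closure of the support:
  in a non-Hausdorff arrow space compact sets need not be closed, and the closure of a support may
  leave \<open>U\<close>.\<close>

definition bcc_on :: "'g groupoid_data \<Rightarrow> ('g \<Rightarrow> complex) \<Rightarrow> 'g set \<Rightarrow> 'g set \<Rightarrow> bool" where
  "bcc_on G f U K \<longleftrightarrow> bisection G U \<and> K \<subseteq> U \<and> compactin (arrtop G) K \<and>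
     continuous_map (subtopology (arrtop G) U) euclidean f \<and> (\<forall>g. g \<notin> K \<longrightarrow> f g = 0)"

definition bcc :: "'g groupoid_data \<Rightarrow> ('g \<Rightarrow> complex) set" where
  "bcc G = {f. \<exists>U K. bcc_on G f U K}"

definition cc0 :: "'g groupoid_data \<Rightarrow> ('g \<Rightarrow> complex) set" where
  "cc0 G = {u. continuous_map (unit_top G) euclidean u \<and>
     (\<exists>K. compactin (unit_top G) K \<and> (\<forall>x. x \<notin> K \<longrightarrow> u x = 0))}"

text \<open>Scalars are absent because \<open>bcc\<close> is closed under them. The inductive form
  yields the rule \<open>qcc_induct\<close>, by which statements on \<open>qcc\<close> reduce to a
  single bisection.\<close>

inductive_set bspan :: "'g groupoid_data \<Rightarrow> ('g \<Rightarrow> complex) set" for G where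
  zero: "(\<lambda>_. 0) \<in> bspan G"
| step: "\<lbrakk>b \<in> bcc G; f \<in> bspan G\<rbrakk> \<Longrightarrow> (\<lambda>g. b g + f g) \<in> bspan G"

lemma bccI:
  "\<lbrakk>bisection G U; K \<subseteq> U; compactin (arrtop G) K; continuous_map (subtopology (arrtop G) U) euclidean f;
    \<And>g. g \<notin> K \<Longrightarrow> f g = 0\<rbrakk> \<Longrightarrow> f \<in> bcc G"
  unfolding bcc_def bcc_on_def by blast

lemma bcc_onD:
  assumes "bcc_on G f U K"
  shows "bisection G U" "K \<subseteq> U" "compactin (arrtop G) K"
    "continuous_map (subtopology (arrtop G) U) euclidean f" "\<And>g. g \<notin> K \<Longrightarrow> f g = 0"
  using assms unfolding bcc_on_def by blast+

lemma bccE: assumes "f \<in> bcc G" obtains U K where "bcc_on G f U K"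
  using assms unfolding bcc_def by blast

lemma bspan_add: "\<lbrakk>f \<in> bspan G; f' \<in> bspan G\<rbrakk> \<Longrightarrow> (\<lambda>g. f g + f' g) \<in> bspan G"
  by (induction rule: bspan.induct) (auto simp: add.assoc intro: bspan.step)

lemma bcc_bspan: "b \<in> bcc G \<Longrightarrow> b \<in> bspan G"
  using bspan.step[OF _ bspan.zero] by fastforce

lemma bspan_sum: "\<lbrakk>finite I; \<And>i. i \<in> I \<Longrightarrow> f i \<in> bspan G\<rbrakk> \<Longrightarrow> (\<lambda>g. \<Sum>i\<in>I. f i g) \<in> bspan G"
  by (induction rule: finite_induct) (auto intro: bspan_add bspan.zero)

lemma bcc_scale: "b \<in> bcc G \<Longrightarrow> (\<lambda>g. c * b g) \<in> bcc G"
proof -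
  assume "b \<in> bcc G"
  then obtain U K where "bcc_on G b U K" by (rule bccE)
  note U = bcc_onD[OF this]
  show ?thesis by (rule bccI[OF U(1-3)]) (use U in \<open>auto intro!: continuous_map_complex_mult\<close>)
qed

lemma bspan_scale: "f \<in> bspan G \<Longrightarrow> (\<lambda>g. c * f g) \<in> bspan G"
  by (induction rule: bspan.induct) (auto simp: distrib_left bcc_scale intro: bspan.step bspan.zero)

context etale_lc_groupoid
begin

section \<open>Elementary topology of the arrow space\<close>

abbreviation T where "T \<equiv> arrtop G"
abbreviation X0 where "X0 \<equiv> unit_top G"

lemma topspace_T [simp]: "topspace T = \<A>"
  by (simp add: arrows_def)

lemma topspace_X0 [simp]: "topspace X0 = units G"
  using units_subset by (auto simp: unit_top_def)

lemma src_open: "openin T U \<Longrightarrow> openin X0 (\<s> ` U)"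
  using etale_src local_homeomorphism_open_image by blast

lemma rng_open: "openin T U \<Longrightarrow> openin X0 (\<r> ` U)"
  using etale_rng local_homeomorphism_open_image by blast

lemma openin_T_arrows: "openin T U \<Longrightarrow> U \<subseteq> \<A>"
  using openin_subset by fastforce

lemma src_cont: "continuous_map T T \<s>" and rng_cont: "continuous_map T T \<r>"
  using continuous_src continuous_rng continuous_map_into_fulltopology by (auto simp: unit_top_def)

text \<open>Near a unit the source map is injective on some \<open>U\<close>; if \<open>g\<close>
  and its source both lie in \<open>U\<close>, they agree, having the same source.\<close>

lemma units_open: "openin T (units G)"
proof (subst openin_subopen, clarify)
  fix x assume x: "x \<in> units G"
  have "x \<in> topspace T" using x by simp
  then obtain U where U: "openin T U" "x \<in> U" "inj_on \<s> U"
    using local_homeomorphism_inj_nbhd[OF etale_src openin_topspace] by blast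
  let ?V = "{g \<in> U. \<s> g \<in> U}"
  have "openin T ?V" by (rule openin_continuous_map_preimage_gen[OF src_cont U(1,1)])
  moreover have "?V \<subseteq> units G"
  proof
    fix g assume g: "g \<in> ?V"
    then have gA: "g \<in> \<A>" using openin_T_arrows[OF U(1)] by blast
    have "\<s> g = g" using g gA by (auto intro: inj_onD[OF U(3)])
    then show "g \<in> units G" using gA units_iff_src by blast
  qed
  ultimately show "\<exists>V. openin T V \<and> x \<in> V \<and> V \<subseteq> units G"
    using x U(2) by (intro exI[of _ ?V]) auto
qed

lemma openin_X0: "openin X0 W \<longleftrightarrow> openin T W \<and> W \<subseteq> units G"
  unfolding unit_top_def using units_open openin_open_subtopology by blast

lemma bisectionD:
  assumes "bisection G U"
  shows "openin T U" "inj_on \<r> U" "inj_on \<s> U" "U \<subseteq> \<A>"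
  using assms openin_T_arrows by (auto simp: bisection_def)

lemma bisection_units: "bisection G (units G)"
  unfolding bisection_def using units_open by (auto intro!: inj_onI)

lemma bisection_nbhd:
  assumes "openin T W" "g \<in> W"
  obtains U where "bisection G U" "g \<in> U" "U \<subseteq> W"
proof -
  obtain U where U: "openin T U" "g \<in> U" "U \<subseteq> W" "inj_on \<s> U"
    using local_homeomorphism_inj_nbhd[OF etale_src assms] .
  obtain V where V: "openin T V" "g \<in> V" "V \<subseteq> U" "inj_on \<r> V"
    using local_homeomorphism_inj_nbhd[OF etale_rng U(1,2)] .
  have "bisection G V" using U V inj_on_subset by (auto simp: bisection_def)
  then show ?thesis using that U V by blast
qed

lemma src_section_cont:
  "bisection G U \<Longrightarrow> continuous_map (subtopology X0 (\<s> ` U)) (subtopology T U) (inv_into U \<s>)"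
  by (rule open_injective_inverse_continuous) (auto simp: bisectionD src_open)

lemma rng_section_cont:
  "bisection G U \<Longrightarrow> continuous_map (subtopology X0 (\<r> ` U)) (subtopology T U) (inv_into U \<r>)"
  by (rule open_injective_inverse_continuous) (auto simp: bisectionD rng_open)

lemma bisection_Hausdorff:
  assumes "bisection G U" shows "Hausdorff_space (subtopology T U)"
proof (rule Hausdorff_space_injective_preimage[OF Hausdorff_units])
  show "continuous_map (subtopology T U) X0 \<s>" by (rule continuous_map_from_subtopology[OF continuous_src])
  show "inj_on \<s> (topspace (subtopology T U))"
    using bisectionD[OF assms] by (auto intro: inj_on_subset)
qed

lemma compact_closed_in_Hausdorff:
  "\<lbrakk>Hausdorff_space (subtopology T U); compactin T K; K \<subseteq> U\<rbrakk> \<Longrightarrow> closedin (subtopology T U) K"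
  by (intro compactin_imp_closedin) (auto simp: compactin_subtopology)

lemma compact_X0: "compactin X0 K \<longleftrightarrow> compactin T K \<and> K \<subseteq> units G"
  by (simp add: unit_top_def compactin_subtopology)

lemma compact_X0_closed: "compactin X0 K \<Longrightarrow> closedin X0 K"
  using Hausdorff_units compactin_imp_closedin by blast

section \<open>Bump functions and reduction to bisections\<close>

lemma cc0_bcc: "u \<in> cc0 G \<Longrightarrow> u \<in> bcc G"
  unfolding cc0_def using bccI[OF bisection_units, of _ u] by (auto simp: compact_X0 simp flip: unit_top_def)

lemma cc0_zero: "\<lbrakk>u \<in> cc0 G; g \<notin> units G\<rbrakk> \<Longrightarrow> u g = 0"
  unfolding cc0_def using compactin_subset_topspace by fastforce

lemma cc0_bump:
  assumes K: "compactin X0 K" "openin X0 W" "K \<subseteq> W"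
  obtains u where "u \<in> cc0 G" "\<And>x. x \<in> K \<Longrightarrow> u x = 1" "\<And>x. x \<notin> W \<Longrightarrow> u x = 0"
proof -
  obtain v L where v: "continuous_map X0 euclideanreal v"
    "\<And>x. x \<in> topspace X0 \<Longrightarrow> 0 \<le> v x \<and> v x \<le> 1" "\<And>x. x \<in> K \<Longrightarrow> v x = 1"
    "compactin X0 L" "L \<subseteq> W" "\<And>x. \<lbrakk>x \<in> topspace X0; x \<notin> L\<rbrakk> \<Longrightarrow> v x = 0"
    using urysohn_locally_compact[OF locally_compact_units Hausdorff_units K] by blast
  let ?u = "\<lambda>x. complex_of_real (if x \<in> units G then v x else 0)"
  have "continuous_map X0 euclidean ?u"
    by (rule continuous_map_eq[OF continuous_map_of_real[OF v(1)]]) auto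
  then have "?u \<in> cc0 G" unfolding cc0_def using v by auto
  moreover have "?u x = 1" if "x \<in> K" for x
    using v(3)[OF that] compactin_subset_topspace[OF K(1)] that by auto
  moreover have "?u x = 0" if "x \<notin> W" for x using v(5,6) that by auto
  ultimately show ?thesis using that by blast
qed

text \<open>The source map identifies a bisection with an open set of objects, so a bump function on
  objects is transported to arrows.\<close>

lemma bisection_bump:
  assumes W: "openin T W" "g \<in> W"
  obtains U K h where "bisection G U" "g \<in> U" "U \<subseteq> W" "compactin T K" "K \<subseteq> U"
    "continuous_map (subtopology T U) euclideanreal h" "\<And>k. 0 \<le> h k" "h g = 1" "\<And>k. k \<notin> K \<Longrightarrow> h k = 0"
proof -
  obtain U where U: "bisection G U" "g \<in> U" "U \<subseteq> W" using bisection_nbhd[OF W] .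
  note UD = bisectionD[OF U(1)]
  have "compactin X0 {\<s> g}" using UD(4) U(2) by auto
  moreover have "openin X0 (\<s> ` U)" using UD src_open by blast
  moreover have "{\<s> g} \<subseteq> \<s> ` U" using U by blast
  ultimately obtain v L where v: "continuous_map X0 euclideanreal v"
      "\<And>x. x \<in> topspace X0 \<Longrightarrow> 0 \<le> v x \<and> v x \<le> 1" "\<And>x. x \<in> {\<s> g} \<Longrightarrow> v x = 1"
      "compactin X0 L" "L \<subseteq> \<s> ` U" "\<And>x. \<lbrakk>x \<in> topspace X0; x \<notin> L\<rbrakk> \<Longrightarrow> v x = 0"
    using urysohn_locally_compact[OF locally_compact_units Hausdorff_units] by blast
  define h where "h k = (if k \<in> U then v (\<s> k) else 0)" for k
  define K where "K = inv_into U \<s> ` L"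
  have "compactin (subtopology T U) K"
    unfolding K_def
    by (rule image_compactin[OF _ src_section_cont[OF U(1)]]) (use v in \<open>simp add: compactin_subtopology\<close>)
  then have K: "compactin T K" "K \<subseteq> U" by (auto simp: compactin_subtopology)
  have "continuous_map (subtopology T U) euclideanreal (v \<circ> \<s>)"
    using continuous_map_compose[OF continuous_map_from_subtopology[OF continuous_src] v(1)] .
  then have "continuous_map (subtopology T U) euclideanreal h"
    by (rule continuous_map_eq) (auto simp: h_def)
  moreover have "0 \<le> h k" for k using v(2) UD(4) by (auto simp: h_def)
  moreover have "h g = 1" using v(3) U by (simp add: h_def)
  moreover have "h k = 0" if "k \<notin> K" for k
  proof (cases "k \<in> U")
    case True
    have "\<s> k \<notin> L"
    proof
      assume "\<s> k \<in> L"
      then have "inv_into U \<s> (\<s> k) \<in> K" by (simp add: K_def)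
      then show False using that True UD(3) by simp
    qed
    then show ?thesis using v(6) True UD(4) by (auto simp: h_def)
  qed (simp add: h_def)
  ultimately show ?thesis using that U K by blast
qed

text \<open>A partition of unity inside the open Hausdorff set \<open>U\<close>, where compact sets
  are closed and extension by zero is continuous.\<close>

lemma local_cc_bspan:
  assumes "f \<in> local_cc G" shows "f \<in> bspan G"
proof -
  obtain U where U: "openin T U" "Hausdorff_space (subtopology T U)"
      "continuous_map (subtopology T U) euclidean f"
      "compactin (subtopology T U) ((subtopology T U) closure_of {g \<in> U. f g \<noteq> 0})"
      "\<And>g. g \<notin> U \<Longrightarrow> f g = 0"
    using assms unfolding local_cc_def by blast
  define K where "K = (subtopology T U) closure_of {g \<in> U. f g \<noteq> 0}"
  have UA: "U \<subseteq> \<A>" using U(1) openin_T_arrows by blast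
  have K: "compactin T K" "K \<subseteq> U" using U(4) by (auto simp: K_def compactin_subtopology)
  have Kcl: "closedin (subtopology T U) K" by (simp add: K_def)
  have f0: "f g = 0" if "g \<notin> K" for g
  proof (rule ccontr)
    assume "f g \<noteq> 0"
    then have "g \<in> {g \<in> U. f g \<noteq> 0}" using U(5) by blast
    moreover have "{g \<in> U. f g \<noteq> 0} \<subseteq> K" unfolding K_def
      by (rule closure_of_subset) (use UA in auto)
    ultimately show False using that by blast
  qed
  define Q where "Q g V L h \<longleftrightarrow> bisection G V \<and> g \<in> V \<and> V \<subseteq> U \<and> compactin T L \<and> L \<subseteq> V \<and>
      continuous_map (subtopology T V) euclideanreal h \<and> (\<forall>k. 0 \<le> h k) \<and> h g = 1 \<and>
      (\<forall>k. k \<notin> L \<longrightarrow> h k = 0)" for g V L and h :: "'g \<Rightarrow> real"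
  have "\<exists>V L h. Q g V L h" if "g \<in> K" for g
  proof -
    have "g \<in> U" using that K(2) by blast
    then obtain V L h where *: "bisection G V" "g \<in> V" "V \<subseteq> U" "compactin T L" "L \<subseteq> V"
        "continuous_map (subtopology T V) euclideanreal h" "\<And>k. 0 \<le> h k" "h g = 1" "\<And>k. k \<notin> L \<Longrightarrow> h k = 0"
      using bisection_bump[OF U(1)] by blast
    have "Q g V L h" unfolding Q_def by (intro conjI allI impI *)
    then show ?thesis by blast
  qed
  then obtain V L h where "\<And>g. g \<in> K \<Longrightarrow> Q g (V g) (L g) (h g)" by metis
  note V = this[unfolded Q_def]
  have sub: "subtopology (subtopology T U) (V g) = subtopology T (V g)" if "g \<in> K" for g
    using V[OF that] by (simp add: subtopology_subtopology Int_absorb1)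
  have hU: "continuous_map (subtopology T U) euclideanreal (h g)" if g: "g \<in> K" for g
  proof (rule continuous_map_extend_zero)
    show "openin (subtopology T U) (V g)"
      using V[OF g] U(1) bisectionD(1)[of "V g"] by (simp add: openin_open_subtopology)
    show "closedin (subtopology T U) (L g)"
      using V[OF g] by (intro compact_closed_in_Hausdorff[OF U(2)]) auto
  qed (use V[OF g] sub[OF g] in auto)
  define Op where "Op g = {k \<in> U. h g k > 0}" for g
  have Op: "openin T (Op g)" if g: "g \<in> K" for g
  proof -
    have "openin (subtopology T U) {k \<in> topspace (subtopology T U). h g k \<in> {0<..}}"
      by (rule openin_continuous_map_preimage[OF hU[OF g]]) simp
    moreover have "{k \<in> topspace (subtopology T U). h g k \<in> {0<..}} = Op g"
      using UA by (auto simp: Op_def)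
    ultimately show ?thesis using U(1) by (simp add: openin_open_subtopology)
  qed
  have "\<exists>\<F>. finite \<F> \<and> \<F> \<subseteq> Op ` K \<and> K \<subseteq> \<Union>\<F>"
  proof (rule compactinD[OF K(1)])
    show "K \<subseteq> \<Union>(Op ` K)" using V K(2) by (force simp: Op_def)
  qed (use Op in blast)
  then obtain J where J: "finite J" "J \<subseteq> K" "K \<subseteq> (\<Union>g\<in>J. Op g)"
    by (metis finite_subset_image)
  define S where "S k = (\<Sum>g\<in>J. h g k)" for k
  have Scont: "continuous_map (subtopology T U) euclideanreal S"
    unfolding S_def by (intro continuous_map_sum J hU) (use J in blast)
  have Spos: "0 < S k" if k: "k \<in> K" for k
  proof -
    obtain g where g: "g \<in> J" "k \<in> Op g" using J(3) k by blast
    have "h g k \<le> S k" unfolding S_def using J V g by (intro member_le_sum) auto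
    then show ?thesis using g(2) by (simp add: Op_def)
  qed
  define P where "P = {k \<in> U. S k > 0}"
  have P: "openin (subtopology T U) P"
  proof -
    have "openin (subtopology T U) {k \<in> topspace (subtopology T U). S k \<in> {0<..}}"
      by (rule openin_continuous_map_preimage[OF Scont]) simp
    moreover have "{k \<in> topspace (subtopology T U). S k \<in> {0<..}} = P" using UA by (auto simp: P_def)
    ultimately show ?thesis by simp
  qed
  \<comment> \<open>Outside \<open>K\<close> the quotient may divide by zero, but there
    \<open>f\<close> vanishes; on \<open>K\<close> the sum \<open>S\<close> is positive.\<close>
  define F where "F g k = f k * complex_of_real (h g k / S k)" for g k
  have FU: "continuous_map (subtopology T U) euclidean (F g)" if g: "g \<in> K" for g
  proof (rule continuous_map_extend_zero[OF P Kcl])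
    show "K \<subseteq> P" using K Spos by (auto simp: P_def)
    show "continuous_map (subtopology (subtopology T U) P) euclidean (F g)"
      unfolding F_def
      by (intro continuous_map_complex_mult continuous_map_of_real continuous_map_real_divide
          continuous_map_from_subtopology[OF U(3)] continuous_map_from_subtopology[OF hU[OF g]]
          continuous_map_from_subtopology[OF Scont]) (auto simp: P_def)
  qed (simp add: F_def f0)
  have "F g \<in> bcc G" if g: "g \<in> K" for g
  proof (rule bccI[of G "V g" "L g"])
    show "continuous_map (subtopology T (V g)) euclidean (F g)"
      using continuous_map_from_subtopology[OF FU[OF g], of "V g"] sub[OF g] by simp
  qed (use V[OF g] in \<open>auto simp: F_def\<close>)
  then have "(\<lambda>k. \<Sum>g\<in>J. F g k) \<in> bspan G" using J by (intro bspan_sum bcc_bspan) auto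
  moreover have "(\<Sum>g\<in>J. F g k) = f k" for k
  proof (cases "k \<in> K")
    case True
    have "(\<Sum>g\<in>J. F g k) = f k * complex_of_real ((\<Sum>g\<in>J. h g k) / S k)"
      by (simp add: F_def sum_distrib_left sum_divide_distrib)
    also have "\<dots> = f k" using Spos[OF True] by (simp add: S_def[symmetric])
    finally show ?thesis .
  qed (simp add: F_def f0)
  ultimately show ?thesis by simp
qed

lemma bcc_local_cc: assumes "b \<in> bcc G" shows "b \<in> local_cc G"
proof -
  obtain U K where "bcc_on G b U K" using assms by (rule bccE)
  note U = bcc_onD[OF this]
  have cl: "closedin (subtopology T U) K"
    using U by (intro compact_closed_in_Hausdorff bisection_Hausdorff)
  have "(subtopology T U) closure_of {g \<in> U. b g \<noteq> 0} \<subseteq> K"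
    by (rule closure_of_minimal[OF _ cl]) (use U(5) in auto)
  then have "compactin (subtopology T U) ((subtopology T U) closure_of {g \<in> U. b g \<noteq> 0})"
    by (rule closed_compactin[of _ K, rotated]) (use U(2,3) in \<open>auto simp: compactin_subtopology\<close>)
  then show ?thesis
    unfolding local_cc_def using U bisectionD(1)[OF U(1)] bisection_Hausdorff[OF U(1)] by blast
qed

lemma qcc_eq_bspan: "qcc G = bspan G"
proof (intro equalityI subsetI)
  fix f assume "f \<in> qcc G"
  then obtain n c F where "\<And>i. i < n \<Longrightarrow> F i \<in> local_cc G" "f = (\<lambda>g. \<Sum>i<(n::nat). c i * F i g)"
    unfolding qcc_def by blast
  then show "f \<in> bspan G" using local_cc_bspan by (auto intro!: bspan_sum bspan_scale)
next
  fix f assume "f \<in> bspan G"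
  then show "f \<in> qcc G"
  proof induction
    case zero
    show ?case unfolding qcc_def by (auto intro!: exI[of _ 0])
  next
    case (step b f)
    then obtain n c F where F: "\<And>i. i < n \<Longrightarrow> F i \<in> local_cc G" "f = (\<lambda>g. \<Sum>i<(n::nat). c i * F i g)"
      unfolding qcc_def by blast
    have "\<forall>i<Suc n. (F(n := b)) i \<in> local_cc G" using F(1) bcc_local_cc[OF step(1)] by (simp add: less_Suc_eq)
    moreover have "(\<lambda>g. b g + f g) = (\<lambda>g. \<Sum>i<Suc n. (c(n := 1)) i * (F(n := b)) i g)"
      unfolding F(2) by (simp add: add.commute)
    ultimately show ?case unfolding qcc_def by blast
  qed
qed

lemma qcc_induct [consumes 1, case_names zero step]:
  assumes "f \<in> qcc G" "P (\<lambda>_. 0)"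
    "\<And>b f. \<lbrakk>b \<in> bcc G; f \<in> qcc G; P f\<rbrakk> \<Longrightarrow> P (\<lambda>g. b g + f g)"
  shows "P f"
  using assms(1) unfolding qcc_eq_bspan
  by (induction rule: bspan.induct) (use assms(2,3) qcc_eq_bspan in auto)

lemma qcc_zero [simp]: "(\<lambda>_. 0) \<in> qcc G"
  and qcc_add: "\<lbrakk>f \<in> qcc G; f' \<in> qcc G\<rbrakk> \<Longrightarrow> (\<lambda>g. f g + f' g) \<in> qcc G"
  and qcc_scale: "f \<in> qcc G \<Longrightarrow> (\<lambda>g. c * f g) \<in> qcc G"
  and bcc_qcc: "b \<in> bcc G \<Longrightarrow> b \<in> qcc G"
  unfolding qcc_eq_bspan by (auto intro: bspan.zero bspan_add bspan_scale bcc_bspan)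

lemma cc0_qcc: "u \<in> cc0 G \<Longrightarrow> u \<in> qcc G"
  by (intro bcc_qcc cc0_bcc)

section \<open>The convolution algebra\<close>

lemma bcc_fibre_finite: assumes "b \<in> bcc G" shows "fibre_finite b"
proof -
  obtain U K where "bcc_on G b U K" using assms by (rule bccE)
  note U = bcc_onD[OF this]
  have fin: "finite {k \<in> \<A>. f k = x \<and> b k \<noteq> 0}" if f: "inj_on f U" for f :: "'g \<Rightarrow> 'g" and x
  proof -
    have bU: "k \<in> U" if "b k \<noteq> 0" for k using U(2,5) that by blast
    have inj: "inj_on f {k \<in> \<A>. f k = x \<and> b k \<noteq> 0}" by (rule inj_on_subset[OF f]) (use bU in auto)
    have "finite (f ` {k \<in> \<A>. f k = x \<and> b k \<noteq> 0})" by (rule finite_subset[of _ "{x}"]) auto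
    then show ?thesis using inj by (rule finite_imageD)
  qed
  have "b g = 0" if "g \<notin> \<A>" for g using U(2,5) bisectionD(4)[OF U(1)] that by blast
  then show ?thesis unfolding fibre_finite_def using fin bisectionD[OF U(1)] by blast
qed

lemma qcc_fibre_finite: "f \<in> qcc G \<Longrightarrow> fibre_finite f"
proof (induction rule: qcc_induct)
  case zero
  show ?case by (simp add: fibre_finite_def)
qed (auto intro: fibre_finite_add bcc_fibre_finite)

lemma qcc_zero_off: "\<lbrakk>f \<in> qcc G; g \<notin> \<A>\<rbrakk> \<Longrightarrow> f g = 0"
  using qcc_fibre_finite fibre_finite_zero_off by blast

lemma bcc_involution: assumes "b \<in> bcc G" shows "involution G b \<in> bcc G"
proof -
  obtain U K where "bcc_on G b U K" using assms by (rule bccE)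
  note U = bcc_onD[OF this]
  note UD = bisectionD[OF U(1)]
  let ?U = "{g \<in> \<A>. \<iota> g \<in> U}"
  have op: "openin T ?U" using openin_continuous_map_preimage[OF continuous_inv UD(1)] by simp
  have "bisection G ?U" unfolding bisection_def
  proof (intro conjI op inj_onI)
    fix g h assume *: "g \<in> ?U" "h \<in> ?U"
    show "g = h" if "\<r> g = \<r> h"
    proof -
      have "\<iota> g = \<iota> h" by (rule inj_onD[OF UD(3)]) (use * that in auto)
      then show ?thesis using * inv_inv by (metis (no_types, lifting) mem_Collect_eq)
    qed
    show "g = h" if "\<s> g = \<s> h"
    proof -
      have "\<iota> g = \<iota> h" by (rule inj_onD[OF UD(2)]) (use * that in auto)
      then show ?thesis using * inv_inv by (metis (no_types, lifting) mem_Collect_eq)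
    qed
  qed
  moreover have "\<iota> ` K \<subseteq> ?U"
  proof clarify
    fix k assume "k \<in> K"
    then have "k \<in> U" "k \<in> \<A>" using U(2) UD(4) by auto
    then show "\<iota> k \<in> \<A> \<and> \<iota> (\<iota> k) \<in> U" by simp
  qed
  moreover have "compactin T (\<iota> ` K)" by (rule image_compactin[OF U(3) continuous_inv])
  moreover have "continuous_map (subtopology T ?U) euclidean (involution G b)"
  proof (rule continuous_map_eq)
    have "continuous_map (subtopology T ?U) (subtopology T U) \<iota>"
      by (intro continuous_map_into_subtopology continuous_map_from_subtopology[OF continuous_inv]) auto
    from continuous_map_cnj[OF continuous_map_compose[OF this U(4)]]
    show "continuous_map (subtopology T ?U) euclidean (\<lambda>g. cnj ((b \<circ> \<iota>) g))" .
  qed (auto simp: involution_def)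
  moreover have "involution G b g = 0" if "g \<notin> \<iota> ` K" for g
  proof (cases "g \<in> \<A>")
    case True
    have "\<iota> g \<notin> K"
    proof
      assume "\<iota> g \<in> K"
      then have "\<iota> (\<iota> g) \<in> \<iota> ` K" by (rule imageI)
      then show False using that True by simp
    qed
    then show ?thesis using U(5) by (simp add: involution_def)
  qed (simp add: involution_def)
  ultimately show ?thesis by (rule bccI)
qed

text \<open>This rests on the object space being Hausdorff, whatever the arrow space. In
  \<open>bcc_convolution\<close> it keeps the set of composable pairs in \<open>K \<times> L\<close>
  compact.\<close>

lemma composable_closed:
  "closedin (prod_topology T T) {(g, h). g \<in> \<A> \<and> h \<in> \<A> \<and> \<s> g = \<r> h}"
proof -
  have "closedin (prod_topology T T) {z \<in> topspace (prod_topology T T). (\<s> \<circ> fst) z = (\<r> \<circ> snd) z}"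
    by (intro closedin_equalizer[OF Hausdorff_units] continuous_map_compose[OF continuous_map_fst continuous_src]
        continuous_map_compose[OF continuous_map_snd continuous_rng])
  moreover have "{z \<in> topspace (prod_topology T T). (\<s> \<circ> fst) z = (\<r> \<circ> snd) z}
      = {(g, h). g \<in> \<A> \<and> h \<in> \<A> \<and> \<s> g = \<r> h}" by auto
  ultimately show ?thesis by simp
qed

lemma bcc_convolution:
  assumes "a \<in> bcc G" "b \<in> bcc G" shows "convolution G a b \<in> bcc G"
proof -
  obtain U K where "bcc_on G a U K" using assms(1) by (rule bccE)
  note U = bcc_onD[OF this]
  obtain V L where "bcc_on G b V L" using assms(2) by (rule bccE)
  note V = bcc_onD[OF this]
  note UD = bisectionD[OF U(1)] and VD = bisectionD[OF V(1)]
  define D where "D = {g \<in> \<A>. \<r> g \<in> \<r> ` U}"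
  \<comment> \<open>An arrow \<open>g\<close> whose range is the range of an arrow of
    \<open>U\<close> factors in one way only as \<open>k g\<close> in \<open>U\<close> times
    \<open>p g\<close>, so the convolution has a single term.\<close>
  define k where "k g = inv_into U \<r> (\<r> g)" for g
  define p where "p g = \<iota> (k g) \<cdot> g" for g
  have D: "openin T D" unfolding D_def
    using openin_continuous_map_preimage[OF continuous_rng rng_open[OF UD(1)]] by simp
  have kU: "k g \<in> U" "\<r> (k g) = \<r> g" if "g \<in> D" for g
    using that by (auto simp: D_def k_def inv_into_into f_inv_into_f)
  have kA: "k g \<in> \<A>" if "g \<in> D" for g using kU(1)[OF that] UD(4) by blast
  have DA: "g \<in> \<A>" if "g \<in> D" for g using that by (simp add: D_def)
  have k_eq: "k g = l" if "l \<in> U" "\<r> l = \<r> g" for l g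
    using that UD(2) by (metis k_def inv_into_f_f)
  have pA: "p g \<in> \<A>" "\<r> (p g) = \<s> (k g)" "\<s> (p g) = \<s> g" "k g \<cdot> p g = g" if "g \<in> D" for g
    using kA[OF that] DA[OF that] kU[OF that] by (auto simp: p_def)
  have kcont: "continuous_map (subtopology T D) (subtopology T U) k"
  proof -
    have "continuous_map (subtopology T D) (subtopology X0 (\<r> ` U)) \<r>"
      by (intro continuous_map_into_subtopology continuous_map_from_subtopology[OF continuous_rng])
        (auto simp: D_def)
    from continuous_map_compose[OF this rng_section_cont[OF U(1)]] show ?thesis
      by (simp add: comp_def k_def[abs_def])
  qed
  have pcont: "continuous_map (subtopology T D) T p"
  proof -
    let ?E = "{(g, h). g \<in> \<A> \<and> h \<in> \<A> \<and> \<s> g = \<r> h}"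
    have "continuous_map (subtopology T D) T (\<iota> \<circ> k)"
      using continuous_map_compose[OF continuous_map_into_fulltopology[OF kcont] continuous_inv] .
    then have "continuous_map (subtopology T D) (prod_topology T T) (\<lambda>g. ((\<iota> \<circ> k) g, id g))"
      by (rule continuous_map_pairedI) (rule continuous_map_from_subtopology[OF continuous_map_id])
    then have "continuous_map (subtopology T D) (subtopology (prod_topology T T) ?E) (\<lambda>g. ((\<iota> \<circ> k) g, id g))"
      by (rule continuous_map_into_subtopology) (use kA kU DA in auto)
    from continuous_map_compose[OF this continuous_comp] show ?thesis
      by (simp add: comp_def p_def[abs_def])
  qed
  define W where "W = {g \<in> D. p g \<in> V}"
  have W: "openin T W"
  proof -
    have "openin (subtopology T D) {g \<in> topspace (subtopology T D). p g \<in> V}"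
      by (rule openin_continuous_map_preimage[OF pcont VD(1)])
    moreover have "{g \<in> topspace (subtopology T D). p g \<in> V} = W" using DA by (auto simp: W_def)
    ultimately show ?thesis using D by (simp add: openin_open_subtopology)
  qed
  have "bisection G W" unfolding bisection_def
  proof (intro conjI W inj_onI)
    fix g h assume gh: "g \<in> W" "h \<in> W"
    have gD: "g \<in> D" "h \<in> D" "p g \<in> V" "p h \<in> V" using gh by (auto simp: W_def)
    show "g = h" if "\<r> g = \<r> h"
    proof -
      have kk: "k g = k h" using that by (simp add: k_def)
      have "p g = p h" by (rule inj_onD[OF VD(2)]) (use gD pA kk in auto)
      then show ?thesis using pA(4)[OF gD(1)] pA(4)[OF gD(2)] kk by metis
    qed
    show "g = h" if "\<s> g = \<s> h"
    proof -
      have pp: "p g = p h" by (rule inj_onD[OF VD(3)]) (use gD pA that in auto)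
      have "k g = k h"
        by (rule inj_onD[OF UD(3)]) (use gD kU(1) pA(2)[OF gD(1)] pA(2)[OF gD(2)] pp in simp_all)
      then show ?thesis using pA(4)[OF gD(1)] pA(4)[OF gD(2)] pp by metis
    qed
  qed
  moreover
  define C where "C = (K \<times> L) \<inter> {(g, h). g \<in> \<A> \<and> h \<in> \<A> \<and> \<s> g = \<r> h}"
  define M where "M = (\<lambda>(g, h). g \<cdot> h) ` C"
  have "compactin (prod_topology T T) C"
    unfolding C_def by (intro compact_Int_closedin composable_closed) (simp add: compactin_Times U V)
  then have "compactin (subtopology (prod_topology T T) {(g, h). g \<in> \<A> \<and> h \<in> \<A> \<and> \<s> g = \<r> h}) C"
    by (simp add: compactin_subtopology C_def)
  then have "compactin T M" unfolding M_def by (rule image_compactin[OF _ continuous_comp])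
  moreover have "M \<subseteq> W"
  proof
    fix g assume "g \<in> M"
    then obtain l m where lm: "l \<in> K" "m \<in> L" "l \<in> \<A>" "m \<in> \<A>" "\<s> l = \<r> m" "g = l \<cdot> m"
      by (auto simp: M_def C_def)
    have kl: "k g = l" by (rule k_eq) (use lm U(2) in auto)
    have "g \<in> D" using lm U(2) by (auto simp: D_def)
    moreover have "p g = m" using kl lm by (simp add: p_def)
    ultimately show "g \<in> W" using lm V(2) by (auto simp: W_def)
  qed
  moreover have "convolution G a b g = 0" if "g \<notin> M" for g
  proof (rule ccontr)
    assume "convolution G a b g \<noteq> 0"
    then obtain l m where lm: "l \<in> \<A>" "m \<in> \<A>" "\<s> l = \<r> m" "g = l \<cdot> m" "a l \<noteq> 0" "b m \<noteq> 0"
      by (rule convolution_nonzero)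
    then have "(l, m) \<in> C" using U(5) V(5) by (auto simp: C_def)
    then show False using that lm(4) unfolding M_def by (metis case_prod_conv image_eqI)
  qed
  moreover have "continuous_map (subtopology T W) euclidean (convolution G a b)"
  proof (rule continuous_map_eq)
    have WD: "W \<subseteq> D" by (auto simp: W_def)
    have k': "continuous_map (subtopology T W) (subtopology T U) k"
      using continuous_map_from_subtopology_mono[OF kcont WD] .
    have p': "continuous_map (subtopology T W) (subtopology T V) p"
      by (intro continuous_map_into_subtopology continuous_map_from_subtopology_mono[OF pcont WD])
        (auto simp: W_def)
    show "continuous_map (subtopology T W) euclidean (\<lambda>g. (a \<circ> k) g * (b \<circ> p) g)"
      by (intro continuous_map_complex_mult continuous_map_compose[OF k' U(4)] continuous_map_compose[OF p' V(4)])
    fix g assume "g \<in> topspace (subtopology T W)"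
    then have g: "g \<in> D" using WD by auto
    have "convolution G a b g = (\<Sum>l\<in>{k g}. a l * b (\<iota> l \<cdot> g))"
    proof (rule convolution_sum)
      fix l assume l: "l \<in> \<A>" "\<r> l = \<r> g" "l \<notin> {k g}"
      then have "l \<notin> U" using k_eq by auto
      then show "a l = 0 \<or> b (\<iota> l \<cdot> g) = 0" using U(2,5) by blast
    qed (use g DA kA kU in auto)
    then show "(a \<circ> k) g * (b \<circ> p) g = convolution G a b g" by (simp add: p_def)
  qed
  ultimately show ?thesis by (intro bccI[of G W M])
qed

lemma qcc_involution: "f \<in> qcc G \<Longrightarrow> involution G f \<in> qcc G"
proof (induction rule: qcc_induct)
  case zero
  have "involution G (\<lambda>_. 0) = (\<lambda>_. 0)" by (simp add: involution_def fun_eq_iff)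
  then show ?case by simp
next
  case (step b f)
  have "involution G (\<lambda>g. b g + f g) = (\<lambda>g. involution G b g + involution G f g)"
    by (simp add: involution_def fun_eq_iff)
  then show ?case using step qcc_add bcc_qcc bcc_involution by simp
qed

lemma qcc_convolution:
  assumes f: "f \<in> qcc G" and h: "h \<in> qcc G" shows "convolution G f h \<in> qcc G"
  using f
proof (induction rule: qcc_induct)
  case zero
  have "convolution G (\<lambda>_. 0) h = (\<lambda>_. 0)" by (simp add: convolution_def fun_eq_iff)
  then show ?case by simp
next
  case (step b f)
  have bf: "fibre_finite b" using step(1) by (rule bcc_fibre_finite)
  have "convolution G b h \<in> qcc G" using h
  proof (induction rule: qcc_induct)
    case zero
    have "convolution G b (\<lambda>_. 0) = (\<lambda>_. 0)" by (simp add: convolution_def fun_eq_iff)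
    then show ?case by simp
  next
    case (step c h)
    then show ?case using bf assms(1) \<open>b \<in> bcc G\<close>
      by (simp add: convolution_add_right qcc_add bcc_qcc bcc_convolution)
  qed
  then show ?case using step bf qcc_fibre_finite[OF step(2)] by (simp add: convolution_add_left qcc_add)
qed

section \<open>The *-algebra structure and bounds for all C*-seminorms\<close>

abbreviation Alg where "Alg \<equiv> conv_algebra G"
abbreviation NAlg where "NAlg \<equiv> normed_conv_algebra G"

lemma NAlg_simps [simp]:
  "acarrier NAlg = qcc G" "azero NAlg = (\<lambda>_. 0)" "aadd NAlg = (\<lambda>f f' g. f g + f' g)"
  "ascale NAlg = (\<lambda>c f g. c * f g)" "amult NAlg = convolution G" "astar NAlg = involution G"
  "anorm NAlg = max_cstar_norm Alg"
  by (simp_all add: normed_conv_algebra_def conv_algebra_def star_algebra.defs)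

lemma Alg_simps [simp]:
  "acarrier Alg = qcc G" "azero Alg = (\<lambda>_. 0)" "aadd Alg = (\<lambda>f f' g. f g + f' g)"
  "ascale Alg = (\<lambda>c f g. c * f g)" "amult Alg = convolution G" "astar Alg = involution G"
  by (simp_all add: conv_algebra_def)

text \<open>\<open>conv_algebra\<close> and \<open>normed_conv_algebra\<close> are different record
  types with the same operations; stated for any such record, the axioms are verified once.\<close>

lemma star_alg_like:
  assumes "acarrier A = qcc G" "azero A = (\<lambda>_. 0)" "aadd A = (\<lambda>f f' g. f g + f' g)"
    "ascale A = (\<lambda>c f g. c * f g)" "amult A = convolution G" "astar A = involution G"
  shows "star_alg A"
proof (rule star_alg.intro, unfold assms)
  show "involution G (involution G f) = f" if "f \<in> qcc G" for f
    using that by (intro involution_involution qcc_zero_off)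
  show "involution G (convolution G f h) = convolution G (involution G h) (involution G f)"
    if "f \<in> qcc G" "h \<in> qcc G" for f h using that qcc_fibre_finite involution_convolution by blast
  show "convolution G (convolution G a b) c = convolution G a (convolution G b c)"
    if "a \<in> qcc G" "b \<in> qcc G" "c \<in> qcc G" for a b c
    using that qcc_fibre_finite convolution_assoc by blast
qed (auto simp: qcc_add qcc_scale qcc_convolution qcc_involution convolution_add_left convolution_add_right
    convolution_scale_left convolution_scale_right qcc_fibre_finite involution_def algebra_simps fun_eq_iff)

lemma Alg_star_alg: "star_alg Alg" and NAlg_star_alg: "star_alg NAlg"
  by (rule star_alg_like; simp)+

lemma cstar_seminorm_NAlg_iff: "cstar_seminorm NAlg p \<longleftrightarrow> cstar_seminorm Alg p"
  by (simp add: cstar_seminorm_def)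

lemma bcc_bounded:
  assumes "b \<in> bcc G" obtains M where "0 < M" "\<And>g. cmod (b g) \<le> M"
proof -
  obtain U K where "bcc_on G b U K" using assms by (rule bccE)
  note U = bcc_onD[OF this]
  have "compactin euclidean (b ` K)"
    by (rule image_compactin[OF _ U(4)]) (use U in \<open>simp add: compactin_subtopology\<close>)
  then have "bounded (b ` K)" by (simp add: compact_imp_bounded)
  then obtain M where M: "0 < M" "\<And>z. z \<in> b ` K \<Longrightarrow> cmod z \<le> M" unfolding bounded_pos by blast
  have "cmod (b g) \<le> M" for g
    using M U(5)[of g] by (cases "g \<in> K") auto
  then show ?thesis using that M(1) by blast
qed

text \<open>The bisection of \<open>b\<close> may leave the unit space, which need not be closed
  when the arrow space is not Hausdorff, so the units in \<open>K\<close> may fail to form a compact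
  set. The set of sources of \<open>K\<close> is compact and takes their place.\<close>

lemma bcc_units_cc0:
  assumes "b \<in> bcc G" and z: "\<And>g. g \<notin> units G \<Longrightarrow> b g = 0" shows "b \<in> cc0 G"
proof -
  obtain U K where "bcc_on G b U K" using assms(1) by (rule bccE)
  note U = bcc_onD[OF this]
  note UD = bisectionD[OF U(1)]
  have K: "compactin X0 (\<s> ` K)" by (rule image_compactin[OF U(3) continuous_src])
  have zero: "b x = 0" if "x \<notin> \<s> ` K" for x
  proof (cases "x \<in> units G")
    case True
    have "x \<notin> K" using True that src_unit by (metis imageI)
    then show ?thesis using U(5) by blast
  qed (rule z)
  have "continuous_map X0 euclidean b"
  proof (rule continuous_map_extend_zero[OF src_open[OF UD(1)] compact_X0_closed[OF K]])
    show "continuous_map (subtopology X0 (\<s> ` U)) euclidean b"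
    proof (rule continuous_map_eq[OF continuous_map_compose[OF src_section_cont[OF U(1)] U(4)]])
      fix x assume "x \<in> topspace (subtopology X0 (\<s> ` U))"
      then have x: "x \<in> units G" "x \<in> \<s> ` U" by auto
      let ?g = "inv_into U \<s> x"
      have g: "?g \<in> U" "\<s> ?g = x" using x by (auto simp: inv_into_into f_inv_into_f)
      show "(b \<circ> inv_into U \<s>) x = b x"
      proof (cases "?g \<in> units G")
        case True
        then show ?thesis using g by simp
      next
        case False
        \<comment> \<open>The arrow of \<open>U\<close> over \<open>x\<close> is not a unit, so
          \<open>b\<close> vanishes there; injectivity of the source map keeps \<open>x\<close>
          itself out of \<open>U\<close>, so \<open>b x\<close> is zero as well.\<close>
        have "x \<notin> U"
        proof
          assume "x \<in> U"
          then have "?g = x" using g x by (intro inj_onD[OF UD(3), of ?g x]) auto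
          then show False using False x by simp
        qed
        then have "b x = 0" using U(2,5) by blast
        then show ?thesis using z[OF False] by simp
      qed
    qed
  qed (use U zero in auto)
  then show ?thesis unfolding cc0_def using K zero by blast
qed

lemma cc0_involution: "h \<in> cc0 G \<Longrightarrow> involution G h = (\<lambda>x. cnj (h x))"
proof
  fix g assume h: "h \<in> cc0 G"
  show "involution G h g = cnj (h g)"
  proof (cases "g \<in> units G")
    case False
    have "\<iota> g \<notin> units G" if "g \<in> \<A>"
      using inv_unit[of "\<iota> g"] inv_inv[OF that] False by metis
    then show ?thesis using cc0_zero[OF h] False by (simp add: involution_def)
  qed (simp add: involution_def)
qed

lemma cc0_convolution:
  assumes "h \<in> cc0 G" shows "convolution G h k = (\<lambda>g. if g \<in> \<A> then h (\<r> g) * k g else 0)"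
    "convolution G k h = (\<lambda>g. if g \<in> \<A> then k g * h (\<s> g) else 0)"
  using convolution_unit_left[of h] convolution_unit_right[of h] cc0_zero[OF assms]
  by (auto simp: fun_eq_iff)

lemma cc0_convolution_cc0:
  assumes h: "h \<in> cc0 G" and k: "k \<in> cc0 G" shows "convolution G h k = (\<lambda>x. h x * k x)"
proof
  fix g show "convolution G h k g = h g * k g"
    using cc0_zero[OF k, of g] by (cases "g \<in> units G") (auto simp: cc0_convolution(1)[OF h])
qed

text \<open>The equation of \<open>N_le_one\<close> is solved pointwise: \<open>h / t\<close> is
  real with values between -1 and 1, and \<open>k = 1 - sqrt (1 - (h / t)^2)\<close> is continuous
  and vanishes where \<open>h\<close> does.\<close>

lemma cc0_seminorm_le:
  assumes p: "cstar_seminorm Alg p" and h: "h \<in> cc0 G" and t: "0 < t"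
    and re: "\<And>x. h x = complex_of_real (r x)" "\<And>x. \<bar>r x\<bar> \<le> t"
  shows "p h \<le> t"
proof -
  interpret star_seminorm Alg p using Alg_star_alg p by (rule star_alg.star_seminormI)
  define h' where "h' x = complex_of_real (r x / t)" for x
  define k where "k x = complex_of_real (1 - sqrt (1 - (r x / t)\<^sup>2))" for x
  obtain K where K: "continuous_map X0 euclidean h" "compactin X0 K" "\<And>x. x \<notin> K \<Longrightarrow> h x = 0"
    using h unfolding cc0_def by blast
  have r: "continuous_map X0 euclideanreal r"
    by (rule continuous_map_eq[OF continuous_map_Re[OF K(1)]]) (simp add: re)
  have r0: "r x = 0" if "x \<notin> K" for x using K(3)[OF that] re(1) by simp
  have rt: "continuous_map X0 euclideanreal (\<lambda>x. r x / t)"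
    using continuous_map_real_mult_right[OF r, of "1 / t"] by simp
  have h': "h' \<in> cc0 G" unfolding cc0_def h'_def
    using continuous_map_of_real[OF rt] K(2) r0 by auto
  have "continuous_map X0 euclidean k" unfolding k_def power2_eq_square
    by (intro continuous_map_of_real continuous_map_diff continuous_map_sqrt continuous_map_real_mult rt) auto
  then have k: "k \<in> cc0 G" unfolding cc0_def using K(2) r0 by (auto simp: k_def)
  have le1: "(r x / t)\<^sup>2 \<le> 1" for x
    using re(2)[of x] t by (simp add: abs_square_le_1)
  have sq: "h' x * h' x + k x * k x = 2 * k x" for x
  proof -
    define s where "s = sqrt (1 - (r x / t)\<^sup>2)"
    have s: "s\<^sup>2 = 1 - (r x / t)\<^sup>2" using le1[of x] by (simp add: s_def)
    have "(r x / t) * (r x / t) + (1 - s) * (1 - s) = 2 * (1 - s)"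
      using s by (simp add: power2_eq_square algebra_simps)
    then have "complex_of_real ((r x / t) * (r x / t) + (1 - s) * (1 - s)) = complex_of_real (2 * (1 - s))"
      by simp
    then show ?thesis by (simp only: h'_def k_def s_def[symmetric] of_real_mult of_real_add of_real_numeral)
  qed
  have "p h' \<le> 1"
    by (rule N_le_one[of h' k])
      (use h' k sq in \<open>auto simp: cc0_qcc cc0_involution cc0_convolution_cc0 fun_eq_iff h'_def k_def\<close>)
  moreover have "h = (\<lambda>x. complex_of_real t * h' x)" using t by (simp add: h'_def re fun_eq_iff)
  then have "p h = t * p h'" using N_scale[of h' "complex_of_real t"] cc0_qcc[OF h'] t by simp
  ultimately show ?thesis using t by simp
qed

text \<open>A bisection meets each source fibre in at most one arrow \<open>m\<close>, so
  \<open>b* b\<close> is a function on objects with values \<open>|b m|^2\<close>. Bounds for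
  \<open>b\<close> thereby reduce to \<open>cc0_seminorm_le\<close>.\<close>

lemma bcc_star_mult:
  assumes b: "b \<in> bcc G" and M: "\<And>g. cmod (b g) \<le> M"
  defines "h \<equiv> convolution G (involution G b) b"
  obtains r where "h \<in> cc0 G" "\<And>x. h x = complex_of_real (r x)" "\<And>x. 0 \<le> r x" "\<And>x. r x \<le> M\<^sup>2"
proof -
  obtain U K where "bcc_on G b U K" using b by (rule bccE)
  note U = bcc_onD[OF this]
  note UD = bisectionD[OF U(1)]
  have bU: "g \<in> U" if "b g \<noteq> 0" for g using U(2,5) that by blast
  have z: "h g = 0" if "g \<notin> units G" for g
    unfolding h_def using bisection_star_mult_units[OF bU UD(2) that] by blast
  have "h \<in> cc0 G"
    using bcc_units_cc0[OF _ z] bcc_convolution[OF bcc_involution[OF b] b] by (simp add: h_def)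
  moreover define r where "r x = (if x \<in> units G then \<Sum>m\<in>{m \<in> \<A>. \<s> m = x \<and> b m \<noteq> 0}. (cmod (b m))\<^sup>2 else 0)" for x
  moreover have "h x = complex_of_real (r x)" for x
    unfolding r_def using inner_self[OF bcc_fibre_finite[OF b], of x] z[of x] by (auto simp: h_def)
  moreover have "0 \<le> r x" for x by (simp add: r_def sum_nonneg)
  moreover have "r x \<le> M\<^sup>2" for x
  proof -
    let ?F = "{m \<in> \<A>. \<s> m = x \<and> b m \<noteq> 0}"
    have "(\<Sum>m\<in>?F. (cmod (b m))\<^sup>2) \<le> M\<^sup>2"
    proof (cases "?F = {}")
      case False
      then obtain m where m: "m \<in> ?F" by blast
      have "?F = {m}"
      proof (intro equalityI subsetI)
        fix n assume n: "n \<in> ?F"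
        have "n = m" by (rule inj_onD[OF UD(3)]) (use n m bU in auto)
        then show "n \<in> {m}" by simp
      qed (use m in simp)
      then show ?thesis using M[of m] by (simp add: power_mono)
    qed simp
    then show ?thesis by (simp add: r_def)
  qed
  ultimately show ?thesis using that by blast
qed

text \<open>For \<open>b\<close> on a bisection the C*-identity bounds every \<open>p b\<close> by a
  bound \<open>M\<close> of \<open>|b|\<close>, and sums add such bounds. This makes the supremum in
  \<open>max_cstar_norm\<close> finite.\<close>

lemma seminorms_bounded:
  "f \<in> qcc G \<Longrightarrow> \<exists>B. \<forall>p. cstar_seminorm Alg p \<longrightarrow> p f \<le> B"
proof (induction rule: qcc_induct)
  case zero
  have "p (\<lambda>_. 0) \<le> 0" if "cstar_seminorm Alg p" for p
    using star_seminorm.N_zero[OF star_alg.star_seminormI[OF Alg_star_alg that]] by simp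
  then show ?case by blast
next
  case (step b f)
  then obtain B where B: "\<And>p. cstar_seminorm Alg p \<Longrightarrow> p f \<le> B" by blast
  obtain M where M: "0 < M" "\<And>g. cmod (b g) \<le> M" using bcc_bounded[OF step(1)] by blast
  obtain r where r: "convolution G (involution G b) b \<in> cc0 G"
    "\<And>x. convolution G (involution G b) b x = complex_of_real (r x)" "\<And>x. 0 \<le> r x" "\<And>x. r x \<le> M\<^sup>2"
    using bcc_star_mult[OF step(1) M(2)] by blast
  have "p (\<lambda>g. b g + f g) \<le> M + B" if p: "cstar_seminorm Alg p" for p
  proof -
    interpret star_seminorm Alg p using Alg_star_alg p by (rule star_alg.star_seminormI)
    have "(p b)\<^sup>2 \<le> M\<^sup>2"
      using cc0_seminorm_le[OF p r(1) _ r(2), of "M\<^sup>2"] r(3,4) M(1) N_star_mult[of b] bcc_qcc[OF step(1)]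
      by simp
    then have "p b \<le> M" by (rule power2_le_imp_le) (use M in simp)
    then show ?thesis using N_add[of b f] B[OF p] bcc_qcc[OF step(1)] step(2) by simp
  qed
  then show ?case by blast
qed

lemma max_norm_cstar: "cstar_seminorm Alg (max_cstar_norm Alg)"
  using cstar_seminorm_max(1)[OF Alg_star_alg] seminorms_bounded by simp

lemma seminorm_le_max: "\<lbrakk>cstar_seminorm Alg p; f \<in> qcc G\<rbrakk> \<Longrightarrow> p f \<le> max_cstar_norm Alg f"
  using cstar_seminorm_max(2)[OF Alg_star_alg] seminorms_bounded by simp

lemma NAlg_pre_cstar: "pre_cstar NAlg"
  unfolding pre_cstar_def
  by (rule star_alg.star_seminormI[OF NAlg_star_alg]) (simp add: cstar_seminorm_NAlg_iff max_norm_cstar)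

section \<open>Point evaluations\<close>

text \<open>The GNS representation of the evaluation at \<open>x\<close> is the regular
  representation on \<open>l^2\<close> of the source fibre: the form at \<open>b\<close> is the
  squared \<open>l^2\<close>-norm of \<open>b\<close> on this fibre.\<close>

lemma gns_evaluation:
  assumes x: "x \<in> units G" shows "gns Alg (\<lambda>f. f x)"
proof (intro gns.intro Alg_star_alg gns_axioms.intro)
  fix a assume "a \<in> acarrier Alg"
  then have a: "a \<in> qcc G" by simp
  show "astar Alg a x = cnj (a x)" using x by (simp add: involution_def)
  show "0 \<le> Re (amult Alg (astar Alg a) a x)"
    using inner_self[OF qcc_fibre_finite[OF a] x] by (simp add: sum_nonneg)
  let ?n = "\<lambda>b. Re (convolution G (involution G b) b x)"
  have nb: "?n b = (\<Sum>m\<in>{m \<in> \<A>. \<s> m = x \<and> b m \<noteq> 0}. (cmod (b m))\<^sup>2)" if "b \<in> qcc G" for b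
    using inner_self[OF qcc_fibre_finite[OF that] x] by simp
  have n0: "0 \<le> ?n b" if "b \<in> qcc G" for b using nb[OF that] by (simp add: sum_nonneg)
  have "\<exists>M. 0 \<le> M \<and> (\<forall>b\<in>qcc G. ?n (convolution G a b) \<le> M\<^sup>2 * ?n b)" using a
  proof (induction rule: qcc_induct)
    case zero
    have *: "convolution G (\<lambda>_. 0) b = (\<lambda>_. 0)" for b by (simp add: convolution_def fun_eq_iff)
    have "?n (\<lambda>_. 0) = 0" using nb[OF qcc_zero] by simp
    then show ?case using * by (intro exI[of _ 0]) simp
  next
    case (step c f)
    then obtain B where B: "0 \<le> B" "\<And>b. b \<in> qcc G \<Longrightarrow> ?n (convolution G f b) \<le> B\<^sup>2 * ?n b" by blast
    obtain M where M: "0 < M" "\<And>g. cmod (c g) \<le> M" using bcc_bounded[OF step(1)] by blast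
    obtain r where r: "convolution G (involution G c) c \<in> cc0 G"
      "\<And>x. convolution G (involution G c) c x = complex_of_real (r x)" "\<And>x. 0 \<le> r x" "\<And>x. r x \<le> M\<^sup>2"
      using bcc_star_mult[OF step(1) M(2)] by blast
    have c: "c \<in> qcc G" using step(1) by (rule bcc_qcc)
    \<comment> \<open>Reassociating brings \<open>c* c\<close> next to \<open>b\<close>; it acts by
      multiplication with the value of \<open>r\<close> at the range, which is at most
      \<open>M^2\<close>.\<close>
    have cb: "?n (convolution G c b) \<le> M\<^sup>2 * ?n b" if b: "b \<in> qcc G" for b
    proof -
      have "convolution G (involution G (convolution G c b)) (convolution G c b)
          = convolution G (involution G b) (convolution G (convolution G (involution G c) c) b)"
        using b c by (simp add: involution_convolution convolution_assoc qcc_fibre_finite qcc_involution)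
      then have "?n (convolution G c b)
          = Re (\<Sum>m\<in>{m \<in> \<A>. \<s> m = x \<and> b m \<noteq> 0}. cnj (b m) * convolution G (convolution G (involution G c) c) b m)"
        by (simp add: convolution_inner[OF qcc_fibre_finite[OF b] x])
      also have "\<dots> = Re (\<Sum>m\<in>{m \<in> \<A>. \<s> m = x \<and> b m \<noteq> 0}. complex_of_real (r (\<r> m) * (cmod (b m))\<^sup>2))"
        by (intro arg_cong[of _ _ Re] sum.cong)
          (simp_all add: cc0_convolution(1)[OF r(1)] r(2) complex_norm_square mult.commute mult.left_commute
            del: of_real_power)
      also have "\<dots> = (\<Sum>m\<in>{m \<in> \<A>. \<s> m = x \<and> b m \<noteq> 0}. r (\<r> m) * (cmod (b m))\<^sup>2)"
        by (simp only: Re_sum Re_complex_of_real)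
      also have "\<dots> \<le> (\<Sum>m\<in>{m \<in> \<A>. \<s> m = x \<and> b m \<noteq> 0}. M\<^sup>2 * (cmod (b m))\<^sup>2)"
        by (intro sum_mono mult_right_mono r) simp
      also have "\<dots> = M\<^sup>2 * ?n b" by (simp add: nb[OF b] sum_distrib_left)
      finally show ?thesis .
    qed
    \<comment> \<open>Only some bound is needed, so \<open>|u + v|^2 \<le> 2 |u|^2 + 2 |v|^2\<close>
      replaces the triangle inequality and yields this constant.\<close>
    have "?n (convolution G (\<lambda>g. c g + f g) b) \<le> (sqrt (2 * (M\<^sup>2 + B\<^sup>2)))\<^sup>2 * ?n b" if b: "b \<in> qcc G" for b
    proof -
      let ?u = "convolution G c b" and ?v = "convolution G f b"
      have uv: "?u \<in> qcc G" "?v \<in> qcc G" using b c step(2) by (auto simp: qcc_convolution)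
      let ?F = "{m \<in> \<A>. \<s> m = x \<and> ?u m \<noteq> 0} \<union> {m \<in> \<A>. \<s> m = x \<and> ?v m \<noteq> 0}"
      have fin: "finite ?F" using qcc_fibre_finite[OF uv(1)] qcc_fibre_finite[OF uv(2)]
        by (simp add: fibre_finite_def)
      have nF: "?n w = (\<Sum>m\<in>?F. (cmod (w m))\<^sup>2)"
        if "w \<in> qcc G" "\<And>m. ?u m = 0 \<Longrightarrow> ?v m = 0 \<Longrightarrow> w m = 0" for w
        unfolding nb[OF that(1)] by (rule sum.mono_neutral_left[OF fin]) (use that(2) in auto)
      have "?n (\<lambda>g. ?u g + ?v g) = (\<Sum>m\<in>?F. (cmod (?u m + ?v m))\<^sup>2)"
        by (rule nF) (auto simp: uv qcc_add)
      also have "\<dots> \<le> (\<Sum>m\<in>?F. 2 * (cmod (?u m))\<^sup>2 + 2 * (cmod (?v m))\<^sup>2)"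
      proof (rule sum_mono)
        fix m
        have "(cmod (?u m + ?v m))\<^sup>2 \<le> (cmod (?u m) + cmod (?v m))\<^sup>2"
          by (intro power_mono norm_triangle_ineq) simp
        also have "\<dots> \<le> 2 * (cmod (?u m))\<^sup>2 + 2 * (cmod (?v m))\<^sup>2"
          using sum_squares_bound[of "cmod (?u m)" "cmod (?v m)"] by (simp add: power2_sum)
        finally show "(cmod (?u m + ?v m))\<^sup>2 \<le> 2 * (cmod (?u m))\<^sup>2 + 2 * (cmod (?v m))\<^sup>2" .
      qed
      also have "\<dots> = 2 * ?n ?u + 2 * ?n ?v"
        using nF[OF uv(1)] nF[OF uv(2)] by (simp add: sum.distrib sum_distrib_left)
      also have "\<dots> \<le> 2 * (M\<^sup>2 * ?n b) + 2 * (B\<^sup>2 * ?n b)" using cb[OF b] B(2)[OF b] by linarith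
      also have "\<dots> = (sqrt (2 * (M\<^sup>2 + B\<^sup>2)))\<^sup>2 * ?n b" by (simp add: algebra_simps)
      finally show ?thesis
        using convolution_add_left[OF qcc_fibre_finite[OF c] qcc_fibre_finite[OF step(2)], of b] by simp
    qed
    then show ?case by (intro exI[of _ "sqrt (2 * (M\<^sup>2 + B\<^sup>2))"]) auto
  qed
  then show "\<exists>M\<ge>0. \<forall>b\<in>acarrier Alg. Re (amult Alg (astar Alg (amult Alg a b)) (amult Alg a b) x)
      \<le> M\<^sup>2 * Re (amult Alg (astar Alg b) b x)" by simp
qed simp_all

text \<open>In the regular representation at the source \<open>x\<close> of \<open>g\<close>, the
  value \<open>f g\<close> is the coordinate at \<open>g\<close> of the image of the point mass at
  \<open>x\<close>; on this source fibre \<open>u\<close> is that point mass.\<close>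

lemma evaluation_le_norm:
  assumes f: "f \<in> qcc G" shows "cmod (f g) \<le> max_cstar_norm Alg f"
proof (cases "g \<in> \<A>")
  case False
  then show ?thesis using qcc_zero_off[OF f False] star_seminorm.N_nonneg[of Alg] f
    star_alg.star_seminormI[OF Alg_star_alg max_norm_cstar] by auto
next
  case g: True
  define x where "x = \<s> g"
  have x: "x \<in> units G" using g by (simp add: x_def)
  interpret gns Alg "\<lambda>f. f x" by (rule gns_evaluation[OF x])
  have c: "compactin X0 {x}" "openin X0 (units G)" "{x} \<subseteq> units G"
    using x openin_X0 units_open by auto
  obtain u where u1: "u \<in> cc0 G" "\<And>y. y \<in> {x} \<Longrightarrow> u y = 1" "\<And>y. y \<notin> units G \<Longrightarrow> u y = 0"
    using cc0_bump[OF c] by blast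
  then have u: "u \<in> cc0 G" "u x = 1" by auto
  have uq: "u \<in> qcc G" using u(1) by (rule cc0_qcc)
  have fu: "convolution G f u \<in> qcc G" using f uq by (rule qcc_convolution)
  have nb: "(q b)\<^sup>2 = (\<Sum>m\<in>{m \<in> \<A>. \<s> m = x \<and> b m \<noteq> 0}. (cmod (b m))\<^sup>2)" if "b \<in> qcc G" for b
    using q_sq[of b] that inner_self[OF qcc_fibre_finite[OF that] x] by simp
  have "{m \<in> \<A>. \<s> m = x \<and> u m \<noteq> 0} = {x}"
  proof (intro equalityI subsetI)
    fix m assume m: "m \<in> {m \<in> \<A>. \<s> m = x \<and> u m \<noteq> 0}"
    then have "m \<in> units G" using cc0_zero[OF u(1)] by blast
    then show "m \<in> {x}" using m src_unit by auto
  qed (use x u in auto)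
  then have "(q u)\<^sup>2 = 1" using nb[OF uq] u(2) by simp
  then have "q u = 1 \<or> q u = - 1" by (simp add: power2_eq_1_iff)
  moreover have "0 \<le> q u" using uq by simp
  ultimately have "q u = 1" by linarith
  have "(cmod (f g))\<^sup>2 \<le> (q (convolution G f u))\<^sup>2"
  proof (cases "f g = 0")
    case False
    have fug: "convolution G f u g = f g" using g u(2) by (simp add: cc0_convolution(2)[OF u(1)] x_def)
    have "(cmod (convolution G f u g))\<^sup>2 \<le> (q (convolution G f u))\<^sup>2"
      unfolding nb[OF fu] using qcc_fibre_finite[OF fu] g fug False
      by (intro member_le_sum) (auto simp: x_def fibre_finite_def)
    then show ?thesis using fug by simp
  qed simp
  then have "cmod (f g) \<le> q (convolution G f u)" by (rule power2_le_imp_le) (use q_nonneg fu in simp)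
  also have "\<dots> \<le> gnorm f" using q_le_gnorm[of f u] f uq \<open>q u = 1\<close> by simp
  also have "\<dots> \<le> max_cstar_norm Alg f" using gnorm_cstar_seminorm f by (rule seminorm_le_max)
  finally show ?thesis .
qed

end

section \<open>Coefficient functions of elements of the groupoid C*-algebra\<close>

text \<open>The limit exists because point evaluations are dominated by the maximal norm.\<close>

definition coef :: "(nat \<Rightarrow> 'g \<Rightarrow> complex) set \<Rightarrow> 'g \<Rightarrow> complex" where
  "coef X g = lim (\<lambda>n. cauchy_rep X n g)"

context etale_lc_groupoid
begin

abbreviation Cst where "Cst \<equiv> groupoid_cstar G"

lemma Cst_cstar_alg: "cstar_alg Cst"
  unfolding groupoid_cstar_def using NAlg_pre_cstar by (rule pre_cstar.completion_cstar_alg)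

interpretation N: pre_cstar NAlg by (rule NAlg_pre_cstar)
interpretation C: cstar_alg Cst by (rule Cst_cstar_alg)

lemma Cst_eq: "Cst = completion NAlg"
  by (simp add: groupoid_cstar_def)

lemma evaluation_le_adist:
  assumes "f \<in> qcc G" "h \<in> qcc G" shows "cmod (f g - h g) \<le> adist NAlg f h"
proof -
  have "(\<lambda>g. f g + (-1) * h g) \<in> qcc G" using assms by (intro qcc_add qcc_scale)
  from evaluation_le_norm[OF this, of g] show ?thesis by (simp add: adist_def)
qed

lemma coef_lim:
  assumes u: "u \<in> cauchy_seqs NAlg"
  shows "(\<lambda>n. u n g) \<longlonglongrightarrow> coef (cauchy_class NAlg u) g"
proof -
  let ?v = "cauchy_rep (cauchy_class NAlg u)"
  note v = N.rep_class[OF u]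
  have q: "u n \<in> qcc G" "?v n \<in> qcc G" for n
    using N.cauchy_seqs_closed[OF u] N.cauchy_seqs_closed[OF v(1)] by auto
  have "Cauchy (\<lambda>n. ?v n g)"
  proof (rule CauchyI)
    fix e :: real assume "0 < e"
    then obtain M where M: "\<forall>m\<ge>M. \<forall>n\<ge>M. adist NAlg (?v m) (?v n) < e"
      using N.cauchy_seqsD[OF v(1)] by blast
    have "norm (?v m g - ?v n g) < e" if "m \<ge> M" "n \<ge> M" for m n
      using evaluation_le_adist[OF q(2) q(2), of m g n] M[rule_format, OF that] by linarith
    then show "\<exists>M. \<forall>m\<ge>M. \<forall>n\<ge>M. norm (?v m g - ?v n g) < e" by blast
  qed
  then have l: "(\<lambda>n. ?v n g) \<longlonglongrightarrow> coef (cauchy_class NAlg u) g"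
    unfolding coef_def by (simp add: Cauchy_convergent_iff convergent_LIMSEQ_iff)
  have "(\<lambda>n. ?v n g - u n g) \<longlonglongrightarrow> 0"
    by (rule Lim_null_comparison[OF _ v(2)]) (use evaluation_le_adist[OF q(2) q(1)] in auto)
  from tendsto_diff[OF l this] show ?thesis by simp
qed

lemma to_cstar_closed [simp]: "f \<in> qcc G \<Longrightarrow> to_cstar G f \<in> acarrier Cst"
  using N.to_completion_closed by (simp add: to_cstar_def Cst_eq)

lemma to_cstar_add: "\<lbrakk>f \<in> qcc G; h \<in> qcc G\<rbrakk> \<Longrightarrow>
    to_cstar G (\<lambda>g. f g + h g) = aadd Cst (to_cstar G f) (to_cstar G h)"
  and to_cstar_scale: "f \<in> qcc G \<Longrightarrow> to_cstar G (\<lambda>g. c * f g) = ascale Cst c (to_cstar G f)"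
  and to_cstar_mult: "\<lbrakk>f \<in> qcc G; h \<in> qcc G\<rbrakk> \<Longrightarrow>
    to_cstar G (convolution G f h) = amult Cst (to_cstar G f) (to_cstar G h)"
  using N.to_completion_add N.to_completion_scale N.to_completion_mult
  by (simp_all add: to_cstar_def Cst_eq)

lemma adist_to_cstar:
  "\<lbrakk>f \<in> qcc G; h \<in> qcc G\<rbrakk> \<Longrightarrow> adist Cst (to_cstar G f) (to_cstar G h) = adist NAlg f h"
  using N.adist_to_completion by (simp add: to_cstar_def Cst_eq)

lemma Cst_dense:
  assumes "X \<in> acarrier Cst" "0 < e" obtains f where "f \<in> qcc G" "adist Cst X (to_cstar G f) < e"
  using N.completion_dense[of X e] assms by (auto simp: to_cstar_def Cst_eq)

lemma Cst_class:
  assumes "X \<in> acarrier Cst"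
  obtains u where "u \<in> cauchy_seqs NAlg" "X = cauchy_class NAlg u" "\<And>n. u n \<in> qcc G"
  using N.classE[of X] assms by (auto simp: Cst_eq)

lemma Cst_sequence:
  assumes "X \<in> acarrier Cst"
  obtains u where "\<And>n. u n \<in> qcc G" "(\<lambda>n. adist Cst X (to_cstar G (u n))) \<longlonglongrightarrow> 0"
proof -
  obtain u where u: "u \<in> cauchy_seqs NAlg" "X = cauchy_class NAlg u" "\<And>n. u n \<in> qcc G"
    using Cst_class[OF assms] by blast
  show ?thesis
    using that[of u] N.class_limit[OF u(1)] u(2,3) by (simp add: to_cstar_def Cst_eq)
qed

lemma coef_to_cstar [simp]: "f \<in> qcc G \<Longrightarrow> coef (to_cstar G f) = f"
  using coef_lim[of "\<lambda>_. f"] LIMSEQ_unique[OF _ tendsto_const]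
  by (fastforce simp: to_cstar_def to_completion_def fun_eq_iff)

lemma coef_add:
  assumes "X \<in> acarrier Cst" "Y \<in> acarrier Cst" shows "coef (aadd Cst X Y) g = coef X g + coef Y g"
proof -
  obtain u where u: "u \<in> cauchy_seqs NAlg" "X = cauchy_class NAlg u" "\<And>n. u n \<in> qcc G"
    using Cst_class[OF assms(1)] by blast
  obtain v where v: "v \<in> cauchy_seqs NAlg" "Y = cauchy_class NAlg v" "\<And>n. v n \<in> qcc G"
    using Cst_class[OF assms(2)] by blast
  have "aadd Cst X Y = cauchy_class NAlg (\<lambda>n. aadd NAlg (u n) (v n))"
    using N.completion_add[OF u(1) v(1)] u(2) v(2) by (simp add: Cst_eq)
  then have "(\<lambda>n. u n g + v n g) \<longlonglongrightarrow> coef (aadd Cst X Y) g"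
    using coef_lim[OF N.cauchy_add[OF u(1) v(1)], of g] by simp
  moreover have "(\<lambda>n. u n g + v n g) \<longlonglongrightarrow> coef X g + coef Y g"
    unfolding u(2) v(2) by (intro tendsto_add coef_lim u(1) v(1))
  ultimately show ?thesis by (rule LIMSEQ_unique)
qed

lemma coef_scale: assumes "X \<in> acarrier Cst" shows "coef (ascale Cst c X) g = c * coef X g"
proof -
  obtain u where u: "u \<in> cauchy_seqs NAlg" "X = cauchy_class NAlg u"
    using Cst_class[of X] assms by blast
  have "ascale Cst c X = cauchy_class NAlg (\<lambda>n. ascale NAlg c (u n))"
    using N.completion_scale[OF u(1)] u(2) by (simp add: Cst_eq)
  then have "(\<lambda>n. c * u n g) \<longlonglongrightarrow> coef (ascale Cst c X) g"
    using coef_lim[OF N.cauchy_scale[OF u(1)], of c g] by simp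
  moreover have "(\<lambda>n. c * u n g) \<longlonglongrightarrow> c * coef X g"
    unfolding u(2) by (intro tendsto_mult tendsto_const coef_lim u(1))
  ultimately show ?thesis by (rule LIMSEQ_unique)
qed

lemma coef_le_norm: assumes "X \<in> acarrier Cst" shows "cmod (coef X g) \<le> anorm Cst X"
proof -
  obtain u where u: "u \<in> cauchy_seqs NAlg" "X = cauchy_class NAlg u" "\<And>n. u n \<in> qcc G"
    using Cst_class[OF assms] by blast
  show ?thesis unfolding u(2) Cst_eq
    by (rule LIMSEQ_le[OF tendsto_norm[OF coef_lim[OF u(1)]] N.completion_norm[OF u(1)]])
      (use u(3) evaluation_le_norm in auto)
qed

lemma coef_diff_le:
  assumes "X \<in> acarrier Cst" "Y \<in> acarrier Cst" shows "cmod (coef X g - coef Y g) \<le> adist Cst X Y"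
  using coef_le_norm[of "aadd Cst X (ascale Cst (-1) Y)" g] assms by (simp add: adist_def coef_add coef_scale)

lemma coef_limit:
  assumes "\<And>n. Y n \<in> acarrier Cst" "X \<in> acarrier Cst" "(\<lambda>n. adist Cst X (Y n)) \<longlonglongrightarrow> 0"
  shows "(\<lambda>n. coef (Y n) g) \<longlonglongrightarrow> coef X g"
proof -
  have "cmod (coef (Y n) g - coef X g) \<le> adist Cst X (Y n)" for n
    using coef_diff_le[OF assms(2,1), of g n] by (simp add: norm_minus_commute)
  then have "(\<lambda>n. coef (Y n) g - coef X g) \<longlonglongrightarrow> 0"
    by (intro Lim_null_comparison[OF _ assms(3)]) simp
  then show ?thesis by (simp add: LIM_zero_iff)
qed

lemma coef_zero_off: assumes "X \<in> acarrier Cst" "g \<notin> \<A>" shows "coef X g = 0"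
proof -
  obtain u where u: "\<And>n. u n \<in> qcc G" "(\<lambda>n. adist Cst X (to_cstar G (u n))) \<longlonglongrightarrow> 0"
    using Cst_sequence[OF assms(1)] by blast
  have "(\<lambda>n. coef (to_cstar G (u n)) g) \<longlonglongrightarrow> coef X g"
    by (rule coef_limit) (use u assms in auto)
  then show ?thesis using qcc_zero_off[OF u(1) assms(2)] u(1) LIMSEQ_unique[OF _ tendsto_const] by fastforce
qed

text \<open>Convolution with \<open>f\<close> is a finite sum at each arrow, so it commutes with
  pointwise limits, although \<open>coef Y\<close> need not have finite fibres.\<close>

lemma coef_mult_left:
  assumes f: "f \<in> qcc G" and Y: "Y \<in> acarrier Cst"
  shows "coef (amult Cst (to_cstar G f) Y) = convolution G f (coef Y)"
proof
  fix g
  obtain v where v: "v \<in> cauchy_seqs NAlg" "Y = cauchy_class NAlg v"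
    using Cst_class[OF Y] by blast
  have fc: "(\<lambda>_. f) \<in> cauchy_seqs NAlg" using f by simp
  show "coef (amult Cst (to_cstar G f) Y) g = convolution G f (coef Y) g"
  proof (cases "g \<in> \<A>")
    case True
    have "amult Cst (to_cstar G f) Y = cauchy_class NAlg (\<lambda>n. amult NAlg f (v n))"
      using N.completion_mult[OF fc v(1)] v(2) by (simp add: Cst_eq to_cstar_def to_completion_def)
    then have "(\<lambda>n. convolution G f (v n) g) \<longlonglongrightarrow> coef (amult Cst (to_cstar G f) Y) g"
      using coef_lim[OF N.cauchy_mult[OF fc v(1)], of g] by simp
    moreover have "(\<lambda>n. convolution G f (v n) g) \<longlonglongrightarrow> convolution G f (coef Y) g"
      unfolding convolution_sum_supp[OF qcc_fibre_finite[OF f] True] v(2)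
      by (intro tendsto_sum tendsto_mult tendsto_const coef_lim v(1))
    ultimately show ?thesis by (rule LIMSEQ_unique)
  next
    case False
    then show ?thesis using coef_zero_off[OF C.mult_closed[OF to_cstar_closed[OF f] Y]] by simp
  qed
qed

text \<open>\<open>X\<close> is approximated in norm by functions, for which
  \<open>coef_mult_left\<close> leaves one term; both sides are continuous in
  \<open>X\<close>.\<close>

lemma coef_mult_units:
  assumes X: "X \<in> acarrier Cst" and Y: "Y \<in> acarrier Cst"
    and u: "\<And>g. g \<notin> units G \<Longrightarrow> coef Y g = 0" and g: "g \<in> \<A>"
  shows "coef (amult Cst X Y) g = coef X g * coef Y (\<s> g)"
proof -
  obtain f where f: "\<And>n. f n \<in> qcc G" "(\<lambda>n. adist Cst X (to_cstar G (f n))) \<longlonglongrightarrow> 0"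
    using Cst_sequence[OF X] by blast
  have "(\<lambda>n. coef (amult Cst (to_cstar G (f n)) Y) g) \<longlonglongrightarrow> coef (amult Cst X Y) g"
  proof (rule coef_limit)
    show "(\<lambda>n. adist Cst (amult Cst X Y) (amult Cst (to_cstar G (f n)) Y)) \<longlonglongrightarrow> 0"
    proof (rule null_squeeze[OF tendsto_mult_left_zero[OF f(2), of "anorm Cst Y"]])
      fix n
      show "adist Cst (amult Cst X Y) (amult Cst (to_cstar G (f n)) Y) \<le> adist Cst X (to_cstar G (f n)) * anorm Cst Y"
        using C.adist_mult[of X Y "to_cstar G (f n)" Y] X Y f(1) by simp
    qed (use X Y f in simp)
  qed (use X Y f in auto)
  moreover have "coef (amult Cst (to_cstar G (f n)) Y) g = coef (to_cstar G (f n)) g * coef Y (\<s> g)" for n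
    using coef_mult_left[OF f(1) Y] convolution_unit_right[OF u g] f(1) by simp
  moreover have "(\<lambda>n. coef (to_cstar G (f n)) g * coef Y (\<s> g)) \<longlonglongrightarrow> coef X g * coef Y (\<s> g)"
    by (intro tendsto_mult tendsto_const coef_limit X f) (use f in auto)
  ultimately show ?thesis using LIMSEQ_unique by simp
qed

lemma coef_star: assumes "X \<in> acarrier Cst" "g \<in> \<A>" shows "coef (astar Cst X) g = cnj (coef X (\<iota> g))"
proof -
  obtain u where u: "u \<in> cauchy_seqs NAlg" "X = cauchy_class NAlg u"
    using Cst_class[of X] assms by blast
  have "astar Cst X = cauchy_class NAlg (\<lambda>n. astar NAlg (u n))"
    using N.completion_star[OF u(1)] u(2) by (simp add: Cst_eq)
  then have "(\<lambda>n. cnj (u n (\<iota> g))) \<longlonglongrightarrow> coef (astar Cst X) g"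
    using coef_lim[OF N.cauchy_star[OF u(1)], of g] assms(2) by (simp add: involution_def)
  moreover have "(\<lambda>n. cnj (u n (\<iota> g))) \<longlonglongrightarrow> cnj (coef X (\<iota> g))"
    unfolding u(2) by (intro tendsto_cnj coef_lim u(1))
  ultimately show ?thesis by (rule LIMSEQ_unique)
qed

text \<open>Adjoints turn this into \<open>coef_mult_units\<close>, since the coefficients of the
  adjoint of \<open>X\<close> live on units as well.\<close>

lemma coef_units_mult:
  assumes X: "X \<in> acarrier Cst" and Y: "Y \<in> acarrier Cst"
    and u: "\<And>g. g \<notin> units G \<Longrightarrow> coef X g = 0" and g: "g \<in> \<A>"
  shows "coef (amult Cst X Y) g = coef X (\<r> g) * coef Y g"
proof -
  have u': "coef (astar Cst X) k = 0" if "k \<notin> units G" for k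
  proof (cases "k \<in> \<A>")
    case True
    then have "\<iota> k \<notin> units G" using that inv_unit[of "\<iota> k"] inv_inv[OF True] by metis
    then show ?thesis using coef_star[OF X True] u by simp
  qed (use X in \<open>simp add: coef_zero_off\<close>)
  have "coef (amult Cst X Y) g = cnj (coef (amult Cst (astar Cst Y) (astar Cst X)) (\<iota> g))"
    using coef_star[of "amult Cst X Y" "\<iota> g"] X Y g by (simp add: C.star_mult)
  also have "\<dots> = cnj (coef (astar Cst Y) (\<iota> g) * coef (astar Cst X) (\<s> (\<iota> g)))"
    using X Y g u' by (subst coef_mult_units) auto
  also have "\<dots> = coef X (\<r> g) * coef Y g"
    using X Y g by (simp add: coef_star)
  finally show ?thesis .
qed

text \<open>In a Hausdorff arrow space \<open>K\<close> is closed, so a function on a bisection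
  extends continuously by zero. Hausdorffness of \<open>G\<close> enters the final result through
  this lemma and \<open>coef_nonzero_open\<close>.\<close>

lemma qcc_continuous:
  assumes "Hausdorff_groupoid G" "f \<in> qcc G" shows "continuous_map T euclidean f"
  using assms(2)
proof (induction rule: qcc_induct)
  case (step b f)
  obtain U K where "bcc_on G b U K" using step(1) by (rule bccE)
  note U = bcc_onD[OF this]
  have "closedin T K" using assms(1) U(3) by (simp add: Hausdorff_groupoid_def compactin_imp_closedin)
  then have "continuous_map T euclidean b"
    by (rule continuous_map_extend_zero[OF bisectionD(1)[OF U(1)] _ U(2,4)]) (use U in blast)
  then show ?case using step by (intro continuous_map_add)
qed simp

lemma coef_nonzero_open:
  assumes "Hausdorff_groupoid G" and X: "X \<in> acarrier Cst"
  shows "openin T {g \<in> \<A>. coef X g \<noteq> 0}"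
proof (subst openin_subopen, clarify)
  fix g assume g: "g \<in> \<A>" "coef X g \<noteq> 0"
  \<comment> \<open>At \<open>g\<close> the approximant then exceeds \<open>?e\<close> in modulus,
    and wherever it does the coefficient cannot vanish.\<close>
  let ?e = "cmod (coef X g) / 3"
  obtain f where f: "f \<in> qcc G" "adist Cst X (to_cstar G f) < ?e" using Cst_dense[OF X, of ?e] g by auto
  have close: "cmod (coef X k - f k) < ?e" for k
    using coef_diff_le[OF X to_cstar_closed[OF f(1)], of k] f by simp
  let ?V = "{k \<in> topspace T. cmod (f k) \<in> {?e<..}}"
  have "openin T ?V"
    by (rule openin_continuous_map_preimage[OF continuous_map_norm[OF qcc_continuous[OF assms(1) f(1)]]]) simp
  moreover have "g \<in> ?V"
  proof -
    have "0 < cmod (coef X g)" using g by simp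
    then have "?e < cmod (f g)" using close[of g] norm_triangle_ineq2[of "coef X g" "f g"] by linarith
    then show ?thesis using g by simp
  qed
  moreover have "?V \<subseteq> {g \<in> \<A>. coef X g \<noteq> 0}"
  proof
    fix k assume k: "k \<in> ?V"
    then show "k \<in> {g \<in> \<A>. coef X g \<noteq> 0}" using close[of k] by auto
  qed
  ultimately show "\<exists>V. openin T V \<and> g \<in> V \<and> V \<subseteq> {g \<in> \<A>. coef X g \<noteq> 0}" by blast
qed

text \<open>The adjoint used in \<open>mult_left_cancel\<close> need not come from
  \<open>qcc\<close>, so vanishing on functions is first extended to the whole algebra by
  density.\<close>

lemma Cst_left_cancel:
  assumes X: "X \<in> acarrier Cst" and Y: "Y \<in> acarrier Cst"
    and eq: "\<And>f. f \<in> qcc G \<Longrightarrow> amult Cst X (to_cstar G f) = amult Cst Y (to_cstar G f)"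
  shows "X = Y"
proof (rule C.diff_eq_zero[OF X Y])
  let ?Z = "aadd Cst X (ascale Cst (-1) Y)"
  have Z: "?Z \<in> acarrier Cst" using X Y by simp
  have z: "amult Cst ?Z (to_cstar G f) = azero Cst" if "f \<in> qcc G" for f
    using X Y that eq[OF that] by (simp add: C.mult_add_left)
  show "?Z = azero Cst"
  proof (rule C.mult_left_cancel[OF Z])
    fix b assume b: "b \<in> acarrier Cst"
    obtain u where u: "\<And>n. u n \<in> qcc G" "(\<lambda>n. adist Cst b (to_cstar G (u n))) \<longlonglongrightarrow> 0"
      using Cst_sequence[OF b] by blast
    have "adist Cst (amult Cst ?Z b) (azero Cst) \<le> anorm Cst ?Z * adist Cst b (to_cstar G (u n))" for n
      using C.adist_mult[OF Z b Z to_cstar_closed[OF u(1)[of n]]] z[OF u(1)[of n]] Z b by simp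
    then have "adist Cst (amult Cst ?Z b) (azero Cst) \<le> 0"
      using LIMSEQ_le_const[OF tendsto_mult_right_zero[OF u(2), of "anorm Cst ?Z"]] by blast
    moreover have "0 \<le> adist Cst (amult Cst ?Z b) (azero Cst)"
      by (rule C.adist_nonneg) (use Z b in simp_all)
    ultimately have "adist Cst (amult Cst ?Z b) (azero Cst) = 0" by linarith
    then show "amult Cst ?Z b = azero Cst" using C.adist_eq_0[of "amult Cst ?Z b" "azero Cst"] Z b by simp
  qed
qed

text \<open>Compact sets of arrows need not be closed, but their ranges lie in the Hausdorff object
  space; this form of compact support is what \<open>anchor_proper\<close> uses.\<close>

lemma qcc_compact_range:
  "f \<in> qcc G \<Longrightarrow> \<exists>L. compactin X0 L \<and> (\<forall>g. f g \<noteq> 0 \<longrightarrow> \<r> g \<in> L)"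
proof (induction rule: qcc_induct)
  case zero
  show ?case by (intro exI[of _ "{}"]) simp
next
  case (step b f)
  then obtain L where L: "compactin X0 L" "\<forall>g. f g \<noteq> 0 \<longrightarrow> \<r> g \<in> L" by blast
  obtain U K where "bcc_on G b U K" using step(1) by (rule bccE)
  note U = bcc_onD[OF this]
  have "compactin X0 (\<r> ` K)" by (rule image_compactin[OF U(3) continuous_rng])
  then have "compactin X0 (L \<union> \<r> ` K)" using L(1) by (intro compactin_Un)
  moreover have "\<r> g \<in> L \<union> \<r> ` K" if "b g + f g \<noteq> 0" for g
    using that L(2) U(5)[of g] by (cases "f g = 0") auto
  ultimately show ?case by blast
qed

lemma cc0_separate:
  assumes "x \<in> units G" "y \<in> units G" "x \<noteq> y"
  obtains u where "u \<in> cc0 G" "u x = 1" "u y = 0"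
proof -
  have "closedin X0 {y}" using assms Hausdorff_units by (simp add: closedin_Hausdorff_singleton)
  then have o: "openin X0 (units G - {y})" by (metis openin_diff openin_topspace topspace_X0)
  have c: "compactin X0 {x}" "{x} \<subseteq> units G - {y}" using assms by auto
  obtain u where "u \<in> cc0 G" "\<And>z. z \<in> {x} \<Longrightarrow> u z = 1" "\<And>z. z \<notin> units G - {y} \<Longrightarrow> u z = 0"
    using cc0_bump[OF c(1) o c(2)] by blast
  then show ?thesis using that by auto
qed

lemma cc0_at:
  assumes "x \<in> W" "openin X0 W"
  obtains u where "u \<in> cc0 G" "u x = 1" "\<And>y. y \<notin> W \<Longrightarrow> u y = 0"
proof -
  have c: "compactin X0 {x}" "{x} \<subseteq> W" using assms openin_subset[OF assms(2)] by auto
  obtain u where "u \<in> cc0 G" "\<And>z. z \<in> {x} \<Longrightarrow> u z = 1" "\<And>z. z \<notin> W \<Longrightarrow> u z = 0"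
    using cc0_bump[OF c(1) assms(2) c(2)] by blast
  then show ?thesis using that by auto
qed

lemma qcc_at: assumes "g \<in> \<A>" obtains f where "f \<in> qcc G" "f g = 1"
proof -
  have "g \<in> topspace T" using assms by simp
  then obtain U K h where U: "bisection G U" "g \<in> U" "U \<subseteq> topspace T" "compactin T K" "K \<subseteq> U"
    "continuous_map (subtopology T U) euclideanreal h" "\<And>k. 0 \<le> h k" "h g = 1" "\<And>k. k \<notin> K \<Longrightarrow> h k = 0"
    using bisection_bump[OF openin_topspace] by blast
  have "(\<lambda>k. complex_of_real (h k)) \<in> bcc G"
    by (rule bccI[OF U(1,5,4) continuous_map_of_real[OF U(6)]]) (simp add: U)
  then show ?thesis using that[of "\<lambda>k. complex_of_real (h k)"] U(8) bcc_qcc by simp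
qed

text \<open>Outside \<open>qcc G\<close>, \<open>to_cstar G\<close> has the junk value \<open>{}\<close>, which is not a Cauchy class.\<close>

lemma to_cstar_closed_imp_qcc:
  assumes "to_cstar G f \<in> acarrier Cst" shows "f \<in> qcc G"
proof -
  have "cauchy_rel NAlg `` {\<lambda>_. f} \<in> cauchy_seqs NAlg // cauchy_rel NAlg"
    using assms by (simp add: to_cstar_def to_completion_def cauchy_class_def groupoid_cstar_def completion_def)
  then have "cauchy_rel NAlg `` {\<lambda>_. f} \<noteq> {}"
    by (rule in_quotient_imp_non_empty[OF pre_cstar.equiv_cauchy_rel[OF NAlg_pre_cstar]])
  then have "(\<lambda>_::nat. f) \<in> cauchy_seqs NAlg" by (auto simp: cauchy_rel_def)
  then show ?thesis by (simp add: cauchy_seqs_def)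
qed

lemma openin_X0_units: "openin X0 (units G)"
  using openin_X0 units_open by blast

end

section \<open>Actors that induce isomorphisms\<close>

text \<open>Here \<Psi> is the induced map as an isomorphism onto the algebra itself instead of its
  copy in the multipliers, as supplied by \<open>multiplier_valued_hom\<close>. The final theorem
  derives \<open>actor_act_qcc\<close> from \<open>to_cstar_closed_imp_qcc\<close>.\<close>

locale iso_actor = G: etale_lc_groupoid G + H: etale_lc_groupoid H + actor G H anchor act
  for G :: "'g groupoid_data" and H :: "'h groupoid_data"
    and anchor :: "'h \<Rightarrow> 'g" and act :: "'g \<Rightarrow> 'h \<Rightarrow> 'h" +
  fixes \<Psi> :: "(nat \<Rightarrow> 'g \<Rightarrow> complex) set \<Rightarrow> (nat \<Rightarrow> 'h \<Rightarrow> complex) set"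
  assumes effective: "effective_groupoid G" and Hausdorff: "Hausdorff_groupoid G"
    and hom: "star_hom (groupoid_cstar G) (groupoid_cstar H) \<Psi>"
    and bij: "bij_betw \<Psi> (acarrier (groupoid_cstar G)) (acarrier (groupoid_cstar H))"
    and actor_act_qcc: "\<lbrakk>f \<in> qcc G; \<xi> \<in> qcc H\<rbrakk> \<Longrightarrow> actor_act G H anchor act f \<xi> \<in> qcc H"
    and Psi_mult: "\<lbrakk>f \<in> qcc G; \<xi> \<in> qcc H\<rbrakk> \<Longrightarrow>
      amult (groupoid_cstar H) (\<Psi> (to_cstar G f)) (to_cstar H \<xi>) = to_cstar H (actor_act G H anchor act f \<xi>)"
begin

abbreviation CG where "CG \<equiv> groupoid_cstar G"
abbreviation CH where "CH \<equiv> groupoid_cstar H"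

interpretation CG: cstar_alg CG by (rule G.Cst_cstar_alg)
interpretation CH: cstar_alg CH by (rule H.Cst_cstar_alg)

lemma Psi_closed [simp]: "X \<in> acarrier CG \<Longrightarrow> \<Psi> X \<in> acarrier CH"
  and Psi_add: "\<lbrakk>X \<in> acarrier CG; Y \<in> acarrier CG\<rbrakk> \<Longrightarrow> \<Psi> (aadd CG X Y) = aadd CH (\<Psi> X) (\<Psi> Y)"
  and Psi_scale: "X \<in> acarrier CG \<Longrightarrow> \<Psi> (ascale CG c X) = ascale CH c (\<Psi> X)"
  and Psi_mult_hom: "\<lbrakk>X \<in> acarrier CG; Y \<in> acarrier CG\<rbrakk> \<Longrightarrow> \<Psi> (amult CG X Y) = amult CH (\<Psi> X) (\<Psi> Y)"
  using hom by (auto simp: star_hom_def)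

lemma Psi_inj: "\<lbrakk>\<Psi> X = \<Psi> Y; X \<in> acarrier CG; Y \<in> acarrier CG\<rbrakk> \<Longrightarrow> X = Y"
  using bij by (auto simp: bij_betw_def inj_on_def)

lemma Psi_adist_le:
  assumes "X \<in> acarrier CG" "Y \<in> acarrier CG" shows "adist CH (\<Psi> X) (\<Psi> Y) \<le> adist CG X Y"
  using star_hom_contractive[OF G.Cst_cstar_alg cstar_alg.axioms(1)[OF H.Cst_cstar_alg] hom,
      of "aadd CG X (ascale CG (-1) Y)"]
    assms by (simp add: adist_def Psi_add Psi_scale)

text \<open>Automatic contractivity of \<Psi> is used here: formulas for coefficients of images of
  functions extend to all of \<open>CG\<close>.\<close>

lemma coef_Psi_limit:
  assumes "\<And>n. u n \<in> qcc G" "X \<in> acarrier CG" "(\<lambda>n. adist CG X (to_cstar G (u n))) \<longlonglongrightarrow> 0"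
  shows "(\<lambda>n. coef (\<Psi> (to_cstar G (u n))) h) \<longlonglongrightarrow> coef (\<Psi> X) h"
proof (rule H.coef_limit)
  show "(\<lambda>n. adist CH (\<Psi> X) (\<Psi> (to_cstar G (u n)))) \<longlonglongrightarrow> 0"
    by (rule null_squeeze[OF assms(3)]) (use assms(1,2) Psi_adist_le in auto)
qed (use assms in auto)

definition lift :: "('h \<Rightarrow> complex) \<Rightarrow> (nat \<Rightarrow> 'g \<Rightarrow> complex) set" where
  "lift \<xi> = inv_into (acarrier CG) \<Psi> (to_cstar H \<xi>)"

lemma lift:
  assumes "\<xi> \<in> qcc H" shows "lift \<xi> \<in> acarrier CG" "\<Psi> (lift \<xi>) = to_cstar H \<xi>"
proof -
  have "to_cstar H \<xi> \<in> \<Psi> ` acarrier CG" using bij assms by (simp add: bij_betw_def)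
  then show "lift \<xi> \<in> acarrier CG" "\<Psi> (lift \<xi>) = to_cstar H \<xi>"
    unfolding lift_def by (simp_all add: inv_into_into f_inv_into_f)
qed

lemma lift_unique: "\<lbrakk>\<xi> \<in> qcc H; X \<in> acarrier CG; \<Psi> X = to_cstar H \<xi>\<rbrakk> \<Longrightarrow> lift \<xi> = X"
  using lift Psi_inj by metis

lemma lift_add:
  "\<lbrakk>a \<in> qcc H; b \<in> qcc H\<rbrakk> \<Longrightarrow> lift (\<lambda>h. a h + b h) = aadd CG (lift a) (lift b)"
  by (rule lift_unique) (simp_all add: H.qcc_add lift Psi_add H.to_cstar_add)

lemma lift_scale: "a \<in> qcc H \<Longrightarrow> lift (\<lambda>h. c * a h) = ascale CG c (lift a)"
  by (rule lift_unique) (simp_all add: H.qcc_scale lift Psi_scale H.to_cstar_scale)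

lemma lift_mult: "\<lbrakk>a \<in> qcc H; b \<in> qcc H\<rbrakk> \<Longrightarrow> lift (convolution H a b) = amult CG (lift a) (lift b)"
  by (rule lift_unique) (simp_all add: H.qcc_convolution lift Psi_mult_hom H.to_cstar_mult)

section \<open>Rules for the action and coefficients of images under \<Psi>\<close>

lemma anchor_unit [simp]: "h \<in> arrows H \<Longrightarrow> anchor h \<in> units G"
  using continuous_map_image_subset_topspace[OF continuous_anchor] by auto

lemma act_in [simp]: "\<lbrakk>g \<in> arrows G; h \<in> arrows H; src G g = anchor h\<rbrakk> \<Longrightarrow> act g h \<in> arrows H"
  using continuous_map_image_subset_topspace[OF continuous_act] by force

lemma anchor_rng: "h \<in> arrows H \<Longrightarrow> anchor (rng H h) = anchor h"
  using anchor_comp[of "rng H h" h] by simp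

lemma act_anchor [simp]: "\<lbrakk>g \<in> arrows G; h \<in> arrows H; src G g = anchor h\<rbrakk> \<Longrightarrow> anchor (act g h) = rng G g"
  using anchor_act[of g h] by simp

lemma act_assoc: "\<lbrakk>g \<in> arrows G; k \<in> arrows G; h \<in> arrows H; src G g = rng G k; src G k = anchor h\<rbrakk>
    \<Longrightarrow> act (gcomp G g k) h = act g (act k h)"
  using act_comp[of g k h] by simp

lemma act_anchor_unit [simp]: "h \<in> arrows H \<Longrightarrow> act (anchor h) h = h"
  using act_unit[of h] by simp

lemma act_inv [simp]:
  "\<lbrakk>g \<in> arrows G; h \<in> arrows H; src G g = anchor h\<rbrakk> \<Longrightarrow> act (ginv G g) (act g h) = h"
  using act_assoc[of "ginv G g" g h] by simp

lemma act_inv' [simp]: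
  "\<lbrakk>g \<in> arrows G; h \<in> arrows H; rng G g = anchor h\<rbrakk> \<Longrightarrow> act g (act (ginv G g) h) = h"
  using act_assoc[of g "ginv G g" h] by simp

lemma actor_act_sum:
  assumes "h \<in> arrows H" "finite S" "S \<subseteq> {g \<in> arrows G. rng G g = anchor h}"
    "\<And>g. \<lbrakk>g \<in> arrows G; rng G g = anchor h; g \<notin> S\<rbrakk> \<Longrightarrow> f g = 0 \<or> \<xi> (act (ginv G g) h) = 0"
  shows "actor_act G H anchor act f \<xi> h = (\<Sum>g\<in>S. f g * \<xi> (act (ginv G g) h))"
  unfolding actor_act_def using assms anchor_rng
  by (simp, intro G.infsum_eq_finite_sum) auto

text \<open>Multiplying by a function \<open>u\<close> on objects that is 1 at the source of
  \<open>h\<close> keeps the coefficient at \<open>h\<close> and makes the formula for the actor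
  applicable. The surviving arrows are those that carry the source of \<open>h\<close> to
  \<open>h\<close>.\<close>

lemma coef_Psi:
  assumes f: "f \<in> qcc G" and h: "h \<in> arrows H"
  shows "coef (\<Psi> (to_cstar G f)) h
    = (\<Sum>g\<in>{g \<in> arrows G. rng G g = anchor h \<and> f g \<noteq> 0 \<and> act (ginv G g) h = src H h}. f g)"
proof -
  obtain u where u: "u \<in> cc0 H" "u (src H h) = 1" "\<And>y. y \<notin> units H \<Longrightarrow> u y = 0"
    using H.cc0_at[OF H.src_in_units[OF h] H.openin_X0_units] by blast
  let ?F = "{g \<in> arrows G. rng G g = anchor h \<and> f g \<noteq> 0}"
  have fin: "finite ?F" using G.qcc_fibre_finite[OF f] by (simp add: G.fibre_finite_def)
  have uq: "u \<in> qcc H" using u(1) by (rule H.cc0_qcc)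
  have "coef (\<Psi> (to_cstar G f)) h = coef (amult CH (\<Psi> (to_cstar G f)) (to_cstar H u)) h"
    using H.coef_mult_units[of "\<Psi> (to_cstar G f)" "to_cstar H u" h] f uq u h by simp
  also have "\<dots> = actor_act G H anchor act f u h"
    using Psi_mult[OF f uq] H.coef_to_cstar[OF actor_act_qcc[OF f uq]] by simp
  also have "\<dots> = (\<Sum>g\<in>?F. f g * u (act (ginv G g) h))"
    by (rule actor_act_sum[OF h fin]) auto
  also have "\<dots> = (\<Sum>g\<in>?F. if act (ginv G g) h = src H h then f g else 0)"
  proof (rule sum.cong[OF refl])
    fix g assume g: "g \<in> ?F"
    \<comment> \<open>The action preserves sources, so the translate of \<open>h\<close> is either
      its source or not a unit, and \<open>u\<close> vanishes off units.\<close>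
    have s: "src H (act (ginv G g) h) = src H h" using src_act[of "ginv G g" h] g h by simp
    have "u (act (ginv G g) h) = 0" if "act (ginv G g) h \<noteq> src H h"
    proof (rule u(3))
      show "act (ginv G g) h \<notin> units H" using s that H.src_unit by metis
    qed
    then show "f g * u (act (ginv G g) h) = (if act (ginv G g) h = src H h then f g else 0)"
      using u(2) by auto
  qed
  also have "\<dots> = (\<Sum>g\<in>{g \<in> ?F. act (ginv G g) h = src H h}. f g)"
    using sum.inter_filter[OF fin, of f "\<lambda>g. act (ginv G g) h = src H h"] by simp
  finally show ?thesis by (simp add: conj_assoc)
qed

section \<open>Properness of the map on objects\<close>

definition pull :: "('g \<Rightarrow> complex) \<Rightarrow> 'h \<Rightarrow> complex" where
  "pull f h = (if h \<in> units H then f (anchor h) else 0)"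

lemma coef_Psi_cc0:
  assumes f: "f \<in> cc0 G" shows "coef (\<Psi> (to_cstar G f)) = pull f"
proof
  fix h show "coef (\<Psi> (to_cstar G f)) h = pull f h"
  proof (cases "h \<in> arrows H")
    case h: True
    have eq: "{g \<in> arrows G. rng G g = anchor h \<and> f g \<noteq> 0 \<and> act (ginv G g) h = src H h}
        = (if h \<in> units H \<and> f (anchor h) \<noteq> 0 then {anchor h} else {})" (is "?S = ?R")
    proof (intro equalityI subsetI)
      fix g assume g: "g \<in> ?S"
      then have gu: "g \<in> units G" using G.cc0_zero[OF f] by blast
      then have ga: "g = anchor h" using g G.rng_unit[OF gu] by simp
      then have "h = src H h" using g gu h by simp
      then have "h \<in> units H" using h H.src_in_units by metis
      then show "g \<in> ?R" using g ga by simp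
    next
      fix g assume "g \<in> ?R"
      then have "h \<in> units H" "f (anchor h) \<noteq> 0" "g = anchor h" by (auto split: if_splits)
      then show "g \<in> ?S" using h anchor_unit[OF h] by simp
    qed
    show ?thesis using coef_Psi[OF G.cc0_qcc[OF f] h] unfolding eq by (auto simp: pull_def)
  next
    case False
    then show ?thesis using H.coef_zero_off[OF Psi_closed[OF G.to_cstar_closed[OF G.cc0_qcc[OF f]]]]
      by (auto simp: pull_def)
  qed
qed

lemma anchor_cont_units: "continuous_map (unit_top H) (unit_top G) anchor"
  using continuous_map_from_subtopology[OF continuous_anchor, of "units H"] by (simp add: unit_top_def)

text \<open>As \<Psi> of \<open>f\<close> lies in the algebra and not only in its multipliers, some
  function \<xi> approximates it within 1. Its coefficient at objects over \<open>K\<close> is 1, so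
  \<xi> is non-zero there, and such objects stay in a compact set.\<close>

lemma anchor_proper:
  assumes K: "compactin (unit_top G) K" shows "compactin (unit_top H) {y \<in> units H. anchor y \<in> K}"
proof -
  obtain f where f: "f \<in> cc0 G" "\<And>x. x \<in> K \<Longrightarrow> f x = 1" "\<And>x. x \<notin> units G \<Longrightarrow> f x = 0"
    using G.cc0_bump[OF K G.openin_X0_units] compactin_subset_topspace[OF K] by auto
  have c: "\<Psi> (to_cstar G f) \<in> acarrier CH" using f(1) G.cc0_qcc by simp
  obtain \<xi> where \<xi>: "\<xi> \<in> qcc H" "adist CH (\<Psi> (to_cstar G f)) (to_cstar H \<xi>) < 1"
    using H.Cst_dense[OF c zero_less_one] by blast
  obtain L where L: "compactin (unit_top H) L" "\<And>h. \<xi> h \<noteq> 0 \<Longrightarrow> rng H h \<in> L"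
    using H.qcc_compact_range[OF \<xi>(1)] by blast
  have "{y \<in> units H. anchor y \<in> K} \<subseteq> L"
  proof
    fix y assume y: "y \<in> {y \<in> units H. anchor y \<in> K}"
    have "cmod (pull f y - \<xi> y) < 1"
      using H.coef_diff_le[OF c H.to_cstar_closed[OF \<xi>(1)], of y] \<xi> coef_Psi_cc0[OF f(1)] by simp
    moreover have "pull f y = 1" using y f(2) by (simp add: pull_def)
    ultimately have "\<xi> y \<noteq> 0" by auto
    then show "y \<in> L" using L(2) y by fastforce
  qed
  moreover have "closedin (unit_top H) {y \<in> units H. anchor y \<in> K}"
    using closedin_continuous_map_preimage[OF anchor_cont_units G.compact_X0_closed[OF K]] by simp
  ultimately show ?thesis using L(1) closed_compactin by blast
qed

lemma pull_cc0: assumes f: "f \<in> cc0 G" shows "pull f \<in> cc0 H"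
proof -
  obtain K where K: "continuous_map (unit_top G) euclidean f" "compactin (unit_top G) K" "\<And>x. x \<notin> K \<Longrightarrow> f x = 0"
    using f unfolding cc0_def by blast
  have "continuous_map (unit_top H) euclidean (pull f)"
    by (rule continuous_map_eq[OF continuous_map_compose[OF anchor_cont_units K(1)]]) (simp add: pull_def)
  moreover have "pull f y = 0" if "y \<notin> {y \<in> units H. anchor y \<in> K}" for y
    using that K(3) by (auto simp: pull_def)
  ultimately show ?thesis unfolding cc0_def using anchor_proper[OF K(2)] by blast
qed

text \<open>On functions \<xi> both sides multiply by \<open>f (anchor h)\<close>, and these
  products determine an element. The equality of coefficients in \<open>coef_Psi_cc0\<close> would
  not determine it.\<close>

lemma Psi_cc0: assumes f: "f \<in> cc0 G" shows "\<Psi> (to_cstar G f) = to_cstar H (pull f)"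
proof (rule H.Cst_left_cancel)
  have fq: "f \<in> qcc G" using f by (rule G.cc0_qcc)
  have pq: "pull f \<in> qcc H" using pull_cc0[OF f] by (rule H.cc0_qcc)
  show "\<Psi> (to_cstar G f) \<in> acarrier CH" "to_cstar H (pull f) \<in> acarrier CH" using fq pq by auto
  fix \<xi> assume \<xi>: "\<xi> \<in> qcc H"
  have "actor_act G H anchor act f \<xi> = convolution H (pull f) \<xi>"
  proof
    fix h show "actor_act G H anchor act f \<xi> h = convolution H (pull f) \<xi> h"
    proof (cases "h \<in> arrows H")
      case h: True
      have "actor_act G H anchor act f \<xi> h = (\<Sum>g\<in>{anchor h}. f g * \<xi> (act (ginv G g) h))"
      proof (rule actor_act_sum[OF h])
        fix g assume g: "g \<in> arrows G" "rng G g = anchor h" "g \<notin> {anchor h}"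
        have "g \<notin> units G" using g G.rng_unit by auto
        then show "f g = 0 \<or> \<xi> (act (ginv G g) h) = 0" using G.cc0_zero[OF f] by blast
      qed (use anchor_unit[OF h] in auto)
      also have "\<dots> = f (anchor h) * \<xi> h" using anchor_unit[OF h] h by simp
      also have "\<dots> = convolution H (pull f) \<xi> h"
        using h by (simp add: H.cc0_convolution(1)[OF pull_cc0[OF f]] pull_def anchor_rng)
      finally show ?thesis .
    qed (simp add: actor_act_def)
  qed
  then show "amult CH (\<Psi> (to_cstar G f)) (to_cstar H \<xi>) = amult CH (to_cstar H (pull f)) (to_cstar H \<xi>)"
    using Psi_mult[OF fq \<xi>] H.to_cstar_mult[OF pq \<xi>] by simp
qed

lemma lift_pull: "f \<in> cc0 G \<Longrightarrow> lift (pull f) = to_cstar G f"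
  by (rule lift_unique) (simp_all add: Psi_cc0 pull_cc0 H.cc0_qcc G.cc0_qcc)

section \<open>Characters of the functions on objects of \<open>H\<close>\<close>

definition D :: "('h \<Rightarrow> complex) \<Rightarrow> 'g \<Rightarrow> complex" where "D b = coef (lift b)"

lemma D_pull: "f \<in> cc0 G \<Longrightarrow> D (pull f) = f"
  by (simp add: D_def lift_pull G.cc0_qcc)

text \<open>\<open>lift b\<close> commutes with \<open>C\<^sub>0(G\<^sup>0)\<close>, so its coefficient function lives on an open subset of
  the isotropy bundle.\<close>

lemma D_units: assumes b: "b \<in> cc0 H" and g: "g \<notin> units G" shows "D b g = 0"
proof -
  have bq: "b \<in> qcc H" using b by (rule H.cc0_qcc)
  \<comment> \<open>If range and source of \<open>k\<close> differ, some \<open>f\<close> is 1 at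
    the range and 0 at the source; comparing coefficients of the two products with \<open>f\<close>
    at \<open>k\<close> gives \<open>D b k = 0\<close>.\<close>
  have iso: "rng G k = src G k" if k: "k \<in> arrows G" "D b k \<noteq> 0" for k
  proof (rule ccontr)
    assume "rng G k \<noteq> src G k"
    then obtain f where f: "f \<in> cc0 G" "f (rng G k) = 1" "f (src G k) = 0"
      using G.cc0_separate[of "rng G k" "src G k"] k(1) by auto
    have fq: "f \<in> qcc G" and pq: "pull f \<in> qcc H"
      using f(1) pull_cc0 G.cc0_qcc H.cc0_qcc by auto
    have "convolution H (pull f) b = convolution H b (pull f)"
      using H.cc0_convolution_cc0[OF pull_cc0[OF f(1)] b] H.cc0_convolution_cc0[OF b pull_cc0[OF f(1)]]
      by (simp add: mult.commute)
    then have com: "amult CG (to_cstar G f) (lift b) = amult CG (lift b) (to_cstar G f)"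
      using lift_mult[OF pq bq] lift_mult[OF bq pq] lift_pull[OF f(1)] by simp
    have z: "coef (to_cstar G f) x = 0" if "x \<notin> units G" for x
      using G.cc0_zero[OF f(1) that] fq by simp
    have "f (rng G k) * D b k = D b k * f (src G k)"
      using arg_cong[OF com, of "\<lambda>X. coef X k"] fq
      by (simp add: G.coef_units_mult[OF _ lift(1)[OF bq] z k(1)] G.coef_mult_units[OF lift(1)[OF bq] _ z k(1)] D_def)
    then show False using f k by simp
  qed
  let ?V = "{k \<in> arrows G. D b k \<noteq> 0}"
  have "openin (arrtop G) ?V"
    unfolding D_def by (rule G.coef_nonzero_open[OF Hausdorff lift(1)[OF bq]])
  moreover have "?V \<subseteq> {k \<in> arrows G. rng G k = src G k}" using iso by auto
  ultimately have "?V \<subseteq> units G"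
    using effective interior_of_maximal unfolding effective_groupoid_def by blast
  then show ?thesis
    using g G.coef_zero_off[OF lift(1)[OF bq], of g] unfolding D_def by blast
qed

lemma D_add: "\<lbrakk>a \<in> cc0 H; b \<in> cc0 H\<rbrakk> \<Longrightarrow> D (\<lambda>h. a h + b h) g = D a g + D b g"
  using H.cc0_qcc by (simp add: D_def lift_add lift(1) G.coef_add)

lemma D_scale: "a \<in> cc0 H \<Longrightarrow> D (\<lambda>h. c * a h) g = c * D a g"
  using H.cc0_qcc by (simp add: D_def lift_scale lift(1) G.coef_scale)

text \<open>Taking coefficients at units is not multiplicative in general; it is here because the
  coefficients of \<open>lift b\<close> live on units.\<close>

lemma D_mult:
  assumes "a \<in> cc0 H" "b \<in> cc0 H" "x \<in> units G" shows "D (\<lambda>h. a h * b h) x = D a x * D b x"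
proof -
  have q: "a \<in> qcc H" "b \<in> qcc H" using assms H.cc0_qcc by auto
  have "D (\<lambda>h. a h * b h) x = coef (amult CG (lift a) (lift b)) x"
    using lift_mult[OF q] H.cc0_convolution_cc0[OF assms(1,2)] by (simp add: D_def)
  also have "\<dots> = D a x * D b x"
    using G.coef_mult_units[OF lift(1)[OF q(1)] lift(1)[OF q(2)] _, of x] D_units[OF assms(2)] assms(3)
    by (simp add: D_def)
  finally show ?thesis .
qed

lemma cc0_add: "\<lbrakk>a \<in> cc0 H; b \<in> cc0 H\<rbrakk> \<Longrightarrow> (\<lambda>h. a h + b h) \<in> cc0 H"
proof -
  assume "a \<in> cc0 H" "b \<in> cc0 H"
  then obtain K L where *: "continuous_map (unit_top H) euclidean a" "compactin (unit_top H) K" "\<And>x. x \<notin> K \<Longrightarrow> a x = 0"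
    "continuous_map (unit_top H) euclidean b" "compactin (unit_top H) L" "\<And>x. x \<notin> L \<Longrightarrow> b x = 0"
    unfolding cc0_def by blast
  have "a x + b x = 0" if "x \<notin> K \<union> L" for x using *(3)[of x] *(6)[of x] that by simp
  moreover have "compactin (unit_top H) (K \<union> L)" using *(2,5) by (rule compactin_Un)
  ultimately show ?thesis unfolding cc0_def using continuous_map_add[OF *(1,4)] by blast
qed

lemma cc0_mult_cont:
  assumes "a \<in> cc0 H" "continuous_map (unit_top H) euclidean c"
  shows "(\<lambda>h. c h * a h) \<in> cc0 H"
  using assms unfolding cc0_def by (auto intro!: continuous_map_complex_mult)

text \<open>A character of \<open>C\<^sub>c(H\<^sup>0)\<close> is a point evaluation: otherwise a partition of unity argument
  would put the whole algebra into its kernel.\<close>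

lemma D_point:
  assumes x: "x \<in> units G"
  obtains y where "y \<in> units H" "\<And>b. b \<in> cc0 H \<Longrightarrow> D b x = b y"
proof -
  obtain f where f: "f \<in> cc0 G" "f x = 1" "\<And>y. y \<notin> units G \<Longrightarrow> f y = 0"
    using G.cc0_at[OF x G.openin_X0_units] by blast
  define c where "c = pull f"
  have c: "c \<in> cc0 H" "D c x = 1" using f by (auto simp: c_def pull_cc0 D_pull)
  obtain K where K: "continuous_map (unit_top H) euclidean c" "compactin (unit_top H) K" "\<And>x. x \<notin> K \<Longrightarrow> c x = 0"
    using c(1) unfolding cc0_def by blast
  have KH: "K \<subseteq> units H" using compactin_subset_topspace[OF K(2)] by simp
  \<comment> \<open>It suffices to find a point of \<open>K\<close> at which the whole kernel of the
    character vanishes: evaluation there is then a multiple of the character.\<close>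
  have "\<exists>y\<in>K. \<forall>b\<in>cc0 H. D b x = 0 \<longrightarrow> b y = 0"
  proof (rule ccontr)
    assume "\<not> ?thesis"
    then have "\<exists>b. b \<in> cc0 H \<and> D b x = 0 \<and> b y \<noteq> 0" if "y \<in> K" for y using that by blast
    then obtain b where b: "\<And>y. y \<in> K \<Longrightarrow> b y \<in> cc0 H \<and> D (b y) x = 0 \<and> b y y \<noteq> 0" by metis
    define e where "e y h = complex_of_real ((cmod (b y h))\<^sup>2)" for y h
    have e_eq: "e y = (\<lambda>h. cnj (b y h) * b y h)" for y
      unfolding e_def by (simp only: complex_norm_square mult.commute)
    have bcont: "continuous_map (unit_top H) euclidean (b y)" if "y \<in> K" for y
      using b[OF that] by (auto simp: cc0_def)
    have cb: "(\<lambda>h. cnj (b y h)) \<in> cc0 H" if "y \<in> K" for y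
      using b[OF that] unfolding cc0_def by (auto intro!: continuous_map_cnj)
    have e: "e y \<in> cc0 H" "D (e y) x = 0" if y: "y \<in> K" for y
      using cc0_mult_cont[of "b y" "\<lambda>h. cnj (b y h)"] b[OF y] continuous_map_cnj[OF bcont[OF y]]
        D_mult[OF cb[OF y], of "b y" x] x by (auto simp: e_eq)
    define Op where "Op y = {h \<in> units H. b y h \<noteq> 0}" for y
    have Op: "openin (unit_top H) (Op y)" if "y \<in> K" for y
    proof -
      have "openin (unit_top H) {h \<in> topspace (unit_top H). b y h \<in> - {0}}"
        by (rule openin_continuous_map_preimage[OF bcont[OF that]]) (simp add: open_Compl)
      then show ?thesis by (simp add: Op_def)
    qed
    have "\<exists>\<F>. finite \<F> \<and> \<F> \<subseteq> Op ` K \<and> K \<subseteq> \<Union>\<F>"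
    proof (rule compactinD[OF K(2)])
      show "K \<subseteq> \<Union>(Op ` K)" using b KH by (auto simp: Op_def)
    qed (use Op in blast)
    then obtain J where J: "finite J" "J \<subseteq> K" "K \<subseteq> (\<Union>y\<in>J. Op y)" by (metis finite_subset_image)
    define E where "E h = (\<Sum>y\<in>J. (cmod (b y h))\<^sup>2)" for h
    have Ecc: "(\<lambda>h. \<Sum>y\<in>I. e y h) \<in> cc0 H \<and> D (\<lambda>h. \<Sum>y\<in>I. e y h) x = 0" if "finite I" "I \<subseteq> K" for I
      using that
    proof (induction rule: finite_induct)
      case empty
      have z: "(\<lambda>h. 0) \<in> cc0 H" unfolding cc0_def by (auto intro!: exI[of _ "{}"])
      then show ?case using D_scale[OF z, of 0 x] by simp
    next
      case (insert y I)
      then show ?case using e[of y] cc0_add[of "e y"] D_add[of "e y" "\<lambda>h. \<Sum>y\<in>I. e y h" x] by simp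
    qed
    have Epos: "0 < E h" if h: "h \<in> K" for h
    proof -
      obtain y where y: "y \<in> J" "h \<in> Op y" using J(3) h by blast
      have "(cmod (b y h))\<^sup>2 \<le> E h" unfolding E_def using J y by (intro member_le_sum) auto
      moreover have "0 < (cmod (b y h))\<^sup>2" using y by (simp add: Op_def)
      ultimately show ?thesis by linarith
    qed
    have Econt: "continuous_map (unit_top H) euclideanreal E"
      unfolding E_def power2_eq_square using J
      by (intro continuous_map_sum continuous_map_real_mult continuous_map_norm bcont) auto
    \<comment> \<open>Then \<open>c\<close> is the product of \<open>w\<close> with the sum of the
      \<open>e y\<close>, and this sum is in the kernel, although \<open>D c x = 1\<close>.\<close>
    define w where "w h = complex_of_real (1 / E h) * c h" for h
    have "continuous_map (unit_top H) euclidean w"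
    proof (rule continuous_map_extend_zero[of _ "{h \<in> topspace (unit_top H). E h \<in> {0<..}}" K])
      show "openin (unit_top H) {h \<in> topspace (unit_top H). E h \<in> {0<..}}"
        by (rule openin_continuous_map_preimage[OF Econt]) simp
      show "continuous_map (subtopology (unit_top H) {h \<in> topspace (unit_top H). E h \<in> {0<..}}) euclidean w"
        unfolding w_def
        by (intro continuous_map_complex_mult continuous_map_of_real continuous_map_real_divide
            continuous_map_from_subtopology[OF K(1)] continuous_map_from_subtopology[OF Econt]) auto
    qed (use K H.compact_X0_closed[OF K(2)] KH Epos in \<open>auto simp: w_def\<close>)
    then have w: "w \<in> cc0 H" unfolding cc0_def using K by (auto simp: w_def)
    have "c = (\<lambda>h. w h * (\<Sum>y\<in>J. e y h))"
    proof
      fix h show "c h = w h * (\<Sum>y\<in>J. e y h)"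
      proof (cases "h \<in> K")
        case True
        have "(\<Sum>y\<in>J. e y h) = complex_of_real (E h)" by (simp add: e_def E_def)
        then show ?thesis using Epos[OF True] by (simp add: w_def)
      qed (simp add: w_def K)
    qed
    then have "D c x = D w x * D (\<lambda>h. \<Sum>y\<in>J. e y h) x" using D_mult[OF w _ x] Ecc[OF J(1,2)] by simp
    then show False using c(2) Ecc[OF J(1,2)] by simp
  qed
  then obtain y where y: "y \<in> K" "\<And>b. b \<in> cc0 H \<Longrightarrow> D b x = 0 \<Longrightarrow> b y = 0" by blast
  have yH: "y \<in> units H" using y(1) KH by blast
  \<comment> \<open>Since \<open>D c x = 1\<close>, subtracting \<open>D b x\<close> times
    \<open>c\<close> from \<open>b\<close> gives an element of the kernel.\<close>
  have ev: "b y = D b x * c y" if b: "b \<in> cc0 H" for b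
  proof -
    have m: "(\<lambda>h. (- D b x) * c h) \<in> cc0 H" using cc0_mult_cont[OF c(1), of "\<lambda>_. - D b x"] by simp
    have "D (\<lambda>h. b h + (- D b x) * c h) x = 0"
      using D_add[OF b m] D_scale[OF c(1), of "- D b x" x] c(2) by simp
    from y(2)[OF cc0_add[OF b m] this] show ?thesis by simp
  qed
  have "c y \<noteq> 0"
  proof
    assume "c y = 0"
    moreover obtain u where "u \<in> cc0 H" "u y = 1" "\<And>z. z \<notin> units H \<Longrightarrow> u z = 0"
      using H.cc0_at[OF yH H.openin_X0_units] by blast
    ultimately show False using ev[of u] by simp
  qed
  \<comment> \<open>Applied to the square of \<open>c\<close>, \<open>ev\<close> shows the non-zero
    factor \<open>c y\<close> to be idempotent, hence 1.\<close>
  moreover have "c y * c y = c y"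
    using ev[of "\<lambda>h. c h * c h"] D_mult[OF c(1) c(1) x] c cc0_mult_cont[OF c(1) K(1)] by simp
  ultimately have "c y = 1" by simp
  then show ?thesis using that[OF yH] ev by simp
qed

section \<open>The section of the map on objects\<close>

definition \<sigma> :: "'g \<Rightarrow> 'h" where
  "\<sigma> x = (SOME y. y \<in> units H \<and> (\<forall>b\<in>cc0 H. D b x = b y))"

lemma sigma:
  assumes x: "x \<in> units G" shows "\<sigma> x \<in> units H" "\<And>b. b \<in> cc0 H \<Longrightarrow> D b x = b (\<sigma> x)"
proof -
  obtain y where "y \<in> units H" "\<And>b. b \<in> cc0 H \<Longrightarrow> D b x = b y" using D_point[OF x] by blast
  then have "\<exists>y. y \<in> units H \<and> (\<forall>b\<in>cc0 H. D b x = b y)" by blast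
  from someI_ex[OF this] show "\<sigma> x \<in> units H" "\<And>b. b \<in> cc0 H \<Longrightarrow> D b x = b (\<sigma> x)"
    unfolding \<sigma>_def by auto
qed

text \<open>The character at \<open>x\<close> sends \<open>pull f\<close> both to \<open>f x\<close>
  and to \<open>f (anchor (\<sigma> x))\<close>, and functions in \<open>cc0 G\<close> separate
  objects.\<close>

lemma anchor_sigma [simp]: assumes x: "x \<in> units G" shows "anchor (\<sigma> x) = x"
proof (rule ccontr)
  assume ne: "anchor (\<sigma> x) \<noteq> x"
  have "anchor (\<sigma> x) \<in> units G" using sigma(1)[OF x] by simp
  then obtain f where f: "f \<in> cc0 G" "f x = 1" "f (anchor (\<sigma> x)) = 0"
    using G.cc0_separate[OF x _ ne[symmetric]] by blast
  have "f x = f (anchor (\<sigma> x))"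
    using sigma(2)[OF x pull_cc0[OF f(1)]] D_pull[OF f(1)] sigma(1)[OF x] by (simp add: pull_def)
  then show False using f by simp
qed

text \<open>On objects \<open>D b z = b (\<sigma> z)\<close>, so \<sigma> maps the open set where
  \<open>D b\<close> is non-zero into \<open>W\<close> if \<open>b\<close> vanishes off
  \<open>W\<close>.\<close>

lemma sigma_cont: "continuous_map (unit_top G) (unit_top H) \<sigma>"
  unfolding continuous_map_def
proof (intro conjI allI impI)
  show "\<sigma> \<in> topspace (unit_top G) \<rightarrow> topspace (unit_top H)" using sigma(1) by simp
  fix W assume W: "openin (unit_top H) W"
  show "openin (unit_top G) {x \<in> topspace (unit_top G). \<sigma> x \<in> W}"
  proof (subst openin_subopen, clarify)
    fix x assume x: "x \<in> topspace (unit_top G)" "\<sigma> x \<in> W"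
    then have xu: "x \<in> units G" by simp
    obtain b where b: "b \<in> cc0 H" "b (\<sigma> x) = 1" "\<And>y. y \<notin> W \<Longrightarrow> b y = 0"
      using H.cc0_at[OF x(2) W] by blast
    let ?V = "{k \<in> arrows G. D b k \<noteq> 0}"
    have "openin (arrtop G) ?V"
      unfolding D_def by (rule G.coef_nonzero_open[OF Hausdorff lift(1)[OF H.cc0_qcc[OF b(1)]]])
    moreover have Vu: "?V \<subseteq> units G" using D_units[OF b(1)] by auto
    ultimately have "openin (unit_top G) ?V" by (simp add: G.openin_X0)
    moreover have "x \<in> ?V" using sigma(2)[OF xu b(1)] b(2) xu by simp
    moreover have "?V \<subseteq> {x \<in> topspace (unit_top G). \<sigma> x \<in> W}"
    proof
      fix z assume z: "z \<in> ?V"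
      then have "z \<in> units G" using Vu by blast
      then show "z \<in> {x \<in> topspace (unit_top G). \<sigma> x \<in> W}" using sigma(2)[of z b] b z by auto
    qed
    ultimately show "\<exists>V. openin (unit_top G) V \<and> x \<in> V \<and> V \<subseteq> {x \<in> topspace (unit_top G). \<sigma> x \<in> W}" by blast
  qed
qed

section \<open>The groupoid homomorphism\<close>

definition \<phi> :: "'g \<Rightarrow> 'h" where "\<phi> g = act g (\<sigma> (src G g))"

lemma sigma_unit [simp]: "x \<in> units G \<Longrightarrow> \<sigma> x \<in> units H"
  by (rule sigma(1))

lemma phi_in [simp]: "g \<in> arrows G \<Longrightarrow> \<phi> g \<in> arrows H"
  by (simp add: \<phi>_def)

lemma phi_src [simp]: "g \<in> arrows G \<Longrightarrow> src H (\<phi> g) = \<sigma> (src G g)"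
  by (simp add: \<phi>_def src_act)

lemma phi_anchor [simp]: "g \<in> arrows G \<Longrightarrow> anchor (\<phi> g) = rng G g"
  by (simp add: \<phi>_def)

lemma phi_unit [simp]: assumes "x \<in> units G" shows "\<phi> x = \<sigma> x"
proof -
  have "act x (\<sigma> x) = act (anchor (\<sigma> x)) (\<sigma> x)" using assms by simp
  also have "\<dots> = \<sigma> x" using sigma(1)[OF assms] by (intro act_anchor_unit) simp
  finally show ?thesis using assms by (simp add: \<phi>_def)
qed

lemma phi_cont: "continuous_map (arrtop G) (arrtop H) \<phi>"
proof -
  let ?E = "{(g, x). g \<in> arrows G \<and> x \<in> topspace (arrtop H) \<and> src G g = anchor x}"
  have "continuous_map (arrtop G) (unit_top H) (\<sigma> \<circ> src G)"
    by (rule continuous_map_compose[OF G.continuous_src sigma_cont])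
  then have "continuous_map (arrtop G) (arrtop H) (\<sigma> \<circ> src G)"
    unfolding unit_top_def by (rule continuous_map_into_fulltopology)
  then have "continuous_map (arrtop G) (prod_topology (arrtop G) (arrtop H)) (\<lambda>g. (id g, (\<sigma> \<circ> src G) g))"
    by (intro continuous_map_pairedI continuous_map_id)
  then have "continuous_map (arrtop G) (subtopology (prod_topology (arrtop G) (arrtop H)) ?E)
      (\<lambda>g. (id g, (\<sigma> \<circ> src G) g))"
    by (rule continuous_map_into_subtopology) auto
  from continuous_map_compose[OF this continuous_act] show ?thesis
    by (simp add: comp_def \<phi>_def[abs_def])
qed

text \<open>Effectiveness enters once more: the preimage of the units under \<open>\<phi>\<close> is an open set of
  isotropy arrows.\<close>

lemma phi_in_units_iff:
  assumes g: "g \<in> arrows G" shows "\<phi> g \<in> units H \<longleftrightarrow> g \<in> units G"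
proof
  let ?V = "{k \<in> arrows G. \<phi> k \<in> units H}"
  have "openin (arrtop G) ?V"
    using openin_continuous_map_preimage[OF phi_cont H.units_open] by simp
  moreover have "?V \<subseteq> {k \<in> arrows G. rng G k = src G k}"
  proof
    fix k assume k: "k \<in> ?V"
    then have "\<phi> k = \<sigma> (src G k)" using phi_src[of k] H.src_unit by fastforce
    then have "rng G k = src G k" using phi_anchor[of k] k by simp
    then show "k \<in> {k \<in> arrows G. rng G k = src G k}" using k by simp
  qed
  ultimately have V: "?V \<subseteq> units G"
    using effective interior_of_maximal unfolding effective_groupoid_def by blast
  assume "\<phi> g \<in> units H"
  then show "g \<in> units G" using V g by blast
qed simp

lemma act_inv_phi:
  assumes "k \<in> arrows G" "g \<in> arrows G" "rng G k = rng G g"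
  shows "act (ginv G k) (\<phi> g) = \<phi> (gcomp G (ginv G k) g)"
  using assms act_assoc[of "ginv G k" g "\<sigma> (src G g)"] by (simp add: \<phi>_def)

text \<open>A form of freeness of the action: it yields injectivity of \<phi> and leaves one term of
  the sum in \<open>coef_phi\<close>.\<close>

lemma act_inv_phi_unit_iff:
  assumes "k \<in> arrows G" "g \<in> arrows G" "rng G k = rng G g"
  shows "act (ginv G k) (\<phi> g) \<in> units H \<longleftrightarrow> k = g"
  using assms by (simp add: act_inv_phi phi_in_units_iff G.inv_comp_unit_iff)

lemma phi_inj: "inj_on \<phi> (arrows G)"
proof (rule inj_onI)
  fix g k assume gk: "g \<in> arrows G" "k \<in> arrows G" "\<phi> g = \<phi> k"
  have r: "rng G k = rng G g" using phi_anchor[OF gk(1)] phi_anchor[OF gk(2)] gk(3) by simp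
  have "act (ginv G k) (\<phi> k) \<in> units H" using act_inv_phi_unit_iff[OF gk(2,2)] by blast
  then have "k = g" using act_inv_phi_unit_iff[OF gk(2,1) r] by (simp only: gk(3))
  then show "g = k" by simp
qed

text \<open>At \<open>\<phi> g\<close> the sum in \<open>coef_Psi\<close> reduces to the term
  \<open>k = g\<close>, and limits extend this to all \<open>X\<close>. Hence the coefficients of a
  lift are values along \<phi>.\<close>

lemma coef_phi:
  assumes X: "X \<in> acarrier CG" and g: "g \<in> arrows G"
  shows "coef (\<Psi> X) (\<phi> g) = coef X g"
proof -
  have q: "coef (\<Psi> (to_cstar G f)) (\<phi> g) = f g" if f: "f \<in> qcc G" for f
  proof -
    have "{k \<in> arrows G. rng G k = anchor (\<phi> g) \<and> f k \<noteq> 0 \<and> act (ginv G k) (\<phi> g) = src H (\<phi> g)}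
        = (if f g = 0 then {} else {g})" (is "?S = ?R")
    proof (intro equalityI subsetI)
      fix k assume k: "k \<in> ?S"
      then have "act (ginv G k) (\<phi> g) \<in> units H" using g by simp
      then have "k = g" using act_inv_phi_unit_iff[of k g] k g by simp
      then show "k \<in> ?R" using k by simp
    next
      fix k assume "k \<in> ?R"
      then have "k = g" "f g \<noteq> 0" by (auto split: if_splits)
      then show "k \<in> ?S" using g act_inv_phi[OF g g] by simp
    qed
    then show ?thesis using coef_Psi[OF f phi_in[OF g]] by simp
  qed
  obtain u where u: "\<And>n. u n \<in> qcc G" "(\<lambda>n. adist CG X (to_cstar G (u n))) \<longlonglongrightarrow> 0"
    using G.Cst_sequence[OF X] by blast
  have "(\<lambda>n. coef (\<Psi> (to_cstar G (u n))) (\<phi> g)) \<longlonglongrightarrow> coef (\<Psi> X) (\<phi> g)"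
    using u X by (intro coef_Psi_limit)
  moreover have "(\<lambda>n. coef (to_cstar G (u n)) g) \<longlonglongrightarrow> coef X g"
    by (intro G.coef_limit X u(2)) (use u(1) in auto)
  ultimately show ?thesis using q[OF u(1)] u(1) LIMSEQ_unique by fastforce
qed

lemma coef_lift: "\<lbrakk>\<xi> \<in> qcc H; g \<in> arrows G\<rbrakk> \<Longrightarrow> coef (lift \<xi>) g = \<xi> (\<phi> g)"
  using coef_phi[of "lift \<xi>" g] by (simp add: lift)

text \<open>The action controls only anchor and source of \<open>\<phi> g\<close>. For the range, a
  function \<open>b\<close> on objects of \<open>H\<close> is used: it multiplies \<xi> by its value
  at the range of \<open>\<phi> g\<close>, and on lifts by \<open>D b\<close> at the range of
  \<open>g\<close>.\<close>

lemma phi_rng [simp]: assumes g: "g \<in> arrows G" shows "rng H (\<phi> g) = \<sigma> (rng G g)"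
proof (rule ccontr)
  assume "rng H (\<phi> g) \<noteq> \<sigma> (rng G g)"
  then obtain b where b: "b \<in> cc0 H" "b (rng H (\<phi> g)) = 1" "b (\<sigma> (rng G g)) = 0"
    using H.cc0_separate[of "rng H (\<phi> g)" "\<sigma> (rng G g)"] g by auto
  obtain \<xi> where \<xi>: "\<xi> \<in> qcc H" "\<xi> (\<phi> g) = 1" using H.qcc_at[OF phi_in[OF g]] by blast
  have bq: "b \<in> qcc H" using b(1) by (rule H.cc0_qcc)
  have z: "coef (lift b) x = 0" if "x \<notin> units G" for x using D_units[OF b(1) that] by (simp add: D_def)
  have "b (rng H (\<phi> g)) * \<xi> (\<phi> g) = coef (lift (convolution H b \<xi>)) g"
    using coef_lift[OF H.qcc_convolution[OF bq \<xi>(1)] g] g by (simp add: H.cc0_convolution(1)[OF b(1)])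
  also have "\<dots> = coef (lift b) (rng G g) * coef (lift \<xi>) g"
    unfolding lift_mult[OF bq \<xi>(1)] by (rule G.coef_units_mult) (use lift bq \<xi> z g in auto)
  also have "\<dots> = b (\<sigma> (rng G g)) * \<xi> (\<phi> g)"
    using sigma(2)[of "rng G g" b] b(1) g \<xi>(1) by (simp add: coef_lift D_def)
  finally show False using b \<xi> by simp
qed

text \<open>Since the action commutes with right translation, \<open>g\<close> acts on
  \<open>\<phi> k\<close> through its action on the range of \<open>\<phi> k\<close>, which is
  \<sigma> of the source of \<open>g\<close>.\<close>

lemma phi_comp:
  assumes "g \<in> arrows G" "k \<in> arrows G" "src G g = rng G k"
  shows "\<phi> (gcomp G g k) = gcomp H (\<phi> g) (\<phi> k)"
proof -
  have "\<phi> (gcomp G g k) = act g (\<phi> k)"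
    using assms act_assoc[of g k "\<sigma> (src G k)"] by (simp add: \<phi>_def)
  also have "\<dots> = act g (gcomp H (rng H (\<phi> k)) (\<phi> k))"
    by (simp only: H.comp_rng_left[OF phi_in[OF assms(2)]])
  also have "\<dots> = gcomp H (act g (rng H (\<phi> k))) (\<phi> k)"
    using assms by (intro act_comp_right) auto
  also have "act g (rng H (\<phi> k)) = \<phi> g" using assms by (simp add: \<phi>_def[of g])
  finally show ?thesis .
qed

lemma phi_inv [simp]: assumes "g \<in> arrows G" shows "\<phi> (ginv G g) = ginv H (\<phi> g)"
proof (rule H.inv_unique)
  have "gcomp H (\<phi> g) (\<phi> (ginv G g)) = \<phi> (gcomp G g (ginv G g))"
    using assms by (intro phi_comp[symmetric]) auto
  then show "gcomp H (\<phi> g) (\<phi> (ginv G g)) = rng H (\<phi> g)" using assms by simp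
qed (use assms in auto)

text \<open>If no arrow carried the source of \<open>h\<close> to \<open>h\<close>,
  \<open>coef_Psi\<close> would vanish at \<open>h\<close> for every function and, by continuity,
  for every element, against surjectivity of \<Psi>. By \<open>F\<close> the source of
  \<open>h\<close> is a value of \<sigma>, so \<phi> sends the arrow found to
  \<open>h\<close>.\<close>

lemma phi_image:
  assumes h: "h \<in> arrows H" and F: "\<sigma> (anchor (src H h)) = src H h"
  obtains g where "g \<in> arrows G" "\<phi> g = h"
proof -
  have "\<exists>g. g \<in> arrows G \<and> rng G g = anchor h \<and> act (ginv G g) h = src H h"
  proof (rule ccontr)
    assume none: "\<not> ?thesis"
    have q: "coef (\<Psi> (to_cstar G f)) h = 0" if "f \<in> qcc G" for f
    proof -
      have e: "{g \<in> arrows G. rng G g = anchor h \<and> f g \<noteq> 0 \<and> act (ginv G g) h = src H h} = {}"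
        using none by blast
      show ?thesis unfolding coef_Psi[OF that h] e by simp
    qed
    obtain \<xi> where \<xi>: "\<xi> \<in> qcc H" "\<xi> h = 1" using H.qcc_at[OF h] by blast
    note X = lift[OF \<xi>(1)]
    obtain u where u: "\<And>n. u n \<in> qcc G" "(\<lambda>n. adist CG (lift \<xi>) (to_cstar G (u n))) \<longlonglongrightarrow> 0"
      using G.Cst_sequence[OF X(1)] by blast
    have "(\<lambda>n. coef (\<Psi> (to_cstar G (u n))) h) \<longlonglongrightarrow> coef (\<Psi> (lift \<xi>)) h"
      using u X(1) by (intro coef_Psi_limit)
    then have "coef (\<Psi> (lift \<xi>)) h = 0" using q[OF u(1)] LIMSEQ_unique[OF _ tendsto_const] by fastforce
    then show False using X(2) \<xi> by simp
  qed
  then obtain g where g: "g \<in> arrows G" "rng G g = anchor h" "act (ginv G g) h = src H h" by blast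
  have "anchor (src H h) = src G g"
    using act_anchor[of "ginv G g" h] g h by simp
  then have "\<phi> g = act g (act (ginv G g) h)" using F g(3) by (simp add: \<phi>_def)
  then have "\<phi> g = h" using act_inv'[OF g(1) h g(2)] by simp
  then show ?thesis using that g(1) by blast
qed

section \<open>Restriction along the homomorphism\<close>

definition restr :: "('h \<Rightarrow> complex) \<Rightarrow> 'g \<Rightarrow> complex" where
  "restr \<xi> g = (if g \<in> arrows G then \<xi> (\<phi> g) else 0)"

lemma restr_bcc: assumes "b \<in> bcc H" shows "restr b \<in> bcc G"
proof -
  obtain U K where "bcc_on H b U K" using assms by (rule bccE)
  note U = bcc_onD[OF this]
  note UD = H.bisectionD[OF U(1)]
  let ?U = "{g \<in> arrows G. \<phi> g \<in> U}" and ?K = "{g \<in> arrows G. \<phi> g \<in> K}"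
  have "openin (arrtop G) ?U" using openin_continuous_map_preimage[OF phi_cont UD(1)] by simp
  then have bis: "bisection G ?U" unfolding bisection_def
  proof (intro conjI inj_onI)
    fix g k assume gk: "g \<in> ?U" "k \<in> ?U"
    show "g = k" if "rng G g = rng G k"
    proof -
      have "\<phi> g = \<phi> k" by (rule inj_onD[OF UD(2)]) (use gk that in auto)
      then show ?thesis using gk phi_inj by (auto simp: inj_on_def)
    qed
    show "g = k" if "src G g = src G k"
    proof -
      have "\<phi> g = \<phi> k" by (rule inj_onD[OF UD(3)]) (use gk that in auto)
      then show ?thesis using gk phi_inj by (auto simp: inj_on_def)
    qed
  qed
  \<comment> \<open>Compactness does not pass to preimages under \<phi> for free. The preimage of
    \<open>K\<close> is recovered from its sources \<open>L\<close>, a closed subset of the image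
    under \<open>anchor\<close> of a compact set.\<close>
  define L where "L = {x \<in> units G. \<sigma> x \<in> src H ` K}"
  have sK: "compactin (unit_top H) (src H ` K)" by (rule image_compactin[OF U(3) H.continuous_src])
  have "compactin (unit_top G) (anchor ` (src H ` K))" by (rule image_compactin[OF sK anchor_cont_units])
  moreover have "L \<subseteq> anchor ` (src H ` K)"
  proof
    fix x assume "x \<in> L"
    then have "x = anchor (\<sigma> x)" "\<sigma> x \<in> src H ` K" by (auto simp: L_def)
    then show "x \<in> anchor ` (src H ` K)" by (rule image_eqI)
  qed
  moreover have "closedin (unit_top G) L"
    using closedin_continuous_map_preimage[OF sigma_cont H.compact_X0_closed[OF sK]] by (simp add: L_def)
  ultimately have L: "compactin (unit_top G) L" by (rule closed_compactin)
  have LK: "\<exists>g\<in>?K. src G g = x" if xL: "x \<in> L" for x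
  proof -
    obtain h where h: "h \<in> K" "\<sigma> x = src H h" and x: "x \<in> units G" using xL by (auto simp: L_def)
    have hA: "h \<in> arrows H" using h(1) U(2) UD(4) by blast
    have "\<sigma> (anchor (src H h)) = src H h" using h(2)[symmetric] x by simp
    then obtain g where g: "g \<in> arrows G" "\<phi> g = h" using phi_image[OF hA] by blast
    have "\<sigma> (src G g) = \<sigma> x" using phi_src[OF g(1)] g(2) h(2) by simp
    then have "src G g = x" using anchor_sigma[of x] anchor_sigma[of "src G g"] x g(1) by simp
    then show ?thesis using g h by blast
  qed
  have "?K = inv_into ?U (src G) ` L"
  proof (intro equalityI subsetI)
    fix g assume g: "g \<in> ?K"
    then have gU: "g \<in> ?U" using U(2) by blast
    have "src G g \<in> L" using g phi_src[of g] by (auto simp: L_def intro!: image_eqI[of _ _ "\<phi> g"])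
    moreover have "g = inv_into ?U (src G) (src G g)"
      using gU by (simp add: inv_into_f_f[OF G.bisectionD(3)[OF bis]])
    ultimately show "g \<in> inv_into ?U (src G) ` L" by (rule rev_image_eqI)
  next
    fix g assume "g \<in> inv_into ?U (src G) ` L"
    then obtain x where x: "x \<in> L" "g = inv_into ?U (src G) x" by blast
    obtain k where k: "k \<in> ?K" "src G k = x" using LK[OF x(1)] by blast
    have kU: "k \<in> ?U" using k(1) U(2) by blast
    have "inv_into ?U (src G) (src G k) = k" by (rule inv_into_f_f[OF G.bisectionD(3)[OF bis] kU])
    then show "g \<in> ?K" using k x(2) by simp
  qed
  moreover have "compactin (subtopology (arrtop G) ?U) (inv_into ?U (src G) ` L)"
  proof (rule image_compactin[OF _ G.src_section_cont[OF bis]])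
    have "L \<subseteq> src G ` ?U"
    proof
      fix x assume "x \<in> L"
      then obtain g where "g \<in> ?K" "src G g = x" using LK by blast
      then show "x \<in> src G ` ?U" using U(2) by blast
    qed
    then show "compactin (subtopology (unit_top G) (src G ` ?U)) L" using L by (simp add: compactin_subtopology)
  qed
  ultimately have K: "compactin (arrtop G) ?K" by (simp add: compactin_subtopology)
  show ?thesis
  proof (rule bccI[OF bis _ K])
    have "continuous_map (subtopology (arrtop G) ?U) (subtopology (arrtop H) U) \<phi>"
      by (intro continuous_map_into_subtopology continuous_map_from_subtopology[OF phi_cont]) auto
    from continuous_map_compose[OF this U(4)]
    show "continuous_map (subtopology (arrtop G) ?U) euclidean (restr b)"
      by (rule continuous_map_eq) (simp add: restr_def)
  qed (use U in \<open>auto simp: restr_def\<close>)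
qed

lemma restr_add: "restr (\<lambda>h. a h + b h) = (\<lambda>g. restr a g + restr b g)"
  and restr_scale: "restr (\<lambda>h. c * a h) = (\<lambda>g. c * restr a g)"
  by (auto simp: restr_def fun_eq_iff)

lemma restr_qcc: "\<xi> \<in> qcc H \<Longrightarrow> restr \<xi> \<in> qcc G"
proof (induction rule: H.qcc_induct)
  case zero
  have "restr (\<lambda>_. 0) = (\<lambda>_. 0)" by (simp add: restr_def fun_eq_iff)
  then show ?case by simp
next
  case (step b f)
  then show ?case unfolding restr_add using restr_bcc G.bcc_qcc G.qcc_add by blast
qed

lemma restr_involution: "restr (involution H \<xi>) = involution G (restr \<xi>)"
  by (auto simp: restr_def involution_def fun_eq_iff)

text \<open>The whole range fibre of \<open>\<phi> g\<close> consists of values of \<phi>, so both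
  sums run over the same fibre, even before \<phi> is known to be surjective.\<close>

lemma restr_convolution: "restr (convolution H \<xi> \<eta>) = convolution G (restr \<xi>) (restr \<eta>)"
proof
  fix g show "restr (convolution H \<xi> \<eta>) g = convolution G (restr \<xi>) (restr \<eta>) g"
  proof (cases "g \<in> arrows G")
    case g: True
    let ?I = "{k \<in> arrows G. rng G k = rng G g}" and ?J = "{h \<in> arrows H. rng H h = rng H (\<phi> g)}"
    have bij: "bij_betw \<phi> ?I ?J"
    proof (rule bij_betw_imageI)
      show "inj_on \<phi> ?I" by (rule inj_on_subset[OF phi_inj]) auto
      show "\<phi> ` ?I = ?J"
      proof (intro equalityI subsetI)
        fix h assume h: "h \<in> ?J"
        have hA: "h \<in> arrows H" and r: "rng H h = \<sigma> (rng G g)" using h g by auto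
        \<comment> \<open>\<open>phi_image\<close> asks about the source, while here the range of
          \<open>h\<close> is known; it is applied to the inverse of \<open>h\<close>.\<close>
        have "\<sigma> (anchor (src H (ginv H h))) = src H (ginv H h)" using hA r g by simp
        then obtain k where k: "k \<in> arrows G" "\<phi> k = ginv H h" using phi_image[of "ginv H h"] hA by auto
        have hk: "\<phi> (ginv G k) = h" using k hA by simp
        have "rng G (ginv G k) = anchor h" using phi_anchor[of "ginv G k"] k(1) hk by simp
        also have "\<dots> = rng G g" using anchor_rng[OF hA] r g by simp
        finally have "ginv G k \<in> ?I" using k by simp
        then show "h \<in> \<phi> ` ?I" using hk by blast
      qed (use g in auto)
    qed
    have "restr (convolution H \<xi> \<eta>) g = (\<Sum>\<^sub>\<infinity>h\<in>?J. \<xi> h * \<eta> (gcomp H (ginv H h) (\<phi> g)))"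
      using g by (simp add: restr_def convolution_def)
    also have "\<dots> = (\<Sum>\<^sub>\<infinity>k\<in>?I. \<xi> (\<phi> k) * \<eta> (gcomp H (ginv H (\<phi> k)) (\<phi> g)))"
      by (rule infsum_reindex_bij_betw[OF bij, symmetric])
    also have "\<dots> = (\<Sum>\<^sub>\<infinity>k\<in>?I. restr \<xi> k * restr \<eta> (gcomp G (ginv G k) g))"
    proof (rule infsum_cong)
      fix k assume "k \<in> ?I"
      then have k: "k \<in> arrows G" "rng G k = rng G g" by auto
      have "\<phi> (gcomp G (ginv G k) g) = gcomp H (ginv H (\<phi> k)) (\<phi> g)"
        using k g phi_comp[of "ginv G k" g] by simp
      then show "\<xi> (\<phi> k) * \<eta> (gcomp H (ginv H (\<phi> k)) (\<phi> g)) = restr \<xi> k * restr \<eta> (gcomp G (ginv G k) g)"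
        using k g by (simp add: restr_def)
    qed
    also have "\<dots> = convolution G (restr \<xi>) (restr \<eta>) g" using g by (simp add: convolution_def)
    finally show ?thesis .
  qed (simp add: restr_def)
qed

text \<open>The maximal norm of \<open>G\<close> pulled back along \<open>restr\<close> is a
  competitor in the supremum that defines the maximal norm of \<open>H\<close>.\<close>

lemma restr_norm_le:
  assumes "\<xi> \<in> qcc H"
  shows "max_cstar_norm (conv_algebra G) (restr \<xi>) \<le> max_cstar_norm (conv_algebra H) \<xi>"
proof -
  interpret N: star_seminorm "conv_algebra G" "max_cstar_norm (conv_algebra G)"
    using G.Alg_star_alg G.max_norm_cstar by (rule star_alg.star_seminormI)
  have "cstar_seminorm (conv_algebra H) (\<lambda>\<xi>. max_cstar_norm (conv_algebra G) (restr \<xi>))"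
    unfolding cstar_seminorm_def
    using N.N_nonneg N.N_add N.N_scale N.N_mult N.N_star_mult
    by (simp add: restr_add restr_scale restr_convolution restr_involution restr_qcc)
  then show ?thesis using assms by (rule H.seminorm_le_max)
qed

text \<open>This is how \<open>restr\<close> inverts \<Psi>: the product of \<Psi> of
  \<open>f\<close> with \<xi> restricts to the convolution of \<open>f\<close> with the restriction
  of \<xi>.\<close>

lemma restr_actor_act:
  assumes f: "f \<in> qcc G" shows "restr (actor_act G H anchor act f \<xi>) = convolution G f (restr \<xi>)"
proof
  fix g show "restr (actor_act G H anchor act f \<xi>) g = convolution G f (restr \<xi>) g"
  proof (cases "g \<in> arrows G")
    case g: True
    let ?F = "{k \<in> arrows G. rng G k = rng G g \<and> f k \<noteq> 0}"
    have "finite ?F" using G.qcc_fibre_finite[OF f] by (simp add: G.fibre_finite_def)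
    then have "actor_act G H anchor act f \<xi> (\<phi> g) = (\<Sum>k\<in>?F. f k * \<xi> (act (ginv G k) (\<phi> g)))"
      by (intro actor_act_sum) (use g in auto)
    also have "\<dots> = (\<Sum>k\<in>?F. f k * restr \<xi> (gcomp G (ginv G k) g))"
      using g by (intro sum.cong refl) (auto simp: restr_def act_inv_phi)
    finally show ?thesis
      using g G.convolution_sum_supp[OF G.qcc_fibre_finite[OF f] g] by (simp add: restr_def)
  qed (simp add: restr_def)
qed

lemma restr_pull: assumes f: "f \<in> cc0 G" shows "restr (pull f) = f"
proof
  fix g show "restr (pull f) g = f g"
    using G.cc0_zero[OF f, of g] by (cases "g \<in> units G") (auto simp: restr_def pull_def phi_in_units_iff)
qed

text \<open>If \<open>b\<close> vanishes on the range of \<open>\<sigma>\<close>, then so does its restriction, and since restriction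
  is contractive and inverts \<open>\<Psi>\<close> on multiples of \<open>C\<^sub>c(G\<^sup>0)\<close>, this forces \<open>lift b = 0\<close>.\<close>

lemma sigma_anchor [simp]: assumes y: "y \<in> units H" shows "\<sigma> (anchor y) = y"
proof (rule ccontr)
  assume ne: "\<sigma> (anchor y) \<noteq> y"
  have "closedin (unit_top H) {z \<in> topspace (unit_top H). (\<sigma> \<circ> anchor) z = id z}"
    by (rule closedin_equalizer[OF H.Hausdorff_units continuous_map_compose[OF anchor_cont_units sigma_cont]
          continuous_map_id])
  then have W: "openin (unit_top H) (topspace (unit_top H) - {z \<in> topspace (unit_top H). (\<sigma> \<circ> anchor) z = id z})"
    by blast
  have "y \<in> topspace (unit_top H) - {z \<in> topspace (unit_top H). (\<sigma> \<circ> anchor) z = id z}" using y ne by simp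
  then obtain b where b: "b \<in> cc0 H" "b y = 1"
    "\<And>z. z \<notin> topspace (unit_top H) - {z \<in> topspace (unit_top H). (\<sigma> \<circ> anchor) z = id z} \<Longrightarrow> b z = 0"
    using H.cc0_at[OF _ W] by blast
  have b0: "b (\<sigma> x) = 0" if "x \<in> units G" for x using b(3)[of "\<sigma> x"] that by simp
  have "anchor y \<in> units G" using y by simp
  then obtain f where f: "f \<in> cc0 G" "f (anchor y) = 1" "\<And>x. x \<notin> units G \<Longrightarrow> f x = 0"
    using G.cc0_at[OF _ G.openin_X0_units] by blast
  \<comment> \<open>\<Psi> of a function is only known to lie in the completion; multiplying by this
    \<xi>, which is 1 at \<open>y\<close>, produces functions that can be restricted.\<close>
  define \<xi> where "\<xi> = pull f"
  have \<xi>c: "\<xi> \<in> cc0 H" using pull_cc0[OF f(1)] by (simp add: \<xi>_def)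
  have q: "b \<in> qcc H" "f \<in> qcc G" "\<xi> \<in> qcc H" using b(1) f(1) \<xi>c H.cc0_qcc G.cc0_qcc by auto
  define \<beta> where "\<beta> = convolution H b \<xi>"
  have \<beta>q: "\<beta> \<in> qcc H" unfolding \<beta>_def using q by (intro H.qcc_convolution)
  have \<beta>: "\<beta> z = b z * \<xi> z" for z using H.cc0_convolution_cc0[OF b(1) \<xi>c] by (simp add: \<beta>_def)
  have restr0: "restr \<beta> = (\<lambda>_. 0)"
  proof
    fix g show "restr \<beta> g = 0"
    proof (cases "g \<in> units G")
      case False
      then have "b (\<phi> g) = 0" if "g \<in> arrows G"
        using that H.cc0_zero[OF b(1)] phi_in_units_iff by blast
      then show ?thesis by (simp add: restr_def \<beta>)
    qed (simp add: restr_def \<beta> b0)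
  qed
  note X = lift[OF q(1)]
  let ?X = "lift b"
  obtain u where u: "\<And>n. u n \<in> qcc G" "(\<lambda>n. adist CG ?X (to_cstar G (u n))) \<longlonglongrightarrow> 0"
    using G.Cst_sequence[OF X(1)] by blast
  define \<eta> where "\<eta> n = actor_act G H anchor act (u n) \<xi>" for n
  have \<eta>q: "\<eta> n \<in> qcc H" for n unfolding \<eta>_def using actor_act_qcc u(1) q(3) by blast
  have uf: "convolution G (u n) f \<in> qcc G" for n using u(1) q(2) G.qcc_convolution by blast
  \<comment> \<open>As \<beta> restricts to zero, \<open>\<eta> n - \<beta>\<close> restricts to the
    convolution of \<open>u n\<close> and \<open>f\<close>. In \<open>CH\<close> it is the product
    of \<open>\<Psi> (u n - lift b)\<close> with \<xi>, whose norm tends to zero.\<close>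
  have le: "anorm CG (to_cstar G (convolution G (u n) f)) \<le> adist CG ?X (to_cstar G (u n)) * anorm CH (to_cstar H \<xi>)"
    for n
  proof -
    have diff: "(\<lambda>h. \<eta> n h + (-1) * \<beta> h) \<in> qcc H" using \<eta>q \<beta>q by (intro H.qcc_add H.qcc_scale)
    have "restr (\<lambda>h. \<eta> n h + (-1) * \<beta> h) = convolution G (u n) f"
      unfolding restr_add restr_scale restr0 \<eta>_def restr_actor_act[OF u(1)] \<xi>_def restr_pull[OF f(1)] by simp
    then have "max_cstar_norm (conv_algebra G) (convolution G (u n) f) \<le> adist (normed_conv_algebra H) (\<eta> n) \<beta>"
      using restr_norm_le[OF diff] by (simp add: adist_def)
    also have "\<dots> = adist CH (to_cstar H (\<eta> n)) (to_cstar H \<beta>)" using \<eta>q \<beta>q by (simp add: H.adist_to_cstar)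
    also have "\<dots> = adist CH (amult CH (\<Psi> (to_cstar G (u n))) (to_cstar H \<xi>)) (amult CH (\<Psi> ?X) (to_cstar H \<xi>))"
      using Psi_mult[OF u(1) q(3)] H.to_cstar_mult[OF q(1,3)] X(2) by (simp add: \<eta>_def \<beta>_def)
    also have "\<dots> \<le> adist CH (\<Psi> (to_cstar G (u n))) (\<Psi> ?X) * anorm CH (to_cstar H \<xi>)"
      using CH.adist_mult[of "\<Psi> (to_cstar G (u n))" "to_cstar H \<xi>" "\<Psi> ?X" "to_cstar H \<xi>"] X(1) u(1) q(3) by simp
    also have "\<dots> \<le> adist CG (to_cstar G (u n)) ?X * anorm CH (to_cstar H \<xi>)"
      using Psi_adist_le[of "to_cstar G (u n)" ?X] X(1) u(1) q(3) by (intro mult_right_mono) auto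
    also have "\<dots> = adist CG ?X (to_cstar G (u n)) * anorm CH (to_cstar H \<xi>)"
      using CG.adist_commute[of "to_cstar G (u n)" ?X] X(1) u(1) by simp
    finally show ?thesis
      using pre_cstar.to_completion_norm[OF G.NAlg_pre_cstar] uf by (simp add: to_cstar_def groupoid_cstar_def)
  qed
  \<comment> \<open>The same sequence tends to zero by \<open>le\<close> and to the product of
    \<open>lift b\<close> and \<open>f\<close> by continuity.\<close>
  have "amult CG ?X (to_cstar G f) = azero CG"
  proof (rule CG.limit_unique[of "\<lambda>n. to_cstar G (convolution G (u n) f)"])
    show "(\<lambda>n. adist CG (to_cstar G (convolution G (u n) f)) (azero CG)) \<longlonglongrightarrow> 0"
      by (rule null_squeeze[OF tendsto_mult_left_zero[OF u(2), of "anorm CH (to_cstar H \<xi>)"]])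
        (use le uf in \<open>auto simp: CG.adist_eq\<close>)
    show "(\<lambda>n. adist CG (to_cstar G (convolution G (u n) f)) (amult CG ?X (to_cstar G f))) \<longlonglongrightarrow> 0"
    proof (rule null_squeeze[OF tendsto_mult_left_zero[OF u(2), of "anorm CG (to_cstar G f)"]])
      fix n
      have "adist CG (to_cstar G (convolution G (u n) f)) (amult CG ?X (to_cstar G f))
          \<le> adist CG (to_cstar G (u n)) ?X * anorm CG (to_cstar G f)"
        using CG.adist_mult[of "to_cstar G (u n)" "to_cstar G f" ?X "to_cstar G f"] u(1) q(2) X(1)
        by (simp add: G.to_cstar_mult)
      then show "adist CG (to_cstar G (convolution G (u n) f)) (amult CG ?X (to_cstar G f))
          \<le> adist CG ?X (to_cstar G (u n)) * anorm CG (to_cstar G f)"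
        using CG.adist_commute[of "to_cstar G (u n)" ?X] X(1) u(1) by simp
    qed (use uf X(1) q(2) in auto)
  qed (use uf X(1) q(2) in auto)
  \<comment> \<open>Zero is written as a multiple by 0, so that \<open>Psi_scale\<close> and
    \<open>coef_scale\<close> evaluate its coefficient.\<close>
  also have "azero CG = ascale CG 0 (amult CG ?X (to_cstar G f))" using X(1) q(2) by simp
  finally have "coef (\<Psi> (amult CG ?X (to_cstar G f))) y = 0"
    using H.coef_scale[of "\<Psi> (amult CG ?X (to_cstar G f))" 0 y] X(1) q(2) Psi_scale[of "amult CG ?X (to_cstar G f)" 0]
    by simp
  moreover have "\<Psi> (amult CG ?X (to_cstar G f)) = to_cstar H \<beta>"
    using X q Psi_cc0[OF f(1)] by (simp add: Psi_mult_hom \<beta>_def \<xi>_def H.to_cstar_mult)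
  ultimately have "\<beta> y = 0" using \<beta>q by simp
  then show False using b(2) f(2) y by (simp add: \<beta> \<xi>_def pull_def)
qed

section \<open>Bijectivity and openness of \<phi>, and the form of the actor\<close>

lemma phi_surj: "\<phi> ` arrows G = arrows H"
proof (intro equalityI subsetI)
  fix h assume h: "h \<in> arrows H"
  then obtain g where "g \<in> arrows G" "\<phi> g = h" using phi_image[OF h] by auto
  then show "h \<in> \<phi> ` arrows G" by blast
qed auto

text \<open>Within a bisection of \<open>H\<close> an arrow is determined by its source, and on
  objects \<open>anchor\<close> is a continuous inverse of \<phi>; so arrows near
  \<open>\<phi> g\<close> are values of \<phi> on \<open>U\<close>.\<close>

lemma phi_open: "open_map (arrtop G) (arrtop H) \<phi>"
  unfolding open_map_def
proof (intro allI impI)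
  fix U assume U: "openin (arrtop G) U"
  show "openin (arrtop H) (\<phi> ` U)"
  proof (subst openin_subopen, clarify)
    fix g assume g: "g \<in> U"
    have UA: "U \<subseteq> arrows G" using U G.openin_T_arrows by blast
    have "\<phi> g \<in> topspace (arrtop H)" using g UA by auto
    then obtain B where B: "bisection H B" "\<phi> g \<in> B" "B \<subseteq> topspace (arrtop H)"
      using H.bisection_nbhd[OF openin_topspace] by blast
    note BD = H.bisectionD[OF B(1)]
    let ?V = "{k \<in> U. \<phi> k \<in> B}"
    let ?Y = "{y \<in> units H. anchor y \<in> src G ` ?V}"
    let ?W = "{h \<in> B. src H h \<in> ?Y}"
    have "openin (arrtop G) ?V" by (rule openin_continuous_map_preimage_gen[OF phi_cont U BD(1)])
    then have "openin (unit_top G) (src G ` ?V)" by (rule G.src_open)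
    then have "openin (unit_top H) ?Y"
      using openin_continuous_map_preimage[OF anchor_cont_units] by simp
    then have "openin (arrtop H) ?W"
      by (rule openin_continuous_map_preimage_gen[OF H.continuous_src BD(1)])
    moreover have "\<phi> g \<in> ?W" using g B(2) UA by auto
    moreover have "?W \<subseteq> \<phi> ` U"
    proof
      fix h assume h: "h \<in> ?W"
      then obtain k where k: "k \<in> U" "\<phi> k \<in> B" "anchor (src H h) = src G k" by auto
      have kA: "k \<in> arrows G" using k(1) UA by blast
      have "src H h = \<sigma> (anchor (src H h))" using h by simp
      also have "\<dots> = src H (\<phi> k)" using k(3) kA by simp
      finally have "h = \<phi> k" using h k(2) by (intro inj_onD[OF BD(3), of h "\<phi> k"]) auto
      then show "h \<in> \<phi> ` U" using k(1) by blast
    qed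
    ultimately show "\<exists>W. openin (arrtop H) W \<and> \<phi> g \<in> W \<and> W \<subseteq> \<phi> ` U" by blast
  qed
qed

lemma phi_iso: "topological_groupoid_iso G H \<phi>"
  unfolding topological_groupoid_iso_def
proof (intro conjI ballI impI)
  show "homeomorphic_map (arrtop G) (arrtop H) \<phi>"
    by (rule bijective_open_imp_homeomorphic_map[OF phi_cont phi_open]) (simp_all add: phi_surj phi_inj)
qed (auto simp: phi_comp)

lemma anchor_eq: assumes h: "h \<in> arrows H" shows "anchor h = inv_into (arrows G) \<phi> (rng H h)"
proof -
  have "\<phi> (anchor h) = \<sigma> (anchor (rng H h))" using anchor_unit[OF h] anchor_rng[OF h] by simp
  also have "\<dots> = rng H h" using h by simp
  finally show ?thesis using inv_into_f_f[OF phi_inj, of "anchor h"] anchor_unit[OF h] by simp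
qed

text \<open>Right translation reduces the action on \<open>h\<close> to the action on its range,
  which is \<sigma> of the source of \<open>g\<close> now that \<sigma> inverts the anchor on
  objects.\<close>

lemma act_eq:
  assumes "g \<in> arrows G" "h \<in> arrows H" "src G g = anchor h" shows "act g h = gcomp H (\<phi> g) h"
proof -
  have \<sigma>: "\<sigma> (src G g) = rng H h" using sigma_anchor[of "rng H h"] anchor_rng assms by simp
  have "act g h = act g (gcomp H (rng H h) h)" by (simp only: H.comp_rng_left[OF assms(2)])
  also have "\<dots> = gcomp H (act g (rng H h)) h"
    using assms anchor_rng by (intro act_comp_right) auto
  finally show ?thesis by (simp only: \<phi>_def \<sigma>)
qed

end

theorem theorem3p6:
  fixes G :: "'g groupoid_data" and H :: "'h groupoid_data"
    and anchor :: "'h \<Rightarrow> 'g" and act :: "'g \<Rightarrow> 'h \<Rightarrow> 'h"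
  assumes "etale_lc_groupoid G" and "etale_lc_groupoid H"
    and "effective_groupoid G" and "Hausdorff_groupoid G"
    and "actor G H anchor act"
    and "induces_isomorphism G H anchor act"
  shows "\<exists>\<phi>. topological_groupoid_iso G H \<phi> \<and>
    (\<forall>h\<in>arrows H. anchor h = inv_into (arrows G) \<phi> (rng H h)) \<and>
    (\<forall>g\<in>arrows G. \<forall>h\<in>arrows H. src G g = anchor h \<longrightarrow> act g h = gcomp H (\<phi> g) h)"
proof -
  interpret G: etale_lc_groupoid G by fact
  interpret H: etale_lc_groupoid H by fact
  interpret CG: cstar_alg "groupoid_cstar G" by (rule G.Cst_cstar_alg)
  interpret CH: cstar_alg "groupoid_cstar H" by (rule H.Cst_cstar_alg)
  obtain \<Phi> where \<Phi>: "induced_hom G H anchor act \<Phi>"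
    "bij_betw \<Phi> (acarrier (groupoid_cstar G)) (to_multiplier (groupoid_cstar H) ` acarrier (groupoid_cstar H))"
    using assms(6) unfolding induces_isomorphism_def by blast
  have hom: "star_hom (groupoid_cstar G) (multiplier_algebra (groupoid_cstar H)) \<Phi>"
    and ind: "\<And>f \<xi>. \<lbrakk>f \<in> qcc G; \<xi> \<in> qcc H\<rbrakk> \<Longrightarrow>
      fst (\<Phi> (to_cstar G f)) (to_cstar H \<xi>) = to_cstar H (actor_act G H anchor act f \<xi>)"
    using \<Phi>(1) unfolding induced_hom_def by auto
  obtain \<Psi> where \<Psi>: "star_hom (groupoid_cstar G) (groupoid_cstar H) \<Psi>"
    "bij_betw \<Psi> (acarrier (groupoid_cstar G)) (acarrier (groupoid_cstar H))"
    "\<And>X. X \<in> acarrier (groupoid_cstar G) \<Longrightarrow> \<Phi> X = to_multiplier (groupoid_cstar H) (\<Psi> X)"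
    using CH.multiplier_valued_hom[OF CG.star_alg_axioms hom \<Phi>(2)] by blast
  have mult: "amult (groupoid_cstar H) (\<Psi> (to_cstar G f)) (to_cstar H \<xi>) = to_cstar H (actor_act G H anchor act f \<xi>)"
    if "f \<in> qcc G" "\<xi> \<in> qcc H" for f \<xi>
    using ind[OF that] \<Psi>(3)[OF G.to_cstar_closed[OF that(1)]] that by (simp add: to_multiplier_def)
  \<comment> \<open>The condition in \<open>induced_hom\<close> applies \<open>to_cstar H\<close> to
    a function not known to be in \<open>qcc H\<close>. Its value is a product in the completion, so
    it cannot be the junk value.\<close>
  have "actor_act G H anchor act f \<xi> \<in> qcc H" if "f \<in> qcc G" "\<xi> \<in> qcc H" for f \<xi>
  proof (rule H.to_cstar_closed_imp_qcc)
    have "\<Psi> (to_cstar G f) \<in> acarrier (groupoid_cstar H)"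
      using \<Psi>(1) that(1) G.to_cstar_closed by (auto simp: star_hom_def)
    then show "to_cstar H (actor_act G H anchor act f \<xi>) \<in> acarrier (groupoid_cstar H)"
      using mult[OF that] that CH.mult_closed H.to_cstar_closed by metis
  qed
  then interpret iso_actor G H anchor act \<Psi>
    using assms mult \<Psi>(1,2) by (intro iso_actor.intro iso_actor_axioms.intro) auto
  show ?thesis using phi_iso anchor_eq act_eq by blast
qed

end
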